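(* Consider the system $x_{t+1}=f(x_t)$, $y_t=\xi_th(x_t)$ with compact state space $X\subseteq\mathbb{R}^N$, where $f$ and $h$ satisfy the assumptions listed in the context and $x_{t+1}=f(x_t)$ has a unique physical measure $\mu$ with all Lyapunov exponents positive. If the error dynamics of $e_t=x_t-\hat x_t$ for the observer $\hat x_{t+1}=f(\hat x_t)+K(y_t)-K(\hat y_t)$, $\hat y_t=\xi_th(\hat x_t)$, is mean square exponentially (MSE) stable, then $$M\log(1-p)+2H_\mu(f)<0,$$ where $H_\mu(f)$ is the measure-theoretic entropy of $f$ corresponding to $\mu$.
   Context: Setting. $x_t\in X\subseteq\mathbb{R}^N$, $f:X\to X$, $h:X\to Y\subseteq\mathbb{R}^M$, with $M<N$. The $\xi_t\in\{0,1\}$, $t\ge 0$, are i.i.d. Bernoulli random variables with $\mathrm{Prob}(\xi_t=1)=p$, $0<p<1$ ($1-p$ is the erasure probability). $E_{\xi_0^t}[\cdot]$ denotes expectation over $\{\xi_0,\dots,\xi_t\}$. A prime denotes transpose; matrix inequalities are in the order of symmetric matrices; $\log$ is the natural logarithm. Assumptions on the system. $f$ and $h$ are $C^r$, $r\ge1$, with $f(0)=0$, $h(0)=0$, and the Jacobian $\frac{\partial f}{\partial x}(x)$ is uniformly bounded above and below for all $x\in X$ (i.e. $aI_N\le \frac{\partial f}{\partial x}'(x)\frac{\partial f}{\partial x}(x)\le bI_N$ for some constants $a,b>0$). With $\theta^{N-1}(x)=(h(x),h(f(x)),\dots,h(f^{N-1}(x)))'$, $\mathrm{rank}\left(\frac{\partial\theta^{N-1}}{\partial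 x}(x)\right)=N$ and there are $\alpha_\theta,\beta_\theta>0$ with $\alpha_\theta I_N<\frac{\partial\theta^{N-1}}{\partial x}'(x)\frac{\partial\theta^{N-1}}{\partial x}(x)<\beta_\theta I_N$ for all $x\in X$. Assumptions on the observer. $\hat x_t\in X$; the gain $K:Y\to X$ is deterministic, is not an explicit function of $\xi_t$ or its history, is $C^r$ with $r\ge 1$, and $K(0)=0$. Hence the observer reads $\hat x_{t+1}=f(\hat x_t)+\xi_tK(h(x_t))-\xi_tK(h(\hat x_t))$. MSE stability of the error dynamics: there exist positive constants $L<\infty$, $\beta<1$ such that $E_{\xi_0^t}[\|e_{t+1}\|^2]\le L\beta^t\|e_0\|^2$ for all $t\ge0$ and Lebesgue almost all initial conditions ($x_0$ and $e_0$). Physical measure. A Borel probability measure $\mu$ on $X$ is invariant if $\mu(f^{-1}(B))=\mu(B)$ for all Borel $B$; an invariant $\mu$ is ergodic if every bounded continuous $\varphi$ with $\varphi(f(x))=\varphi(x)$ is $\mu$-almost everywhere constant; an ergodic invariant $\mu$ is physical if $\lim_{n\to\infty}\frac1n\sum_{k=0}^n\varphi(f^k(x))=\int_X\varphi\,d\mu$ for a set of initial conditions $x\in X$ of positive Lebesgue measure and all continuous $\varphi:X\to\mathbb{R}$. Lyapunov exponents. Let $\Lambda(x_0)=\lim_{t\to\infty}\left(D_x^tf(x_0)'D_x^tf(x_0)\right)^{\frac1{2t}}$, where $D_xf=\frac{\partial f}{\partial x}$ and $D_x^tf(x_0):=D_xf(x_t)\cdots D_xf(x_0)$. If $\lambda^1_{exp}\ge\dots\ge\lambda^N_{exp}$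 are the eigenvalues of $\Lambda(x_0)$, the Lyapunov exponents are $\Lambda^i_{exp}=\log\lambda^i_{exp}$. Furthermore, if $\det\Lambda(x_0)\ne0$, then $\lim_{t\to\infty}\frac1t\log|\det D_x^tf(x_0)|=\log\prod_{k=1}^N\lambda^k_{exp}$. The existence of these limits is given by the Multiplicative Ergodic Theorem; the exponents are those associated with the unique physical measure, and under the uniqueness assumption the paper takes the limits to be independent of the initial condition. Entropy. $H_\mu(f)$ is the usual measure-theoretic (Kolmogorov–Sinai) entropy of $f$ with respect to $\mu$. *)

theory Defs
  imports "HOL-Probability.Probability"
begin

section \<open>Smooth maps on arbitrary subsets\<close>

text \<open>On an open set, \<open>C\<^sup>r\<close> means that all iterated directional derivatives up to order \<open>r\<close>
  exist (as total derivatives) and are continuous.\<close>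

primrec C_on_open :: "nat \<Rightarrow> 'a::euclidean_space set \<Rightarrow> ('a \<Rightarrow> 'b::euclidean_space) \<Rightarrow> bool" where
  "C_on_open 0 U f \<longleftrightarrow> continuous_on U f"
| "C_on_open (Suc r) U f \<longleftrightarrow>
     f differentiable_on U \<and> (\<forall>v. C_on_open r U (\<lambda>x. frechet_derivative f (at x) v))"

text \<open>A map with an arbitrary (for instance compact) domain \<open>S\<close> is \<open>C\<^sup>r\<close> if it is the
  restriction of a \<open>C\<^sup>r\<close> map on an open neighbourhood of \<open>S\<close>. The total function \<open>f\<close> is its
  own extension, so its Jacobian at a point of \<open>S\<close> is \<open>jacobian f (at x)\<close>.\<close>

definition C_on :: "nat \<Rightarrow> 'a::euclidean_space set \<Rightarrow> ('a \<Rightarrow> 'b::euclidean_space) \<Rightarrow> bool" where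
  "C_on r S f \<longleftrightarrow> (\<exists>U. open U \<and> S \<subseteq> U \<and> C_on_open r U f)"

section \<open>Symmetric matrices\<close>

definition pos_semidef :: "real^'n^'n \<Rightarrow> bool" where
  "pos_semidef A \<longleftrightarrow> transpose A = A \<and> (\<forall>v. 0 \<le> v \<bullet> (A *v v))"

definition pos_def :: "real^'n^'n \<Rightarrow> bool" where
  "pos_def A \<longleftrightarrow> transpose A = A \<and> (\<forall>v. v \<noteq> 0 \<longrightarrow> 0 < v \<bullet> (A *v v))"

definition mat_le :: "real^'n^'n \<Rightarrow> real^'n^'n \<Rightarrow> bool" (infix "\<preceq>" 50) where
  "A \<preceq> B \<longleftrightarrow> pos_semidef (B - A)"

definition mat_less :: "real^'n^'n \<Rightarrow> real^'n^'n \<Rightarrow> bool" (infix "\<prec>" 50) where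
  "A \<prec> B \<longleftrightarrow> pos_def (B - A)"

text \<open>The library power \<open>A ^ k\<close> on \<open>real^'n^'n\<close> is componentwise.\<close>

primrec mat_pow :: "real^'n^'n \<Rightarrow> nat \<Rightarrow> real^'n^'n" where
  "mat_pow A 0 = mat 1"
| "mat_pow A (Suc k) = A ** mat_pow A k"

section \<open>Observability map\<close>

text \<open>The map \<open>x \<mapsto> (h x, h (f x), \<dots>, h (f\<^sup>N\<^sup>-\<^sup>1 x))\<close> with values in dimension \<open>N M\<close>, where
  \<open>N = CARD('n)\<close> and \<open>M = CARD('m)\<close>. The bijection \<open>to_nat_on UNIV\<close> from \<open>'n\<close> onto
  \<open>{..<N}\<close> turns the first index into a time.\<close>

definition obs_map :: "(real^'n \<Rightarrow> real^'n) \<Rightarrow> (real^'n \<Rightarrow> real^'m) \<Rightarrow> real^'n \<Rightarrow> real^('n \<times> 'm)" where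
  "obs_map f h x = (\<chi> ij. h ((f ^^ to_nat_on (UNIV :: 'n set) (fst ij)) x) $ snd ij)"

section \<open>Observer and mean square exponential stability\<close>

primrec observer :: "(real^'n \<Rightarrow> real^'n) \<Rightarrow> (real^'n \<Rightarrow> real^'m) \<Rightarrow> (real^'m \<Rightarrow> real^'n) \<Rightarrow>
    (nat \<Rightarrow> real) \<Rightarrow> real^'n \<Rightarrow> real^'n \<Rightarrow> nat \<Rightarrow> real^'n" where
  "observer f h K \<zeta> x0 xh0 0 = xh0"
| "observer f h K \<zeta> x0 xh0 (Suc t) =
     f (observer f h K \<zeta> x0 xh0 t) + K (\<zeta> t *\<^sub>R h ((f ^^ t) x0))
       - K (\<zeta> t *\<^sub>R h (observer f h K \<zeta> x0 xh0 t))"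

definition obs_error :: "(real^'n \<Rightarrow> real^'n) \<Rightarrow> (real^'n \<Rightarrow> real^'m) \<Rightarrow> (real^'m \<Rightarrow> real^'n) \<Rightarrow>
    (nat \<Rightarrow> real) \<Rightarrow> real^'n \<Rightarrow> real^'n \<Rightarrow> nat \<Rightarrow> real^'n" where
  "obs_error f h K \<zeta> x0 e0 t = (f ^^ t) x0 - observer f h K \<zeta> x0 (x0 - e0) t"

text \<open>The error at time \<open>t + 1\<close> is a function of \<open>\<xi> 0, \<dots>, \<xi> t\<close> only, so the integral over the
  whole probability space is the expectation over these variables. Both \<open>x0\<close> and
  \<open>x0 - e0\<close> (the initial observer state) range over \<open>X\<close>.\<close>

definition mse_stable :: "'w measure \<Rightarrow> (nat \<Rightarrow> 'w \<Rightarrow> real) \<Rightarrow> (real^'n) set \<Rightarrow>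
    (real^'n \<Rightarrow> real^'n) \<Rightarrow> (real^'n \<Rightarrow> real^'m) \<Rightarrow> (real^'m \<Rightarrow> real^'n) \<Rightarrow> bool" where
  "mse_stable P \<xi> X f h K \<longleftrightarrow>
    (\<exists>L \<beta>. 0 < L \<and> 0 < \<beta> \<and> \<beta> < 1 \<and>
      (AE (x0, e0) in lebesgue. x0 \<in> X \<and> x0 - e0 \<in> X \<longrightarrow>
        (\<forall>t. (\<integral>\<omega>. (norm (obs_error f h K (\<lambda>s. \<xi> s \<omega>) x0 e0 (t + 1)))\<^sup>2 \<partial>P)
               \<le> L * \<beta> ^ t * (norm e0)\<^sup>2)))"

definition iid_bernoulli :: "'w measure \<Rightarrow> (nat \<Rightarrow> 'w \<Rightarrow> real) \<Rightarrow> real \<Rightarrow> bool" where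
  "iid_bernoulli P \<xi> p \<longleftrightarrow>
    prob_space P \<and> prob_space.indep_vars P (\<lambda>_. borel) \<xi> UNIV \<and>
    (\<forall>t. (\<forall>\<omega>\<in>space P. \<xi> t \<omega> \<in> {0, 1}) \<and> measure P {\<omega> \<in> space P. \<xi> t \<omega> = 1} = p)"

section \<open>Physical measures\<close>

definition invariant_prob :: "'a::topological_space set \<Rightarrow> ('a \<Rightarrow> 'a) \<Rightarrow> 'a measure \<Rightarrow> bool" where
  "invariant_prob X f \<mu> \<longleftrightarrow>
    prob_space \<mu> \<and> sets \<mu> = sets (restrict_space borel X) \<and>
    (\<forall>B\<in>sets \<mu>. measure \<mu> (f -` B \<inter> X) = measure \<mu> B)"

text \<open>Ergodicity is tested on continuous invariant observables.\<close>

definition ergodic_prob :: "'a::topological_space set \<Rightarrow> ('a \<Rightarrow> 'a) \<Rightarrow> 'a measure \<Rightarrow> bool" where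
  "ergodic_prob X f \<mu> \<longleftrightarrow> invariant_prob X f \<mu> \<and>
    (\<forall>\<phi> :: 'a \<Rightarrow> real. continuous_on X \<phi> \<and> bounded (\<phi> ` X) \<and> (\<forall>x\<in>X. \<phi> (f x) = \<phi> x) \<longrightarrow>
       (\<exists>c. AE x in \<mu>. \<phi> x = c))"

definition physical_measure :: "'a::euclidean_space set \<Rightarrow> ('a \<Rightarrow> 'a) \<Rightarrow> 'a measure \<Rightarrow> bool" where
  "physical_measure X f \<mu> \<longleftrightarrow> ergodic_prob X f \<mu> \<and>
    (\<exists>A. A \<subseteq> X \<and> A \<in> sets lebesgue \<and> 0 < emeasure lebesgue A \<and>
      (\<forall>x\<in>A. \<forall>\<phi> :: 'a \<Rightarrow> real. continuous_on X \<phi> \<longrightarrow>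
        (\<lambda>n. (\<Sum>k=0..n. \<phi> ((f ^^ k) x)) / real n) \<longlonglongrightarrow> (\<integral>x. \<phi> x \<partial>\<mu>)))"

section \<open>Lyapunov exponents\<close>

text \<open>The product \<open>Df(x\<^sub>t) \<cdots> Df(x\<^sub>0)\<close> along the orbit; it has \<open>t + 1\<close> factors.\<close>

primrec deriv_cocycle :: "(real^'n \<Rightarrow> real^'n) \<Rightarrow> real^'n \<Rightarrow> nat \<Rightarrow> real^'n^'n" where
  "deriv_cocycle f x 0 = jacobian f (at x)"
| "deriv_cocycle f x (Suc t) = jacobian f (at ((f ^^ Suc t) x)) ** deriv_cocycle f x t"

text \<open>\<open>Q t\<close> is the positive semidefinite root of order \<open>2 t\<close> of
  \<open>D\<^sup>tf(x)' D\<^sup>tf(x)\<close>, for \<open>t \<ge> 1\<close>.\<close>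

definition lyapunov_matrix :: "(real^'n \<Rightarrow> real^'n) \<Rightarrow> real^'n \<Rightarrow> real^'n^'n \<Rightarrow> bool" where
  "lyapunov_matrix f x \<Lambda> \<longleftrightarrow>
    (\<exists>Q. (\<forall>t\<ge>1. pos_semidef (Q t) \<and>
            mat_pow (Q t) (2 * t) = transpose (deriv_cocycle f x t) ** deriv_cocycle f x t) \<and>
         Q \<longlonglongrightarrow> \<Lambda>)"

text \<open>\<open>lexp 1 \<ge> \<dots> \<ge> lexp N\<close> are the logarithms of the eigenvalues, with multiplicity, of the limit
  matrix, which are the same at \<open>\<mu>\<close>-almost every point.\<close>

definition lyapunov_exponents ::
    "(real^'n \<Rightarrow> real^'n) \<Rightarrow> (real^'n) measure \<Rightarrow> (nat \<Rightarrow> real) \<Rightarrow> bool" where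
  "lyapunov_exponents f \<mu> lexp \<longleftrightarrow>
    (\<forall>i\<in>{1..CARD('n)}. \<forall>j\<in>{1..CARD('n)}. i \<le> j \<longrightarrow> lexp j \<le> lexp i) \<and>
    (AE x in \<mu>. \<exists>\<Lambda>. lyapunov_matrix f x \<Lambda> \<and>
       (\<forall>z. det (mat z - \<Lambda>) = (\<Prod>i=1..CARD('n). z - exp (lexp i))))"

section \<open>Kolmogorov--Sinai entropy\<close>

definition finite_partition :: "'a measure \<Rightarrow> 'a set set \<Rightarrow> bool" where
  "finite_partition \<mu> \<P> \<longleftrightarrow> finite \<P> \<and> \<P> \<subseteq> sets \<mu> \<and> partition_on (space \<mu>) \<P>"

definition partition_entropy :: "'a measure \<Rightarrow> 'a set set \<Rightarrow> real" where
  "partition_entropy \<mu> \<P> = - (\<Sum>A\<in>\<P>. measure \<mu> A * ln (measure \<mu> A))"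

text \<open>The join of the preimages of \<open>\<P>\<close> under \<open>f\<^sup>0, \<dots>, f\<^sup>n\<^sup>-\<^sup>1\<close>.\<close>

definition iterated_join :: "('a \<Rightarrow> 'a) \<Rightarrow> 'a measure \<Rightarrow> 'a set set \<Rightarrow> nat \<Rightarrow> 'a set set" where
  "iterated_join f \<mu> \<P> n =
    {{x \<in> space \<mu>. \<forall>i<n. (f ^^ i) x \<in> A i} | A. \<forall>i<n. A i \<in> \<P>} - {{}}"

definition ks_entropy :: "('a \<Rightarrow> 'a) \<Rightarrow> 'a measure \<Rightarrow> ereal" where
  "ks_entropy f \<mu> =
    (SUP \<P>\<in>{\<P>. finite_partition \<mu> \<P>}.
       ereal (lim (\<lambda>n. partition_entropy \<mu> (iterated_join f \<mu> \<P> n) / real n)))"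

end

theory Submission
  imports Defs
begin

text \<open>
  Write \<open>I\<close> for the \<open>\<mu>\<close>-integral of \<open>ln \<bar>det Df\<bar>\<close>. The result is the combination of two
  inequalities: stability forces \<open>M ln (1 - p) + 2 I < 0\<close>, and positivity of the exponents gives
  \<open>H\<^sub>\<mu>(f) \<le> I\<close>.

  \<^bold>\<open>Stability.\<close> To first order in \<open>e\<^sub>0\<close> the error is \<open>\<Phi>\<^sub>t e\<^sub>0\<close>, where
  \<open>\<Phi>\<^sub>t\<^sub>+\<^sub>1 = (A\<^sub>t - \<xi>\<^sub>t B\<^sub>t) \<Phi>\<^sub>t\<close>, \<open>A\<^sub>t = Df(x\<^sub>t)\<close>, and \<open>B\<^sub>t\<close>, the derivative of \<open>K \<circ> h\<close>,
  has rank at most \<open>M\<close> because it factors through the output. The correction \<open>B\<^sub>t\<close> is present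
  with probability \<open>p\<close> only, and changes \<open>A\<^sub>t \<Phi>\<^sub>t\<close> only inside a subspace of dimension at most
  \<open>M\<close>. So, in mean square and for every matrix \<open>R\<close>, \<open>R \<Phi>\<^sub>t\<^sub>+\<^sub>1\<close> is at least as large as
  \<open>S R A\<^sub>t \<Phi>\<^sub>t\<close>, where \<open>S\<close> shrinks that subspace by the factor \<open>sqrt (1 - p)\<close> and
  \<open>(det S)\<^sup>2 \<ge> (1 - p)\<^sup>M\<close>. As \<open>R\<close> is arbitrary this can be iterated, and the mean square of
  \<open>\<Phi>\<^sub>t\<close>, raised to the power \<open>N\<close>, dominates the product of the \<open>(1 - p)\<^sup>M (det A\<^sub>s)\<^sup>2\<close>
  (lemma \<open>mean_square_ge_det_growth\<close>). The same mean square is \<open>O(\<beta>\<^sup>t)\<close> at Lebesgue almost every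
  \<open>x\<^sub>0\<close>. Physicality of \<open>\<mu>\<close> provides a positive volume of \<open>x\<^sub>0\<close> along whose orbits the
  averages of \<open>ln \<bar>det A\<^sub>s\<bar>\<close> tend to \<open>I\<close>; a point that has both properties gives
  \<open>M ln (1 - p) + 2 I \<le> N ln \<beta> < 0\<close> (proposition \<open>mse_stable_imp_volume_growth_bound\<close>).

  \<^bold>\<open>Entropy.\<close> The second inequality is Ruelle's inequality in the absence of contraction. The
  entropy of a partition is at most the mean length of any code that determines its cells
  (lemma \<open>partition_entropy_le_code_length\<close>). An orbit of \<open>g = f\<^sup>m\<close> is coded by listing the cells of
  a fine cubic grid that it visits, each chosen among the cells that \<open>g\<close> can reach from the
  previous one (lemma \<open>partition_entropy_markov_bound\<close>). By volume comparison, at most a constant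
  times \<open>\<bar>det Dg(x)\<bar>\<close> cells can be reached from the cell of \<open>x\<close>, provided \<open>Dg(x)\<close> does not
  contract (lemma \<open>card_grid_image_le\<close>). The constant disappears after division by \<open>m\<close>, and
  positive exponents make \<open>Df\<^sup>m(x)\<close> noncontracting for all large \<open>m\<close>
  (lemma \<open>positive_exponents_imp_eventually_expanding\<close>), so the entropy is at most \<open>I\<close>
  (proposition \<open>entropy_rate_le_integral_log_jacobian\<close>).
\<close>

section \<open>Erasures cannot hide volume growth\<close>

text \<open>The squared Frobenius norm, written by columns because the columns of \<open>\<Phi>\<close> are the images
  of the coordinate directions.\<close>

definition frob_sq :: "real^'n^'m \<Rightarrow> real" where
  "frob_sq A = (\<Sum>i\<in>UNIV. (norm (column i A))\<^sup>2)"

lemma column_mult: "column i (A ** B) = A *v column i B"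
  by (simp add: column_def matrix_matrix_mult_def matrix_vector_mult_def vec_eq_iff)

lemma frob_sq_nonneg: "0 \<le> frob_sq A"
  by (simp add: frob_sq_def sum_nonneg)

lemma entry_sq_le_frob_sq: "(A $ i $ j)\<^sup>2 \<le> frob_sq A"
proof -
  have "(A $ i $ j)\<^sup>2 \<le> (norm (column j A))\<^sup>2"
    using component_le_norm_cart[of "column j A" i]
    by (simp add: column_def abs_le_square_iff[symmetric])
  also have "\<dots> \<le> frob_sq A"
    unfolding frob_sq_def by (rule member_le_sum) auto
  finally show ?thesis .
qed

text \<open>A crude form of Hadamard's inequality: every entry is bounded by the norm, so each of the
  \<open>N!\<close> terms of the Leibniz formula is. The value of the constant is irrelevant to exponential
  growth rates.\<close>

lemma det_sq_le_frob_sq: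
  fixes A :: "real^'n^'n"
  shows "(det A)\<^sup>2 \<le> (fact CARD('n))\<^sup>2 * frob_sq A ^ CARD('n)"
proof -
  let ?s = "sqrt (frob_sq A)"
  have e: "\<bar>A $ i $ j\<bar> \<le> ?s" for i j
    using real_sqrt_le_mono[OF entry_sq_le_frob_sq[of A i j]] by simp
  have s: "\<bar>real_of_int (sign q)\<bar> = 1" for q :: "'n \<Rightarrow> 'n"
    by (simp add: sign_def)
  have "\<bar>det A\<bar> \<le> (\<Sum>q | q permutes (UNIV::'n set). \<bar>of_int (sign q) * (\<Prod>i\<in>UNIV. A $ i $ q i)\<bar>)"
    unfolding det_def by (rule sum_abs)
  also have "\<dots> \<le> (\<Sum>q | q permutes (UNIV::'n set). ?s ^ CARD('n))"
  proof (rule sum_mono)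
    fix q :: "'n \<Rightarrow> 'n"
    have "(\<Prod>i\<in>UNIV. \<bar>A $ i $ q i\<bar>) \<le> (\<Prod>i\<in>(UNIV::'n set). ?s)"
      by (rule prod_mono) (simp add: e)
    then show "\<bar>of_int (sign q) * (\<Prod>i\<in>UNIV. A $ i $ q i)\<bar> \<le> ?s ^ CARD('n)"
      by (simp add: abs_mult s abs_prod)
  qed
  also have "\<dots> = fact CARD('n) * ?s ^ CARD('n)"
    by (simp add: card_permutations)
  finally have "\<bar>det A\<bar> \<le> fact CARD('n) * ?s ^ CARD('n)" .
  then have "\<bar>det A\<bar>\<^sup>2 \<le> (fact CARD('n) * ?s ^ CARD('n))\<^sup>2"
    by (rule power_mono) simp
  also have "\<dots> = (fact CARD('n))\<^sup>2 * (?s\<^sup>2) ^ CARD('n)"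
    by (simp add: power_mult_distrib power_mult[symmetric] mult.commute)
  finally show ?thesis
    using frob_sq_nonneg[of A] by simp
qed

text \<open>One step of the channel. The range of \<open>G\<close> has dimension at most \<open>M\<close>. A correction
  \<open>G w\<close> cannot reduce the component of \<open>u\<close> orthogonal to this range, and the component inside it
  survives untouched with probability \<open>1 - p\<close>. In an orthonormal basis adapted to the range, \<open>S\<close>
  is diagonal with \<open>sqrt (1 - p)\<close> on the range and \<open>1\<close> on its complement.\<close>

lemma erasure_contraction:
  fixes G :: "real^'m^'n" and p :: real
  assumes p: "0 < p" "p < 1"
  obtains S :: "real^'n^'n" where "(1 - p) ^ CARD('m) \<le> (det S)\<^sup>2"
    "\<And>u w. (norm (S *v u))\<^sup>2 \<le> (1 - p) * (norm u)\<^sup>2 + p * (norm (u - G *v w))\<^sup>2"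
proof -
  define V where "V = range ((*v) G)"
  have subV: "subspace V"
    unfolding V_def by (rule linear_subspace_image) auto
  have "V \<subseteq> span (columns G)"
    unfolding V_def by (auto simp: matrix_vector_mult_in_columnspace)
  moreover have col: "columns G = (\<lambda>i. column i G) ` UNIV"
    by (auto simp: columns_def)
  ultimately have "dim V \<le> card (columns G)"
    by (intro dim_le_card) (auto simp: col)
  also have "\<dots> \<le> CARD('m)"
    unfolding col by (rule card_image_le) simp
  finally have dimV: "dim V \<le> CARD('m)" .
  obtain B where B: "B \<subseteq> V" "pairwise orthogonal B" "\<And>x. x \<in> B \<Longrightarrow> norm x = 1" 
     "independent B" "card B = dim V" "span B = V"
    using orthonormal_basis_subspace[OF subV] by metis
  define V' where "V' = {y. \<forall>x\<in>V. orthogonal x y}"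
  have subV': "subspace V'"
    unfolding V'_def by (rule subspace_orthogonal_to_vectors)
  obtain B' where B': "B' \<subseteq> V'" "pairwise orthogonal B'" "\<And>x. x \<in> B' \<Longrightarrow> norm x = 1" 
     "independent B'" "card B' = dim V'" "span B' = V'"
    using orthonormal_basis_subspace[OF subV'] by metis
  have "dim V + dim V' = CARD('n)"
    using dim_subspace_orthogonal_to_vectors[OF subV subspace_UNIV]
    by (simp add: V'_def add.commute)
  have disj: "B \<inter> B' = {}"
  proof -
    { fix x assume x: "x \<in> B" "x \<in> B'"
      then have "orthogonal x x" using B(1) B'(1) by (auto simp: V'_def)
      then have False using B(3)[OF x(1)] by (simp add: orthogonal_def)
    } then show ?thesis by blast
  qed
  have fin: "finite B" "finite B'"
    using B(4) B'(4) by (auto intro: independent_imp_finite)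
  have "card (B \<union> B') = CARD('n)"
    using \<open>dim V + dim V' = CARD('n)\<close> fin disj B(5) B'(5) by (simp add: card_Un_disjoint)
  then obtain \<phi> where \<phi>: "bij_betw \<phi> (UNIV::'n set) (B \<union> B')"
    using fin by (metis finite_class.finite_UNIV finite_UnI finite_same_card_bij)
  define Q :: "real^'n^'n" where "Q = (\<chi> i. \<phi> i)"
  have mem: "\<phi> i \<in> B \<union> B'" for i
    using \<phi> by (auto simp: bij_betw_def)
  have inj: "\<phi> i \<noteq> \<phi> j" if "i \<noteq> j" for i j
    using \<phi> that by (auto simp: bij_betw_def inj_def)
  have rowQ: "row i Q = \<phi> i" for i
    by (simp add: Q_def row_def vec_eq_iff)
  have cross: "orthogonal x y" if "x \<in> B" "y \<in> B'" for x y
    using B(1) B'(1) that by (auto simp: V'_def)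
  have orthQ: "orthogonal_matrix Q"
    unfolding orthogonal_matrix_orthonormal_rows rowQ
  proof (intro conjI allI impI)
    show "norm (\<phi> i) = 1" for i using mem[of i] B(3) B'(3) by auto
    show "orthogonal (\<phi> i) (\<phi> j)" if "i \<noteq> j" for i j
      using mem[of i] mem[of j] inj[OF that] B(2) B'(2) cross[of "\<phi> i" "\<phi> j"] cross[of "\<phi> j" "\<phi> i"]
      by (auto simp: pairwise_def orthogonal_commute)
  qed
  define J where "J = {i. \<phi> i \<in> B}"
  have "card J = card B"
  proof -
    have "\<phi> ` J = B"
    proof
      show "B \<subseteq> \<phi> ` J"
      proof
        fix x assume x: "x \<in> B"
        then have "x \<in> range \<phi>" using \<phi> by (simp add: bij_betw_def)
        then obtain i where "x = \<phi> i" by (rule imageE)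
        then show "x \<in> \<phi> ` J" using x by (simp add: J_def)
      qed
    qed (auto simp: J_def)
    moreover have "inj_on \<phi> J" using \<phi> by (auto simp: bij_betw_def inj_on_def)
    ultimately show ?thesis by (metis card_image)
  qed
  then have cardJ: "card J \<le> CARD('m)" using dimV B(5) by simp
  define D :: "real^'n^'n" where "D = (\<chi> i j. if i = j then (if i \<in> J then sqrt (1 - p) else 1) else 0)"
  define S where "S = D ** Q"
  have detD: "det D = sqrt (1 - p) ^ card J"
  proof -
    have "det D = (\<Prod>i\<in>UNIV. D $ i $ i)" by (rule det_diagonal) (simp add: D_def)
    also have "\<dots> = (\<Prod>i\<in>UNIV. (if i \<in> J then sqrt (1 - p) else 1))" by (simp add: D_def)
    also have "\<dots> = sqrt (1 - p) ^ card J" by (simp add: prod.If_cases)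
    finally show ?thesis .
  qed
  have dS: "(det S)\<^sup>2 = (det D)\<^sup>2 * (det Q)\<^sup>2"
    by (simp add: S_def det_mul power_mult_distrib)
  have dD: "(det D)\<^sup>2 = (1 - p) ^ card J"
  proof -
    have "(sqrt (1 - p) ^ card J)\<^sup>2 = ((sqrt (1 - p))\<^sup>2) ^ card J"
      by (simp only: power_mult[symmetric] mult.commute)
    then show ?thesis using p by (simp add: detD)
  qed
  have dQ: "(det Q)\<^sup>2 = 1"
    using det_orthogonal_matrix[OF orthQ] by auto
  have "(1 - p) ^ CARD('m) \<le> (1 - p) ^ card J"
    using p cardJ by (intro power_decreasing) auto
  then have 1: "(1 - p) ^ CARD('m) \<le> (det S)\<^sup>2"
    by (simp add: dS dD dQ)
  have "orthogonal_transformation ((*v) Q)"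
    by (simp add: orthogonal_transformation_matrix orthQ)
  then have normQ: "norm (Q *v u) = norm u" for u
    by (rule orthogonal_transformation_norm)
  have nsq: "(norm x)\<^sup>2 = (\<Sum>i\<in>UNIV. (x $ i)\<^sup>2)" for x :: "real^'n"
    by (simp add: norm_vec_def L2_set_def sum_nonneg)
  have 2: "(norm (S *v u))\<^sup>2 \<le> (1 - p) * (norm u)\<^sup>2 + p * (norm (u - G *v w))\<^sup>2" for u w
  proof -
    \<comment> \<open>The correction \<open>G w\<close> is invisible in the coordinates outside \<open>J\<close>.\<close>
    let ?x = "Q *v u" and ?y = "Q *v (u - G *v w)"
    have comp: "?x $ i = ?y $ i" if "i \<notin> J" for i
    proof -
      have "\<phi> i \<in> B'" using mem[of i] that by (auto simp: J_def)
      then have "orthogonal (G *v w) (\<phi> i)" using B'(1) by (auto simp: V'_def V_def)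
      then have "(Q *v (G *v w)) $ i = 0"
        by (simp add: matrix_vector_mul_component Q_def orthogonal_def inner_commute)
      then show ?thesis by (simp add: matrix_vector_mult_diff_distrib)
    qed
    have DQ: "(S *v u) $ i = (if i \<in> J then sqrt (1 - p) else 1) * ?x $ i" for i
    proof -
      have "(S *v u) $ i = (\<Sum>j\<in>UNIV. D $ i $ j * ?x $ j)"
        unfolding S_def matrix_vector_mul_assoc[symmetric] matrix_vector_mult_def[of D] by simp
      also have "\<dots> = (\<Sum>j\<in>UNIV. if j = i then D $ i $ i * ?x $ i else 0)"
        by (rule sum.cong) (auto simp: D_def)
      also have "\<dots> = D $ i $ i * ?x $ i" by simp
      finally show ?thesis by (simp add: D_def)
    qed
    have "(norm (S *v u))\<^sup>2 = (\<Sum>i\<in>UNIV. ((S *v u) $ i)\<^sup>2)" by (rule nsq)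
    also have "\<dots> \<le> (\<Sum>i\<in>UNIV. (1 - p) * (?x $ i)\<^sup>2 + p * (?y $ i)\<^sup>2)"
    proof (rule sum_mono)
      fix i
      show "((S *v u) $ i)\<^sup>2 \<le> (1 - p) * (?x $ i)\<^sup>2 + p * (?y $ i)\<^sup>2"
      proof (cases "i \<in> J")
        case True
        then have "((S *v u) $ i)\<^sup>2 = (1 - p) * (?x $ i)\<^sup>2"
          using p by (simp add: DQ power_mult_distrib)
        then show ?thesis using p by simp
      next
        case False
        then have "((S *v u) $ i)\<^sup>2 = (?x $ i)\<^sup>2" by (simp add: DQ)
        then show ?thesis unfolding comp[OF False, symmetric] by (simp add: left_diff_distrib)
      qed
    qed
    also have "\<dots> = (1 - p) * (norm ?x)\<^sup>2 + p * (norm ?y)\<^sup>2"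
      by (simp add: nsq sum.distrib sum_distrib_left)
    finally show ?thesis by (simp add: normQ)
  qed
  show ?thesis using that 1 2 by blast
qed

text \<open>The expectation of a function of the first \<open>t\<close> erasure variables, computed by averaging over
  one variable at a time. It is monotone and linear without any integrability conditions.\<close>

primrec bernoulli_avg :: "real \<Rightarrow> nat \<Rightarrow> ((nat \<Rightarrow> real) \<Rightarrow> real) \<Rightarrow> real" where
  "bernoulli_avg p 0 F = F (\<lambda>_. 0)"
| "bernoulli_avg p (Suc t) F = (1 - p) * bernoulli_avg p t (\<lambda>\<zeta>. F (\<zeta>(t := 0)))
     + p * bernoulli_avg p t (\<lambda>\<zeta>. F (\<zeta>(t := 1)))"

lemma bernoulli_avg_mono:
  assumes p: "0 < p" "p < 1" and "\<And>\<zeta>. (\<And>t. \<zeta> t \<in> {0, 1}) \<Longrightarrow> F \<zeta> \<le> G \<zeta>"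
  shows "bernoulli_avg p t F \<le> bernoulli_avg p t G"
  using assms(3)
proof (induction t arbitrary: F G)
  case (Suc t)
  have "bernoulli_avg p t (\<lambda>\<zeta>. F (\<zeta>(t := c))) \<le> bernoulli_avg p t (\<lambda>\<zeta>. G (\<zeta>(t := c)))" if "c \<in> {0, 1}" for c
    by (rule Suc.IH, rule Suc.prems) (use that in auto)
  then show ?case using p by (auto intro!: add_mono mult_left_mono)
qed auto

lemma bernoulli_avg_const [simp]: "bernoulli_avg p t (\<lambda>_. c) = c"
  by (induction t) (auto simp: algebra_simps)

lemma bernoulli_avg_add: "bernoulli_avg p t (\<lambda>\<zeta>. F \<zeta> + G \<zeta>) = bernoulli_avg p t F + bernoulli_avg p t G"
  by (induction t arbitrary: F G) (auto simp: algebra_simps)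

lemma bernoulli_avg_cmult: "bernoulli_avg p t (\<lambda>\<zeta>. c * F \<zeta>) = c * bernoulli_avg p t F"
  by (induction t arbitrary: F) (auto simp: algebra_simps)

lemma bernoulli_avg_sum:
  "finite I \<Longrightarrow> bernoulli_avg p t (\<lambda>\<zeta>. \<Sum>i\<in>I. F i \<zeta>) = (\<Sum>i\<in>I. bernoulli_avg p t (F i))"
  by (induction I rule: finite_induct) (auto simp: bernoulli_avg_add)

primrec lin_error :: "(nat \<Rightarrow> real^'n^'n) \<Rightarrow> (nat \<Rightarrow> real^'n^'n) \<Rightarrow> (nat \<Rightarrow> real) \<Rightarrow> nat \<Rightarrow> real^'n^'n" where
  "lin_error A B \<zeta> 0 = mat 1"
| "lin_error A B \<zeta> (Suc t) = (A t - \<zeta> t *\<^sub>R B t) ** lin_error A B \<zeta> t"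

lemma lin_error_cong: "(\<And>s. s < t \<Longrightarrow> \<zeta> s = \<zeta>' s) \<Longrightarrow> lin_error A B \<zeta> t = lin_error A B \<zeta>' t"
  by (induction t) auto

text \<open>The induction works because \<open>R\<close> is arbitrary: the last factor of \<open>\<Phi>\<^sub>t\<^sub>+\<^sub>1\<close> is traded for the
  deterministic matrix \<open>S R A\<^sub>t\<close>, to which the hypothesis for \<open>t\<close> applies.\<close>

lemma mean_square_ge_det_growth:
  fixes A :: "nat \<Rightarrow> real^'n^'n" and C :: "nat \<Rightarrow> real^'m^'n" and H :: "nat \<Rightarrow> real^'n^'m"
  assumes p: "0 < p" "p < 1" and B: "\<And>t. B t = C t ** H t"
  shows "(det R)\<^sup>2 * (\<Prod>s<t. (1 - p) ^ CARD('m) * (det (A s))\<^sup>2)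
    \<le> (fact CARD('n))\<^sup>2 * bernoulli_avg p t (\<lambda>\<zeta>. frob_sq (R ** lin_error A B \<zeta> t)) ^ CARD('n)"
proof (induction t arbitrary: R)
  case 0
  show ?case using det_sq_le_frob_sq[of R] by simp
next
  case (Suc t)
  obtain S :: "real^'n^'n" where S: "(1 - p) ^ CARD('m) \<le> (det S)\<^sup>2"
    "\<And>u w. (norm (S *v u))\<^sup>2 \<le> (1 - p) * (norm u)\<^sup>2 + p * (norm (u - (R ** C t) *v w))\<^sup>2"
    using erasure_contraction[OF p, of "R ** C t"] by metis
  let ?L = "\<lambda>\<zeta>. lin_error A B \<zeta> t"
  have fr: "frob_sq ((S ** R ** A t) ** ?L \<zeta>)
     \<le> (1 - p) * frob_sq (R ** (A t ** ?L \<zeta>)) + p * frob_sq (R ** ((A t - B t) ** ?L \<zeta>))" for \<zeta>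
  proof -
    have "(norm (column i ((S ** R ** A t) ** ?L \<zeta>)))\<^sup>2
      \<le> (1 - p) * (norm (column i (R ** (A t ** ?L \<zeta>))))\<^sup>2
        + p * (norm (column i (R ** ((A t - B t) ** ?L \<zeta>))))\<^sup>2" for i
      using S(2)[of "R *v (A t *v column i (?L \<zeta>))" "H t *v column i (?L \<zeta>)"]
      by (simp add: column_mult B matrix_vector_mul_assoc[symmetric] matrix_vector_mult_diff_distrib
          matrix_vector_mult_diff_rdistrib)
    then show ?thesis
      unfolding frob_sq_def sum_distrib_left sum.distrib[symmetric] by (intro sum_mono)
  qed
  have le: "bernoulli_avg p t (\<lambda>\<zeta>. frob_sq ((S ** R ** A t) ** ?L \<zeta>))
      \<le> bernoulli_avg p (Suc t) (\<lambda>\<zeta>. frob_sq (R ** lin_error A B \<zeta> (Suc t)))"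
  proof -
    have c: "lin_error A B (\<zeta>(t := c)) t = ?L \<zeta>" for \<zeta> c by (rule lin_error_cong) auto
    have "bernoulli_avg p t (\<lambda>\<zeta>. frob_sq ((S ** R ** A t) ** ?L \<zeta>))
       \<le> bernoulli_avg p t (\<lambda>\<zeta>. (1 - p) * frob_sq (R ** (A t ** ?L \<zeta>)) + p * frob_sq (R ** ((A t - B t) ** ?L \<zeta>)))"
      by (rule bernoulli_avg_mono[OF p fr])
    also have "\<dots> = bernoulli_avg p (Suc t) (\<lambda>\<zeta>. frob_sq (R ** lin_error A B \<zeta> (Suc t)))"
      by (simp add: bernoulli_avg_add bernoulli_avg_cmult c)
    finally show ?thesis .
  qed
  have nn: "0 \<le> bernoulli_avg p t (\<lambda>\<zeta>. frob_sq ((S ** R ** A t) ** ?L \<zeta>))"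
    using bernoulli_avg_mono[OF p, of "\<lambda>_. 0" "\<lambda>\<zeta>. frob_sq ((S ** R ** A t) ** ?L \<zeta>)" t]
    by (simp add: frob_sq_nonneg)
  have "(det R)\<^sup>2 * (\<Prod>s<Suc t. (1 - p) ^ CARD('m) * (det (A s))\<^sup>2)
     = (1 - p) ^ CARD('m) * ((det R)\<^sup>2 * (det (A t))\<^sup>2 * (\<Prod>s<t. (1 - p) ^ CARD('m) * (det (A s))\<^sup>2))"
    by simp
  also have "\<dots> \<le> (det S)\<^sup>2 * ((det R)\<^sup>2 * (det (A t))\<^sup>2 * (\<Prod>s<t. (1 - p) ^ CARD('m) * (det (A s))\<^sup>2))"
    using p by (intro mult_right_mono S(1) mult_nonneg_nonneg prod_nonneg) auto
  also have "\<dots> = (det (S ** R ** A t))\<^sup>2 * (\<Prod>s<t. (1 - p) ^ CARD('m) * (det (A s))\<^sup>2)"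
    by (simp add: det_mul power_mult_distrib)
  also have "\<dots> \<le> (fact CARD('n))\<^sup>2 * bernoulli_avg p t (\<lambda>\<zeta>. frob_sq ((S ** R ** A t) ** ?L \<zeta>)) ^ CARD('n)"
    by (rule Suc.IH)
  also have "\<dots> \<le> (fact CARD('n))\<^sup>2 * bernoulli_avg p (Suc t) (\<lambda>\<zeta>. frob_sq (R ** lin_error A B \<zeta> (Suc t))) ^ CARD('n)"
    by (intro mult_left_mono power_mono le nn) auto
  finally show ?case .
qed

section \<open>Expectations over the erasure process\<close>

text \<open>Splitting \<open>F\<close> according to the value of \<open>\<xi> t\<close> produces the factors \<open>1 - \<xi> t\<close> and
  \<open>\<xi> t\<close>. Carrying a product of affine functions of later variables through the induction
  collects these factors, and independence is needed only for the final product.\<close>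

lemma expectation_times_affine_product:
  assumes iid: "iid_bernoulli P \<xi> p"
  shows "\<lbrakk>finite T; T \<inter> {..<t} = {}; \<And>\<zeta> \<zeta>'. (\<And>s. s < t \<Longrightarrow> \<zeta> s = \<zeta>' s) \<Longrightarrow> F \<zeta> = F \<zeta>'\<rbrakk> \<Longrightarrow>
    integrable P (\<lambda>\<omega>. F (\<lambda>s. \<xi> s \<omega>) * (\<Prod>s\<in>T. c s + d s * \<xi> s \<omega>)) \<and>
    (\<integral>\<omega>. F (\<lambda>s. \<xi> s \<omega>) * (\<Prod>s\<in>T. c s + d s * \<xi> s \<omega>) \<partial>P) = bernoulli_avg p t F * (\<Prod>s\<in>T. c s + d s * p)"
proof (induction t arbitrary: F T c d)
  interpret prob_space P using iid by (simp add: iid_bernoulli_def)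
  have ind: "indep_vars (\<lambda>_. borel) \<xi> UNIV" using iid by (simp add: iid_bernoulli_def)
  have meas[measurable]: "random_variable borel (\<xi> s)" for s
    using ind by (simp add: indep_vars_def)
  have val: "\<xi> s \<omega> \<in> {0, 1}" if "\<omega> \<in> space P" for s \<omega>
    using iid that by (simp add: iid_bernoulli_def)
  have int_xi: "integrable P (\<xi> s)" for s
  proof (rule integrable_const_bound[where B = 1])
    show "AE \<omega> in P. norm (\<xi> s \<omega>) \<le> 1"
      using val[of _ s] by (intro AE_I2) fastforce
  qed simp
  have exp_xi: "expectation (\<xi> s) = p" for s
  proof -
    have "expectation (\<xi> s) = expectation (indicator {\<omega> \<in> space P. \<xi> s \<omega> = 1})"
    proof (rule Bochner_Integration.integral_cong)
      fix \<omega> assume "\<omega> \<in> space P"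
      then show "\<xi> s \<omega> = indicator {\<omega> \<in> space P. \<xi> s \<omega> = 1} \<omega>"
        using val[of \<omega> s] by (auto simp: indicator_def)
    qed simp
    also have "\<dots> = p" using iid by (simp add: iid_bernoulli_def)
    finally show ?thesis .
  qed
  { case 0
    have "F (\<lambda>s. \<xi> s \<omega>) = F (\<lambda>_. 0)" for \<omega> by (rule 0) auto
    moreover have "integrable P (\<lambda>\<omega>. \<Prod>s\<in>T. c s + d s * \<xi> s \<omega>) \<and>
       (\<integral>\<omega>. (\<Prod>s\<in>T. c s + d s * \<xi> s \<omega>) \<partial>P) = (\<Prod>s\<in>T. c s + d s * p)"
    proof (cases "T = {}")
      case False
      have i: "indep_vars (\<lambda>_. borel) (\<lambda>s \<omega>. c s + d s * \<xi> s \<omega>) T"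
        using indep_vars_compose[OF indep_vars_subset[OF ind, of T], of "\<lambda>s x. c s + d s * x" "\<lambda>_. borel"]
        by (simp add: comp_def)
      have int: "integrable P (\<lambda>\<omega>. c s + d s * \<xi> s \<omega>)" for s using int_xi by simp
      show ?thesis
      proof
        show "integrable P (\<lambda>\<omega>. \<Prod>s\<in>T. c s + d s * \<xi> s \<omega>)"
          by (rule indep_vars_integrable[OF \<open>finite T\<close> i int])
        have "(\<integral>\<omega>. (\<Prod>s\<in>T. c s + d s * \<xi> s \<omega>) \<partial>P) = (\<Prod>s\<in>T. expectation (\<lambda>\<omega>. c s + d s * \<xi> s \<omega>))"
          by (rule indep_vars_lebesgue_integral[OF \<open>finite T\<close> i int])
        also have "\<dots> = (\<Prod>s\<in>T. c s + d s * p)"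
          by (rule prod.cong) (simp_all add: exp_xi int_xi prob_space)
        finally show "(\<integral>\<omega>. (\<Prod>s\<in>T. c s + d s * \<xi> s \<omega>) \<partial>P) = (\<Prod>s\<in>T. c s + d s * p)" .
      qed
    qed (simp add: prob_space)
    ultimately show ?case by simp
  next
    case (Suc t)
    let ?T = "insert t T"
    have t: "t \<notin> T" using Suc.prems by auto
    have T: "finite ?T" "?T \<inter> {..<t} = {}" using Suc.prems by auto
    let ?F = "\<lambda>b \<zeta>. F (\<zeta>(t := b))"
    have F: "?F b \<zeta> = ?F b \<zeta>'" if "\<And>s. s < t \<Longrightarrow> \<zeta> s = \<zeta>' s" for b \<zeta> \<zeta>'
      by (rule Suc.prems(3)) (use that in auto)
    let ?erased = "\<lambda>\<omega>. ?F 0 (\<lambda>s. \<xi> s \<omega>) * (\<Prod>s\<in>?T. (c(t := 1)) s + (d(t := -1)) s * \<xi> s \<omega>)"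
    let ?kept = "\<lambda>\<omega>. ?F 1 (\<lambda>s. \<xi> s \<omega>) * (\<Prod>s\<in>?T. (c(t := 0)) s + (d(t := 1)) s * \<xi> s \<omega>)"
    let ?E_erased = "bernoulli_avg p t (?F 0) * (\<Prod>s\<in>?T. (c(t := 1)) s + (d(t := -1)) s * p)"
    let ?E_kept = "bernoulli_avg p t (?F 1) * (\<Prod>s\<in>?T. (c(t := 0)) s + (d(t := 1)) s * p)"
    have I0: "integrable P ?erased \<and> (\<integral>\<omega>. ?erased \<omega> \<partial>P) = ?E_erased"
      by (rule Suc.IH[OF T]) (rule F)
    have I1: "integrable P ?kept \<and> (\<integral>\<omega>. ?kept \<omega> \<partial>P) = ?E_kept"
      by (rule Suc.IH[OF T]) (rule F)
    have pr: "(\<Prod>s\<in>?T. (c(t := u)) s + (d(t := v)) s * x s) = (u + v * x t) * (\<Prod>s\<in>T. c s + d s * x s)" for u v and x :: "nat \<Rightarrow> real"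
    proof -
      have "(\<Prod>s\<in>T. (c(t := u)) s + (d(t := v)) s * x s) = (\<Prod>s\<in>T. c s + d s * x s)"
        by (rule prod.cong) (use t in auto)
      then show ?thesis using t Suc.prems(1) by simp
    qed
    let ?g = "\<lambda>\<omega>. F (\<lambda>s. \<xi> s \<omega>) * (\<Prod>s\<in>T. c s + d s * \<xi> s \<omega>)"
    let ?h = "\<lambda>\<omega>. ?erased \<omega> + ?kept \<omega>"
    have eq: "?g \<omega> = ?h \<omega>" if "\<omega> \<in> space P" for \<omega>
    proof -
      have h: "?h \<omega> = F ((\<lambda>s. \<xi> s \<omega>)(t := 0)) * ((1 + -1 * \<xi> t \<omega>) * (\<Prod>s\<in>T. c s + d s * \<xi> s \<omega>))
          + F ((\<lambda>s. \<xi> s \<omega>)(t := 1)) * ((0 + 1 * \<xi> t \<omega>) * (\<Prod>s\<in>T. c s + d s * \<xi> s \<omega>))"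
        by (simp only: pr)
      have "\<xi> t \<omega> = 0 \<or> \<xi> t \<omega> = 1" using val[OF that, of t] by auto
      moreover have "(\<lambda>s. \<xi> s \<omega>)(t := \<xi> t \<omega>) = (\<lambda>s. \<xi> s \<omega>)" by auto
      ultimately show ?thesis unfolding h by auto
    qed
    have i: "integrable P ?h" by (intro Bochner_Integration.integrable_add conjunct1[OF I0] conjunct1[OF I1])
    have "integrable P ?g \<longleftrightarrow> integrable P ?h"
      by (rule Bochner_Integration.integrable_cong[OF refl eq])
    then have 1: "integrable P ?g" using i by (rule iffD2)
    have "(\<integral>\<omega>. ?g \<omega> \<partial>P) = (\<integral>\<omega>. ?h \<omega> \<partial>P)"
      by (rule Bochner_Integration.integral_cong[OF refl eq])
    also have "\<dots> = ?E_erased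
       + ?E_kept"
      by (subst Bochner_Integration.integral_add[OF conjunct1[OF I0] conjunct1[OF I1]])
        (simp only: conjunct2[OF I0] conjunct2[OF I1])
    also have "\<dots> = bernoulli_avg p (Suc t) F * (\<Prod>s\<in>T. c s + d s * p)"
      unfolding pr by (simp add: algebra_simps)
    finally show ?case by (rule conjI[OF 1]) }
qed

lemma expectation_eq_bernoulli_avg:
  assumes "iid_bernoulli P \<xi> p" and "\<And>\<zeta> \<zeta>'. (\<And>s. s < t \<Longrightarrow> \<zeta> s = \<zeta>' s) \<Longrightarrow> F \<zeta> = F \<zeta>'"
  shows "(\<integral>\<omega>. F (\<lambda>s. \<xi> s \<omega>) \<partial>P) = bernoulli_avg p t F"
proof -
  have "(\<integral>\<omega>. F (\<lambda>s. \<xi> s \<omega>) * (\<Prod>s\<in>({}::nat set). 1 + 1 * \<xi> s \<omega>) \<partial>P) = bernoulli_avg p t F * (\<Prod>s\<in>({}::nat set). 1 + 1 * p)"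
    by (rule conjunct2[OF expectation_times_affine_product[OF assms(1), of "{}" t F "\<lambda>_. 1" "\<lambda>_. 1"]]) (simp_all, rule assms(2))
  then show ?thesis by simp
qed

section \<open>Uniform linearization on a compact set\<close>

text \<open>The norm on \<open>real^'n^'m\<close> is the Frobenius norm, so this is the Cauchy--Schwarz inequality
  in each row.\<close>

lemma norm_matrix_vector_mult_le:
  fixes A :: "real^'n^'m"
  shows "norm (A *v x) \<le> norm A * norm x"
proof -
  have "norm (A *v x) = L2_set (\<lambda>i. norm (A $ i \<bullet> x)) UNIV"
    by (simp add: norm_vec_def[of "A *v x"] matrix_vector_mul_component)
  also have "\<dots> \<le> L2_set (\<lambda>i. norm (A $ i) * norm x) UNIV"
    by (rule L2_set_mono) (simp_all add: Cauchy_Schwarz_ineq2)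
  also have "\<dots> = norm A * norm x"
    by (simp add: norm_vec_def[of A] L2_set_left_distrib)
  finally show ?thesis .
qed

text \<open>Differentiability at the points of \<open>S\<close>, tested only on increments within \<open>S\<close>, with one
  modulus for all points. Unlike the mean value inequality it composes without convexity of \<open>S\<close>.\<close>

definition unif_diff_on ::
    "(real^'n) set \<Rightarrow> (real^'n \<Rightarrow> real^'m) \<Rightarrow> (real^'n \<Rightarrow> real^'n^'m) \<Rightarrow> bool" where
  "unif_diff_on S f D \<longleftrightarrow> (\<forall>e>0. \<exists>d>0. \<forall>x\<in>S. \<forall>y\<in>S. dist x y < d \<longrightarrow>
     norm (f y - f x - D x *v (y - x)) \<le> e * norm (y - x))"

lemma unif_diff_onD:
  assumes "unif_diff_on S f D" "0 < e"
  obtains d where "0 < d"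
    "\<And>x y. \<lbrakk>x \<in> S; y \<in> S; dist x y < d\<rbrakk> \<Longrightarrow> norm (f y - f x - D x *v (y - x)) \<le> e * norm (y - x)"
  using assms unfolding unif_diff_on_def by metis

lemma unif_diff_on_compose:
  assumes f: "unif_diff_on S f A" "bounded (A ` S)" and fST: "f ` S \<subseteq> T"
    and g: "unif_diff_on T g B" "bounded (B ` T)"
  shows "unif_diff_on S (g \<circ> f) (\<lambda>x. B (f x) ** A x)"
  unfolding unif_diff_on_def
proof (intro allI impI)
  fix e :: real assume e: "0 < e"
  obtain a where a: "0 < a" "\<And>x. x \<in> S \<Longrightarrow> norm (A x) \<le> a"
    using f(2) unfolding bounded_pos by auto
  obtain b where b: "0 < b" "\<And>y. y \<in> T \<Longrightarrow> norm (B y) \<le> b"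
    using g(2) unfolding bounded_pos by auto
  \<comment> \<open>Half of \<open>e\<close> goes to the error of \<open>g\<close>, whose increments are at most \<open>a + 1\<close> times
    as long, half to that of \<open>f\<close>, magnified by \<open>b\<close>.\<close>
  define e1 where "e1 = e / (2 * (a + 1))"
  define e2 where "e2 = min 1 (e / (2 * b))"
  have e12: "0 < e1" "0 < e2" using e a b by (auto simp: e1_def e2_def)
  obtain d1 where d1: "0 < d1"
    "\<And>x y. \<lbrakk>x \<in> T; y \<in> T; dist x y < d1\<rbrakk> \<Longrightarrow> norm (g y - g x - B x *v (y - x)) \<le> e1 * norm (y - x)"
    using unif_diff_onD[OF g(1) e12(1)] by metis
  obtain d2 where d2: "0 < d2"
    "\<And>x y. \<lbrakk>x \<in> S; y \<in> S; dist x y < d2\<rbrakk> \<Longrightarrow> norm (f y - f x - A x *v (y - x)) \<le> e2 * norm (y - x)"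
    using unif_diff_onD[OF f(1) e12(2)] by metis
  show "\<exists>d>0. \<forall>x\<in>S. \<forall>y\<in>S. dist x y < d \<longrightarrow>
      norm ((g \<circ> f) y - (g \<circ> f) x - (B (f x) ** A x) *v (y - x)) \<le> e * norm (y - x)"
  proof (intro exI[of _ "min d2 (d1 / (a + 1))"] conjI ballI impI)
    show "0 < min d2 (d1 / (a + 1))" using d1 d2 a by simp
    fix x y assume x: "x \<in> S" and y: "y \<in> S" and "dist x y < min d2 (d1 / (a + 1))"
    then have d: "dist x y < d2" "dist x y < d1 / (a + 1)" by auto
    let ?r = "f y - f x - A x *v (y - x)"
    have r: "norm ?r \<le> e2 * norm (y - x)" by (rule d2(2)[OF x y d(1)])
    have "norm (f y - f x) = norm (?r + A x *v (y - x))" by simp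
    also have "\<dots> \<le> norm ?r + norm (A x *v (y - x))" by (rule norm_triangle_ineq)
    also have "norm ?r \<le> 1 * norm (y - x)"
      using r by (rule order_trans) (intro mult_right_mono, auto simp: e2_def)
    also have "norm (A x *v (y - x)) \<le> a * norm (y - x)"
      by (rule order_trans[OF norm_matrix_vector_mult_le]) (intro mult_right_mono a x norm_ge_zero)
    finally have lip: "norm (f y - f x) \<le> (a + 1) * norm (y - x)" by (simp add: algebra_simps)
    also have "\<dots> < d1" using d(2) a by (simp add: dist_norm norm_minus_commute field_simps)
    finally have "dist (f x) (f y) < d1" by (simp add: dist_norm norm_minus_commute)
    then have "norm (g (f y) - g (f x) - B (f x) *v (f y - f x)) \<le> e1 * norm (f y - f x)"
      using x y fST by (intro d1(2)) auto
    also have "\<dots> \<le> e1 * ((a + 1) * norm (y - x))"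
      using e12 by (intro mult_left_mono lip) auto
    also have "\<dots> = e / 2 * norm (y - x)"
    proof -
      have "e1 * (a + 1) = e / 2" using a by (simp add: e1_def field_simps)
      then show ?thesis by (simp only: mult.assoc[symmetric])
    qed
    finally have p1: "norm (g (f y) - g (f x) - B (f x) *v (f y - f x)) \<le> e / 2 * norm (y - x)" .
    have "norm (B (f x) *v ?r) \<le> b * (e2 * norm (y - x))"
      by (rule order_trans[OF norm_matrix_vector_mult_le]) (use x fST b r in \<open>auto intro!: mult_mono\<close>)
    also have "\<dots> \<le> b * (e / (2 * b) * norm (y - x))"
      using b by (intro mult_left_mono mult_right_mono) (auto simp: e2_def)
    also have "\<dots> = e / 2 * norm (y - x)" using b by simp
    finally have p2: "norm (B (f x) *v ?r) \<le> e / 2 * norm (y - x)" .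
    have "(g \<circ> f) y - (g \<circ> f) x - (B (f x) ** A x) *v (y - x)
       = (g (f y) - g (f x) - B (f x) *v (f y - f x)) + B (f x) *v ?r"
      by (simp add: matrix_vector_mul_assoc[symmetric] matrix_vector_mult_diff_distrib)
    then have "norm ((g \<circ> f) y - (g \<circ> f) x - (B (f x) ** A x) *v (y - x))
       \<le> norm (g (f y) - g (f x) - B (f x) *v (f y - f x)) + norm (B (f x) *v ?r)"
      by (simp only: norm_triangle_ineq)
    also have "\<dots> \<le> e / 2 * norm (y - x) + e / 2 * norm (y - x)" by (rule add_mono[OF p1 p2])
    also have "\<dots> = e * norm (y - x)" by simp
    finally show "norm ((g \<circ> f) y - (g \<circ> f) x - (B (f x) ** A x) *v (y - x)) \<le> e * norm (y - x)" .
  qed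
qed

lemma C_on_open_imp_continuous_on: "C_on_open r U f \<Longrightarrow> continuous_on U f"
  by (cases r) (auto intro: differentiable_imp_continuous_on)

lemma C_on_subset: "C_on r S f \<Longrightarrow> T \<subseteq> S \<Longrightarrow> C_on r T f"
  unfolding C_on_def by blast

lemma C_on_jacobian:
  fixes f :: "real^'n \<Rightarrow> real^'m"
  assumes "C_on r S f" "1 \<le> r"
  obtains U where "open U" "S \<subseteq> U"
    "\<And>x. x \<in> U \<Longrightarrow> (f has_derivative (\<lambda>v. jacobian f (at x) *v v)) (at x)"
    "continuous_on U (\<lambda>x. jacobian f (at x))" "continuous_on U f"
proof -
  obtain U where U: "open U" "S \<subseteq> U" "C_on_open r U f" using assms(1) by (auto simp: C_on_def)
  obtain q where "r = Suc q" using assms(2) by (cases r) auto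
  then have d: "f differentiable_on U" and c: "\<And>v. C_on_open q U (\<lambda>x. frechet_derivative f (at x) v)"
    using U(3) by auto
  have 1: "(f has_derivative (\<lambda>v. jacobian f (at x) *v v)) (at x)" if "x \<in> U" for x
    using d U(1) that jacobian_works differentiable_on_eq_differentiable_at by blast
  have J: "jacobian f (at x) = (\<chi> i j. frechet_derivative f (at x) (axis j 1) $ i)" for x
    by (simp add: jacobian_def matrix_def)
  have 2: "continuous_on U (\<lambda>x. jacobian f (at x))"
    unfolding J by (intro continuous_on_vec_lambda continuous_on_component C_on_open_imp_continuous_on[OF c])
  show ?thesis
    using that U(1,2) 1 2 C_on_open_imp_continuous_on[OF U(3)] by blast
qed

text \<open>Close points of \<open>S\<close> are joined by a segment in a compact neighbourhood of \<open>S\<close>, on which the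
  Jacobian is uniformly continuous; the mean value inequality along the segment then applies.\<close>

lemma C_on_imp_unif_diff_on:
  fixes f :: "real^'n \<Rightarrow> real^'m"
  assumes C: "C_on r S f" "1 \<le> r" and S: "compact S"
  shows "unif_diff_on S f (\<lambda>x. jacobian f (at x))"
  unfolding unif_diff_on_def
proof (intro allI impI)
  fix e :: real assume e: "0 < e"
  let ?J = "\<lambda>x. jacobian f (at x)"
  obtain U where U: "open U" "S \<subseteq> U"
    and der: "\<And>x. x \<in> U \<Longrightarrow> (f has_derivative (\<lambda>v. ?J x *v v)) (at x)"
    and cont: "continuous_on U ?J"
    using C_on_jacobian[OF C] by metis
  obtain e0 where e0: "0 < e0" "(\<Union>x\<in>S. cball x e0) \<subseteq> U"
    using compact_subset_open_imp_cball_epsilon_subset[OF S U] by metis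
  define T where "T = (\<Union>x\<in>S. cball x e0)"
  have T: "T = {x + y | x y. x \<in> S \<and> y \<in> cball 0 e0}"
  proof (intro equalityI subsetI)
    fix z assume "z \<in> T"
    then obtain x where "x \<in> S" "dist x z \<le> e0" by (auto simp: T_def)
    then show "z \<in> {x + y | x y. x \<in> S \<and> y \<in> cball 0 e0}"
      by (intro CollectI exI[of _ x] exI[of _ "z - x"]) (auto simp: dist_norm norm_minus_commute)
  next
    fix z assume "z \<in> {x + y | x y. x \<in> S \<and> y \<in> cball 0 e0}"
    then obtain x y where "x \<in> S" "norm y \<le> e0" "z = x + y" by auto
    then show "z \<in> T" unfolding T_def by (intro UN_I[of x]) (auto simp: dist_norm)
  qed
  have "compact T" unfolding T by (intro compact_sums S compact_cball)
  moreover have "continuous_on T ?J" using cont e0 by (auto simp: T_def intro: continuous_on_subset)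
  ultimately have "uniformly_continuous_on T ?J" by (rule compact_uniformly_continuous[rotated])
  then obtain d where d: "0 < d" "\<And>x y. \<lbrakk>x \<in> T; y \<in> T; dist y x < d\<rbrakk> \<Longrightarrow> dist (?J y) (?J x) < e"
    using e unfolding uniformly_continuous_on_def by metis
  show "\<exists>d>0. \<forall>x\<in>S. \<forall>y\<in>S. dist x y < d \<longrightarrow> norm (f y - f x - ?J x *v (y - x)) \<le> e * norm (y - x)"
  proof (intro exI[of _ "min d e0"] conjI ballI impI)
    show "0 < min d e0" using d e0 by simp
    fix x y assume x: "x \<in> S" "y \<in> S" and xy: "dist x y < min d e0"
    let ?B = "ball x (min d e0)"
    have BT: "?B \<subseteq> T" using x by (auto simp: T_def)
    have BU: "?B \<subseteq> U" using BT e0 by (auto simp: T_def)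
    have xB: "x \<in> ?B" using d e0 by simp
    have "norm (f y - f x - (\<lambda>v. ?J x *v v) (y - x)) \<le> norm (y - x) * e"
    proof (rule differentiable_bound_linearization[of x y ?B f "\<lambda>z v. ?J z *v v" x e])
      show "x + t *\<^sub>R (y - x) \<in> ?B" if "t \<in> {0..1}" for t
      proof -
        have "norm (t *\<^sub>R (y - x)) \<le> norm (y - x)" using that by (simp add: mult_left_le_one_le)
        then show ?thesis using xy by (simp add: dist_norm norm_minus_commute)
      qed
      show "(f has_derivative (\<lambda>v. ?J z *v v)) (at z within ?B)" if "z \<in> ?B" for z
        using der BU that by (blast intro: has_derivative_at_withinI)
      show "onorm ((\<lambda>v. ?J z *v v) - (\<lambda>v. ?J x *v v)) \<le> e" if "z \<in> ?B" for z
      proof (rule onorm_le)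
        fix v :: "real^'n"
        have "norm (?J z - ?J x) \<le> e"
          using d(2)[of x z] that subsetD[OF BT that] subsetD[OF BT xB]
          by (simp add: dist_norm norm_minus_commute less_imp_le)
        then have "norm (?J z - ?J x) * norm v \<le> e * norm v" by (rule mult_right_mono) simp
        moreover have "((\<lambda>v. ?J z *v v) - (\<lambda>v. ?J x *v v)) v = (?J z - ?J x) *v v"
          by (simp add: matrix_vector_mult_diff_rdistrib)
        ultimately show "norm (((\<lambda>v. ?J z *v v) - (\<lambda>v. ?J x *v v)) v) \<le> e * norm v"
          using norm_matrix_vector_mult_le[of "?J z - ?J x" v] by simp
      qed
      show "x \<in> ?B" by (rule xB)
    qed
    then show "norm (f y - f x - ?J x *v (y - x)) \<le> e * norm (y - x)" by (simp add: mult.commute)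
  qed
qed

lemma continuous_on_matrix_mult:
  fixes A :: "'a::topological_space \<Rightarrow> real^'n^'m" and B :: "'a \<Rightarrow> real^'k^'n"
  assumes "continuous_on S A" "continuous_on S B"
  shows "continuous_on S (\<lambda>x. A x ** B x)"
  unfolding matrix_matrix_mult_def
  by (intro continuous_on_vec_lambda continuous_on_sum continuous_on_mult continuous_on_component assms)

lemma funpow_in: "f \<in> X \<rightarrow> X \<Longrightarrow> x \<in> X \<Longrightarrow> (f ^^ k) x \<in> X"
  by (induction k) auto

lemma funpow_continuous_on:
  "continuous_on X f \<Longrightarrow> f \<in> X \<rightarrow> X \<Longrightarrow> continuous_on X (f ^^ k)"
proof (induction k)
  case (Suc k)
  have "(f ^^ k) ` X \<subseteq> X" using Suc.prems by (auto intro: funpow_in)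
  then have "continuous_on X (f \<circ> (f ^^ k))"
    using Suc by (intro continuous_on_compose) (auto intro: continuous_on_subset)
  then show ?case by simp
qed (simp add: continuous_on_id id_def)

lemma deriv_cocycle_continuous_on:
  assumes "continuous_on X f" "f \<in> X \<rightarrow> X" "continuous_on X (\<lambda>x. jacobian f (at x))"
  shows "continuous_on X (\<lambda>x. deriv_cocycle f x t)"
proof (induction t)
  case (Suc t)
  have "(f ^^ Suc t) ` X \<subseteq> X" using assms(2) by (auto intro: funpow_in simp del: funpow.simps)
  then have "continuous_on X (\<lambda>x. jacobian f (at ((f ^^ Suc t) x)))"
    using continuous_on_compose[OF funpow_continuous_on[OF assms(1,2), of "Suc t"],
        OF continuous_on_subset[OF assms(3)]] by (simp only: comp_def)
  then show ?case using Suc by (simp only: deriv_cocycle.simps) (rule continuous_on_matrix_mult)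
qed (use assms in simp)

lemma deriv_cocycle_unif_diff_on:
  assumes X: "compact X" and f: "f \<in> X \<rightarrow> X" "C_on r X f" "1 \<le> r"
  shows "unif_diff_on X (f ^^ Suc t) (\<lambda>x. deriv_cocycle f x t)"
proof -
  obtain U where U: "X \<subseteq> U" "continuous_on U (\<lambda>x. jacobian f (at x))" "continuous_on U f"
    using C_on_jacobian[OF f(2,3)] by metis
  have cf: "continuous_on X f" and cJ: "continuous_on X (\<lambda>x. jacobian f (at x))"
    using U continuous_on_subset by blast+
  have bd: "bounded ((\<lambda>x. deriv_cocycle f x t) ` X)" for t
    by (intro compact_imp_bounded compact_continuous_image deriv_cocycle_continuous_on cf f cJ X)
  have ud: "unif_diff_on X f (\<lambda>x. jacobian f (at x))" by (rule C_on_imp_unif_diff_on[OF f(2,3) X])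
  show ?thesis
  proof (induction t)
    case (Suc t)
    have "unif_diff_on X (f \<circ> (f ^^ Suc t)) (\<lambda>x. jacobian f (at ((f ^^ Suc t) x)) ** deriv_cocycle f x t)"
    proof (rule unif_diff_on_compose[OF Suc bd _ ud])
      show "(f ^^ Suc t) ` X \<subseteq> X" using f(1) by (auto intro: funpow_in simp del: funpow.simps)
      show "bounded ((\<lambda>x. jacobian f (at x)) ` X)" using bd[of 0] by simp
    qed
    then show ?case by (simp add: comp_def)
  qed (use ud in simp)
qed

lemma norm_lin_error_le:
  assumes "\<And>s::nat. \<zeta> s \<in> {0, 1}"
  shows "norm (lin_error A B \<zeta> t *v v) \<le> (\<Prod>s<t. norm (A s) + norm (B s)) * norm v"
proof (induction t)
  case (Suc t)
  let ?w = "lin_error A B \<zeta> t *v v"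
  have "norm (lin_error A B \<zeta> (Suc t) *v v) \<le> norm (A t - \<zeta> t *\<^sub>R B t) * norm ?w"
    using norm_matrix_vector_mult_le[of "A t - \<zeta> t *\<^sub>R B t" ?w] by (simp add: matrix_vector_mul_assoc)
  also have "norm (A t - \<zeta> t *\<^sub>R B t) \<le> norm (A t) + norm (B t)"
    using norm_triangle_ineq4[of "A t" "B t"] assms[of t] by auto
  finally have "norm (lin_error A B \<zeta> (Suc t) *v v) \<le> (norm (A t) + norm (B t)) * norm ?w"
    by (simp add: mult_right_mono)
  also have "\<dots> \<le> (norm (A t) + norm (B t)) * ((\<Prod>s<t. norm (A s) + norm (B s)) * norm v)"
    by (intro mult_left_mono Suc) auto
  finally show ?case by (simp add: ac_simps)
qed simp

text \<open>The threshold \<open>d\<close> does not depend on \<open>\<zeta>\<close>. This uniformity lets the linearization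
  be averaged over all erasure patterns.\<close>

lemma error_linearization:
  fixes f :: "real^'n \<Rightarrow> real^'n" and h :: "real^'n \<Rightarrow> real^'m"
  assumes f: "unif_diff_on X f A" and G: "unif_diff_on X (K \<circ> h) B"
    and fX: "f \<in> X \<rightarrow> X" and x: "x \<in> X"
    and obs: "\<And>xh (\<zeta> :: nat \<Rightarrow> real) t. \<lbrakk>xh \<in> X; \<And>s. \<zeta> s \<in> {0, 1}\<rbrakk> \<Longrightarrow> observer f h K \<zeta> x xh t \<in> X"
    and e: "0 < e"
  shows "\<exists>d>0. \<forall>xh\<in>X. \<forall>\<zeta> :: nat \<Rightarrow> real. (\<forall>s. \<zeta> s \<in> {0, 1}) \<longrightarrow> dist xh x < d \<longrightarrow>
    norm (obs_error f h K \<zeta> x (x - xh) t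
        - lin_error (\<lambda>s. A ((f ^^ s) x)) (\<lambda>s. B ((f ^^ s) x)) \<zeta> t *v (x - xh)) \<le> e * norm (x - xh)"
  using e
proof (induction t arbitrary: e)
  case 0
  then show ?case by (intro exI[of _ 1]) (auto simp: obs_error_def)
next
  case (Suc t)
  let ?A = "\<lambda>s. A ((f ^^ s) x)" and ?B = "\<lambda>s. B ((f ^^ s) x)"
  let ?\<Phi> = "\<lambda>\<zeta>. lin_error ?A ?B \<zeta>"
  define c where "c = (\<Prod>s<t. norm (?A s) + norm (?B s)) + 1"
  have c: "1 \<le> c" by (auto simp: c_def intro!: prod_nonneg)
  define b where "b = norm (?A t) + norm (?B t) + 1"
  have b: "1 \<le> b" by (simp add: b_def)
  \<comment> \<open>Three errors of size \<open>e / 3\<close>: those of \<open>f\<close> and of \<open>K \<circ> h\<close> at time \<open>t\<close>, and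
    the inherited one, magnified by at most \<open>b\<close>. The
    error at time \<open>t\<close> is at most \<open>c\<close> times the initial one.\<close>
  define e1 where "e1 = e / (3 * c)"
  define e2 where "e2 = min 1 (e / (3 * b))"
  have e12: "0 < e1" "0 < e2" using Suc.prems b c by (auto simp: e1_def e2_def)
  obtain d1 where d1: "0 < d1"
    "\<And>x y. \<lbrakk>x \<in> X; y \<in> X; dist x y < d1\<rbrakk> \<Longrightarrow> norm (f y - f x - A x *v (y - x)) \<le> e1 * norm (y - x)"
    using unif_diff_onD[OF f e12(1)] by metis
  obtain d2 where d2: "0 < d2"
    "\<And>x y. \<lbrakk>x \<in> X; y \<in> X; dist x y < d2\<rbrakk> \<Longrightarrow> norm ((K \<circ> h) y - (K \<circ> h) x - B x *v (y - x)) \<le> e1 * norm (y - x)"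
    using unif_diff_onD[OF G e12(1)] by metis
  obtain d3 where d3: "0 < d3"
    "\<And>xh (\<zeta> :: nat \<Rightarrow> real). \<lbrakk>xh \<in> X; \<And>s. \<zeta> s \<in> {0, 1}; dist xh x < d3\<rbrakk> \<Longrightarrow>
      norm (obs_error f h K \<zeta> x (x - xh) t - ?\<Phi> \<zeta> t *v (x - xh)) \<le> e2 * norm (x - xh)"
    using Suc.IH[OF e12(2)] by metis
  define d where "d = min d3 (min d1 d2 / c)"
  show ?case
  proof (intro exI[of _ d] conjI ballI allI impI)
    show "0 < d" using d1 d2 d3 c by (simp add: d_def)
    fix xh and \<zeta> :: "nat \<Rightarrow> real" assume xh: "xh \<in> X" and \<zeta>: "\<forall>s. \<zeta> s \<in> {0, 1}" and "dist xh x < d"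
    then have dd: "dist xh x < d3" "dist xh x < min d1 d2 / c" by (auto simp: d_def)
    define xt where "xt = (f ^^ t) x"
    define ot where "ot = observer f h K \<zeta> x xh t"
    define v where "v = x - xh"
    have X: "xt \<in> X" "ot \<in> X" using fX x xh \<zeta> by (auto simp: xt_def ot_def intro: funpow_in obs)
    have E: "obs_error f h K \<zeta> x v t = xt - ot"
      by (simp add: obs_error_def xt_def ot_def v_def)
    have r: "norm (xt - ot - ?\<Phi> \<zeta> t *v v) \<le> e2 * norm v"
      using d3(2)[of xh \<zeta>, OF xh _ dd(1)] \<zeta> E by (simp add: v_def)
    have "norm (xt - ot) \<le> norm (xt - ot - ?\<Phi> \<zeta> t *v v) + norm (?\<Phi> \<zeta> t *v v)"
      using norm_triangle_ineq[of "xt - ot - ?\<Phi> \<zeta> t *v v" "?\<Phi> \<zeta> t *v v"] by simp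
    also have "norm (xt - ot - ?\<Phi> \<zeta> t *v v) \<le> 1 * norm v"
      using r by (rule order_trans) (intro mult_right_mono, auto simp: e2_def)
    also have "norm (?\<Phi> \<zeta> t *v v) \<le> (\<Prod>s<t. norm (?A s) + norm (?B s)) * norm v"
      by (rule norm_lin_error_le) (use \<zeta> in blast)
    finally have lip: "norm (xt - ot) \<le> c * norm v" by (simp add: c_def algebra_simps)
    also have "\<dots> < min d1 d2" using dd(2) c by (simp add: v_def dist_norm norm_minus_commute field_simps)
    finally have near: "dist xt ot < d1" "dist xt ot < d2" by (auto simp: dist_norm)
    have lip': "e1 * norm (ot - xt) \<le> e / 3 * norm v"
    proof -
      have "e1 * norm (ot - xt) \<le> e1 * (c * norm v)"
        using lip e12 by (intro mult_left_mono) (auto simp: norm_minus_commute)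
      also have "\<dots> = e / 3 * norm v" using c by (simp add: e1_def)
      finally show ?thesis .
    qed
    let ?rf = "f ot - f xt - A xt *v (ot - xt)"
    let ?rG = "K (h ot) - K (h xt) - B xt *v (ot - xt)"
    let ?M = "A xt - \<zeta> t *\<^sub>R B xt"
    have rf: "norm ?rf \<le> e / 3 * norm v" using d1(2)[OF X near(1)] lip' by linarith
    have "norm ?rG \<le> e / 3 * norm v" using d2(2)[OF X near(2)] lip' by simp
    then have rG: "norm (\<zeta> t *\<^sub>R ?rG) \<le> e / 3 * norm v"
      using \<zeta>[rule_format, of t] Suc.prems by auto
    have rM: "norm (?M *v (xt - ot - ?\<Phi> \<zeta> t *v v)) \<le> e / 3 * norm v"
    proof -
      have "norm ?M \<le> b"
        using norm_triangle_ineq4[of "A xt" "B xt"] \<zeta>[rule_format, of t] by (auto simp: b_def xt_def)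
      then have "norm (?M *v (xt - ot - ?\<Phi> \<zeta> t *v v)) \<le> b * (e2 * norm v)"
        by (intro order_trans[OF norm_matrix_vector_mult_le] mult_mono r) (use b in auto)
      also have "\<dots> \<le> b * (e / (3 * b) * norm v)"
        using b by (intro mult_left_mono mult_right_mono) (auto simp: e2_def)
      also have "\<dots> = e / 3 * norm v" using b by simp
      finally show ?thesis .
    qed
    have E': "obs_error f h K \<zeta> x v (Suc t) = (f xt - f ot) - \<zeta> t *\<^sub>R (K (h xt) - K (h ot))"
      using \<zeta>[rule_format, of t] by (auto simp: obs_error_def xt_def ot_def v_def)
    have "obs_error f h K \<zeta> x v (Suc t) - ?\<Phi> \<zeta> (Suc t) *v v
        = - ?rf + \<zeta> t *\<^sub>R ?rG + ?M *v (xt - ot - ?\<Phi> \<zeta> t *v v)"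
    proof -
      have P: "?\<Phi> \<zeta> (Suc t) *v v = ?M *v (?\<Phi> \<zeta> t *v v)"
        by (simp add: xt_def matrix_vector_mul_assoc)
      have M: "?M *v u = A xt *v u - \<zeta> t *\<^sub>R (B xt *v u)" for u
        by (simp add: matrix_vector_mult_diff_rdistrib scaleR_matrix_vector_assoc)
      show ?thesis unfolding E' P matrix_vector_mult_diff_distrib M
        by (simp add: algebra_simps scaleR_diff_right)
    qed
    also have "norm \<dots> \<le> norm ?rf + norm (\<zeta> t *\<^sub>R ?rG) + norm (?M *v (xt - ot - ?\<Phi> \<zeta> t *v v))"
      using norm_triangle_ineq[of "- ?rf" "\<zeta> t *\<^sub>R ?rG"]
        norm_triangle_ineq[of "- ?rf + \<zeta> t *\<^sub>R ?rG" "?M *v (xt - ot - ?\<Phi> \<zeta> t *v v)"]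
      unfolding norm_minus_cancel by linarith
    also have "\<dots> \<le> e * norm v" using rf rG rM by (simp add: field_simps)
    finally show "norm (obs_error f h K \<zeta> x (x - xh) (Suc t) - ?\<Phi> \<zeta> (Suc t) *v (x - xh)) \<le> e * norm (x - xh)"
      by (simp only: v_def)
  qed
qed

section \<open>Directions in which a set of positive measure accumulates\<close>

text \<open>Points that are isolated on their line to within \<open>1/n\<close> form a bounded set \<open>I\<close> whose
  translates by distinct multiples of \<open>u\<close> smaller than \<open>1/n\<close> are disjoint. Infinitely many
  disjoint translates fit into a bounded region, so \<open>I\<close> is a null set.\<close>

lemma isolated_along_direction_negligible:
  fixes S :: "'a::euclidean_space set"
  assumes S: "compact S" and u: "u \<noteq> 0"
  shows "negligible {x \<in> S. \<exists>d>0. \<forall>s. 0 < \<bar>s\<bar> \<and> \<bar>s\<bar> < d \<longrightarrow> x + s *\<^sub>R u \<notin> S}"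
proof -
  define I where "I n = {x \<in> S. \<forall>s. 0 < \<bar>s\<bar> \<and> \<bar>s\<bar> \<le> 1 / real (Suc n) \<longrightarrow> x + s *\<^sub>R u \<notin> S}" for n
  have "negligible (I n)" for n
  proof -
    define J where "J k = {s. 1 / real (Suc k) \<le> \<bar>s\<bar> \<and> \<bar>s\<bar> \<le> 1 / real (Suc n)}" for k
    define T where "T k = (\<lambda>(y, s). y - s *\<^sub>R u) ` (S \<times> J k)" for k
    have "compact (J k)" for k
    proof -
      have "J k = {1 / real (Suc k)..1 / real (Suc n)} \<union> {- (1 / real (Suc n))..- (1 / real (Suc k))}"
      proof -
        have "{s::real. a \<le> \<bar>s\<bar> \<and> \<bar>s\<bar> \<le> b} = {a..b} \<union> {- b..- a}" if "0 < a" for a b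
          using that by (auto simp: abs_if)
        then show ?thesis unfolding J_def by simp
      qed
      then show ?thesis by (simp add: compact_Un)
    qed
    then have "compact (T k)" for k
      unfolding T_def by (intro compact_continuous_image compact_Times S)
        (auto simp: case_prod_beta intro!: continuous_intros)
    then have Tk: "T k \<in> sets lebesgue" for k by (simp add: compact_imp_closed borel_closed)
    have IT: "I n = S - (\<Union>k. T k)"
    proof (intro equalityI subsetI DiffI)
      fix x assume x: "x \<in> I n"
      then show "x \<in> S" by (simp add: I_def)
      show "x \<notin> (\<Union>k. T k)"
      proof
        assume "x \<in> (\<Union>k. T k)"
        then obtain k y s where ys: "x = y - s *\<^sub>R u" "y \<in> S" "s \<in> J k" by (auto simp: T_def)
        then have "0 < \<bar>s\<bar>" "\<bar>s\<bar> \<le> 1 / real (Suc n)"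
          by (auto simp: J_def intro: less_le_trans[of 0 "1 / real (Suc k)"])
        then have "x + s *\<^sub>R u \<notin> S" using x by (auto simp: I_def)
        then show False using ys by simp
      qed
    next
      fix x assume x: "x \<in> S - (\<Union>k. T k)"
      have "x + s *\<^sub>R u \<notin> S" if s: "0 < \<bar>s\<bar>" "\<bar>s\<bar> \<le> 1 / real (Suc n)" for s
      proof
        assume y: "x + s *\<^sub>R u \<in> S"
        obtain k where "1 / real (Suc k) < \<bar>s\<bar>" using s(1) by (metis nat_approx_posE)
        then have "s \<in> J k" using s by (simp add: J_def)
        then have "x \<in> T k" unfolding T_def using y by (intro image_eqI[of _ _ "(x + s *\<^sub>R u, s)"]) auto
        then show False using x by auto
      qed
      then show "x \<in> I n" using x by (simp add: I_def)
    qed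
    have meas: "I n \<in> sets lebesgue"
      unfolding IT using S Tk by (intro sets.Diff sets.countable_UN) (auto simp: compact_imp_closed borel_closed)
    have bdd: "bounded (I n)" using compact_imp_bounded[OF S] by (rule bounded_subset) (auto simp: I_def)
    have lm: "I n \<in> lmeasurable" using bdd meas by (rule bounded_set_imp_lmeasurable)
    \<comment> \<open>Distinct shifts below \<open>1 / (n + 1)\<close>.\<close>
    define c where "c k = 1 / (real (Suc n) * real (k + 2))" for k
    define V where "V k = (+) (c k *\<^sub>R u) ` I n" for k
    have c0: "0 < c k" for k by (simp add: c_def)
    have c1: "c k < 1 / real (Suc n)" for k
      unfolding c_def by (rule divide_strict_left_mono) auto
    note c01 = c0 c1
    have cinj: "c j \<noteq> c k" if "j \<noteq> k" for j k using that by (simp add: c_def)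
    obtain r where r: "\<And>x. x \<in> I n \<Longrightarrow> norm x \<le> r" using bdd by (auto simp: bounded_iff)
    let ?R = "r + norm u"
    have VR: "V k \<subseteq> cball 0 ?R" for k
    proof
      fix z assume "z \<in> V k"
      then obtain x where x: "x \<in> I n" "z = c k *\<^sub>R u + x" by (auto simp: V_def)
      have "1 / real (Suc n) \<le> 1" by simp
      then have "c k \<le> 1" using c1[of k] by linarith
      then have "norm (c k *\<^sub>R u) \<le> norm u" using c01[of k] by (simp add: mult_left_le_one_le)
      then have "norm z \<le> ?R" unfolding x using r[OF x(1)] by (intro norm_triangle_le) simp
      then show "z \<in> cball 0 ?R" by simp
    qed
    have disj: "disjoint_family V"
      unfolding disjoint_family_on_def
    proof (intro ballI impI, rule ccontr)
      fix j k assume "j \<noteq> k" and "V j \<inter> V k \<noteq> {}"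
      then obtain x y where xy: "x \<in> I n" "y \<in> I n" "c j *\<^sub>R u + x = c k *\<^sub>R u + y" by (auto simp: V_def)
      have "x + (c j - c k) *\<^sub>R u = y" using xy(3) by (simp add: algebra_simps)
      moreover have "0 < \<bar>c j - c k\<bar>" "\<bar>c j - c k\<bar> \<le> 1 / real (Suc n)"
        using cinj[OF \<open>j \<noteq> k\<close>] c01[of j] c01[of k] by auto
      ultimately have "y \<notin> S" using xy(1) by (auto simp: I_def)
      then show False using xy(2) by (simp add: I_def)
    qed
    have Vm: "V k \<in> lmeasurable" for k unfolding V_def by (rule measurable_translation[OF lm])
    have "real m * measure lebesgue (I n) \<le> measure lebesgue (cball (0::'a) ?R)" for m
    proof -
      have "real m * measure lebesgue (I n) = (\<Sum>k<m. measure lebesgue (V k))"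
        by (simp add: V_def measure_translation)
      also have "\<dots> = measure lebesgue (\<Union>k<m. V k)"
      proof (rule measure_finite_Union[symmetric])
        show "V ` {..<m} \<subseteq> sets lebesgue" using fmeasurableD[OF Vm] by blast
        show "disjoint_family_on V {..<m}" using disj by (auto simp: disjoint_family_on_def)
        show "emeasure lebesgue (V k) \<noteq> \<infinity>" for k using fmeasurableD2[OF Vm] by simp
      qed simp
      also have "\<dots> \<le> measure lebesgue (cball (0::'a) ?R)"
        using VR Vm by (intro measure_mono_fmeasurable UN_least) (auto intro: fmeasurableD)
      finally show ?thesis .
    qed
    then have "measure lebesgue (I n) \<le> 0"
      by (metis not_le reals_Archimedean3)
    then have "measure lebesgue (I n) = 0" by (simp add: measure_le_0_iff)
    then show ?thesis using lm by (simp add: negligible_iff_measure)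
  qed
  then have "negligible (\<Union>n. I n)" by (rule negligible_Union_nat)
  then show ?thesis
  proof (rule negligible_subset)
    show "{x \<in> S. \<exists>d>0. \<forall>s. 0 < \<bar>s\<bar> \<and> \<bar>s\<bar> < d \<longrightarrow> x + s *\<^sub>R u \<notin> S} \<subseteq> (\<Union>n. I n)"
    proof
      fix x assume "x \<in> {x \<in> S. \<exists>d>0. \<forall>s. 0 < \<bar>s\<bar> \<and> \<bar>s\<bar> < d \<longrightarrow> x + s *\<^sub>R u \<notin> S}"
      then obtain d where x: "x \<in> S" "d > 0" "\<And>s. 0 < \<bar>s\<bar> \<Longrightarrow> \<bar>s\<bar> < d \<Longrightarrow> x + s *\<^sub>R u \<notin> S" by auto
      obtain n where "1 / real (Suc n) < d" using x(2) by (metis nat_approx_posE)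
      then have "x \<in> I n" using x by (auto simp: I_def)
      then show "x \<in> (\<Union>n. I n)" by blast
    qed
  qed
qed

text \<open>The points near which \<open>X\<close> has positive volume. A property that holds almost everywhere in
  \<open>X\<close> holds at points of \<open>X\<close> arbitrarily close to them.\<close>

definition lebesgue_support :: "'a::euclidean_space set \<Rightarrow> 'a set" where
  "lebesgue_support X = {x \<in> X. \<forall>U. open U \<longrightarrow> x \<in> U \<longrightarrow> \<not> negligible (X \<inter> U)}"

text \<open>A point of \<open>X\<close> outside the support lies in a basic open set that meets \<open>X\<close> in a null set,
  and a basis can be chosen countable.\<close>

lemma negligible_diff_lebesgue_support: "negligible (X - lebesgue_support X)"
proof -
  obtain B :: "'a set set" where B: "countable B" "topological_basis B"
    using ex_countable_basis by auto
  let ?N = "{X \<inter> b | b. b \<in> B \<and> negligible (X \<inter> b)}"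
  have "countable ?N"
    by (rule countable_subset[OF _ countable_image[OF B(1), of "\<lambda>b. X \<inter> b"]]) auto
  moreover have "negligible N" if "N \<in> ?N" for N using that by auto
  ultimately have "(\<Union>N\<in>?N. N) \<in> null_sets lebesgue"
    by (intro null_sets_UN') (auto simp: negligible_iff_null_sets)
  then have "negligible (\<Union>?N)" by (simp add: negligible_iff_null_sets)
  then show ?thesis
  proof (rule negligible_subset)
    show "X - lebesgue_support X \<subseteq> \<Union>?N"
    proof
      fix x assume "x \<in> X - lebesgue_support X"
      then obtain U where U: "x \<in> X" "open U" "x \<in> U" "negligible (X \<inter> U)" by (auto simp: lebesgue_support_def)
      obtain b where b: "b \<in> B" "x \<in> b" "b \<subseteq> U" using topological_basisE[OF B(2) U(2,3)] by blast
      have "negligible (X \<inter> b)" using U(4) by (rule negligible_subset) (use b in auto)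
      then show "x \<in> \<Union>?N" using b U(1) by blast
    qed
  qed
qed

lemma compact_lebesgue_support: "compact X \<Longrightarrow> compact (lebesgue_support X)"
proof -
  assume X: "compact X"
  have "lebesgue_support X = X - \<Union>{U. open U \<and> negligible (X \<inter> U)}"
    by (auto simp: lebesgue_support_def)
  moreover have "open (\<Union>{U. open U \<and> negligible (X \<inter> U)})" by (rule open_Union) auto
  ultimately show ?thesis using X by (simp add: compact_diff)
qed

section \<open>Mean square stability bounds volume growth\<close>

lemma AE_lborel_imp_negligible:
  assumes "AE x in lborel. R (x::'a::euclidean_space)"
  shows "negligible {x. \<not> R x}"
proof -
  have "AE x in lebesgue. R x" using assms by (rule AE_completion)
  then obtain N where "{x \<in> space lebesgue. \<not> R x} \<subseteq> N" "N \<in> null_sets lebesgue"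
    unfolding eventually_ae_filter by blast
  then show ?thesis
    unfolding negligible_iff_null_sets[symmetric] by (auto intro: negligible_subset)
qed

definition mean_square_error :: "'w measure \<Rightarrow> (nat \<Rightarrow> 'w \<Rightarrow> real) \<Rightarrow> (real^'n \<Rightarrow> real^'n) \<Rightarrow>
    (real^'n \<Rightarrow> real^'m) \<Rightarrow> (real^'m \<Rightarrow> real^'n) \<Rightarrow> real^'n \<Rightarrow> real^'n \<Rightarrow> nat \<Rightarrow> real" where
  "mean_square_error P \<xi> f h K x e t = (\<integral>\<omega>. (norm (obs_error f h K (\<lambda>s. \<xi> s \<omega>) x e t))\<^sup>2 \<partial>P)"

text \<open>Fubini's theorem, in the coordinates \<open>(x\<^sub>0, y)\<close> with \<open>y = x\<^sub>0 - e\<^sub>0\<close> the initial state of the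
  observer.\<close>

lemma mse_stable_fibrewise:
  assumes "mse_stable P \<xi> X f h K"
  obtains L \<beta> N where "0 < L" "0 < \<beta>" "\<beta> < 1" "negligible N"
    "\<And>x. \<lbrakk>x \<in> X; x \<notin> N\<rbrakk> \<Longrightarrow> \<exists>M. negligible M \<and> (\<forall>y\<in>X - M. \<forall>t.
        mean_square_error P \<xi> f h K x (x - y) (t + 1) \<le> L * \<beta> ^ t * (norm (x - y))\<^sup>2)"
proof -
  define Q where "Q L \<beta> x e \<longleftrightarrow> (x \<in> X \<and> x - e \<in> X \<longrightarrow> (\<forall>t.
        mean_square_error P \<xi> f h K x e (t + 1) \<le> L * \<beta> ^ t * (norm e)\<^sup>2))" for L \<beta> x e
  obtain L \<beta> where L: "0 < L" "0 < \<beta>" "\<beta> < 1" and ae: "AE z in lebesgue. case z of (x, e) \<Rightarrow> Q L \<beta> x e"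
    using assms unfolding mse_stable_def Q_def mean_square_error_def by auto
  have "AE z in lborel \<Otimes>\<^sub>M lborel. case z of (x, e) \<Rightarrow> Q L \<beta> x e"
    using ae by (simp only: AE_completion_iff lborel_prod)
  then have "AE x in lborel. AE e in lborel. Q L \<beta> x e"
    using lborel_pair.AE_pair[of "\<lambda>z. case z of (x, e) \<Rightarrow> Q L \<beta> x e"] by simp
  then have neg: "negligible {x. \<not> (AE e in lborel. Q L \<beta> x e)}" by (rule AE_lborel_imp_negligible)
  show ?thesis
  proof (rule that[OF L neg])
    fix x assume x: "x \<in> X" "x \<notin> {x. \<not> (AE e in lborel. Q L \<beta> x e)}"
    then have "negligible {e. \<not> Q L \<beta> x e}" using AE_lborel_imp_negligible by blast
    then have "negligible ((\<lambda>e. x - e) ` {e. \<not> Q L \<beta> x e})"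
      by (rule negligible_differentiable_image_negligible[OF order_refl]) (auto intro!: derivative_intros)
    moreover have "Q L \<beta> x (x - y)" if "y \<notin> (\<lambda>e. x - e) ` {e. \<not> Q L \<beta> x e}" for y
      using that by (metis (mono_tags, lifting) diff_diff_eq2 add_diff_cancel_left' image_eqI mem_Collect_eq)
    ultimately show "\<exists>M. negligible M \<and> (\<forall>y\<in>X - M. \<forall>t.
        mean_square_error P \<xi> f h K x (x - y) (t + 1) \<le> L * \<beta> ^ t * (norm (x - y))\<^sup>2)"
      using x(1) unfolding Q_def by (intro exI[of _ "(\<lambda>e. x - e) ` {e. \<not> Q L \<beta> x e}"]) (auto simp: Q_def)
  qed
qed

lemma observer_cong: "(\<And>s. s < t \<Longrightarrow> \<zeta> s = \<zeta>' s) \<Longrightarrow> observer f h K \<zeta> x y t = observer f h K \<zeta>' x y t"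
  by (induction t) auto

lemma mean_square_error_eq_avg:
  assumes "iid_bernoulli P \<xi> p"
  shows "mean_square_error P \<xi> f h K x e t
    = bernoulli_avg p t (\<lambda>\<zeta>. (norm (obs_error f h K \<zeta> x e t))\<^sup>2)"
unfolding mean_square_error_def
proof (rule expectation_eq_bernoulli_avg[OF assms])
  fix \<zeta> \<zeta>' :: "nat \<Rightarrow> real" assume "\<And>s. s < t \<Longrightarrow> \<zeta> s = \<zeta>' s"
  then have "observer f h K \<zeta> x y t = observer f h K \<zeta>' x y t" for y by (rule observer_cong)
  then show "(norm (obs_error f h K \<zeta> x e t))\<^sup>2 = (norm (obs_error f h K \<zeta>' x e t))\<^sup>2"
    by (simp add: obs_error_def)
qed

lemma norm_add_sq_le: "(norm (a + b))\<^sup>2 \<le> 2 * (norm a)\<^sup>2 + 2 * (norm (b::'a::real_normed_vector))\<^sup>2"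
proof -
  have "(norm (a + b))\<^sup>2 \<le> (norm a + norm b)\<^sup>2"
    by (rule power_mono[OF norm_triangle_ineq]) simp
  also have "\<dots> \<le> 2 * (norm a)\<^sup>2 + 2 * (norm b)\<^sup>2"
    using sum_squares_bound[of "norm a" "norm b"] by (simp add: power2_sum)
  finally show ?thesis .
qed

text \<open>The stability estimate is available for almost every \<open>y\<close> only, whereas the conclusion concerns
  one direction. Points \<open>x + s u\<close> of the support, with \<open>s\<close> tending to zero, are approximated to
  within \<open>\<eta> \<bar>s\<bar>\<close> by points \<open>y\<close> at which the estimate holds, and the linearization passes to the
  limit \<open>\<eta> \<rightarrow> 0\<close>. The constant 16 is generous: only the exponential rate matters.\<close>

lemma linearized_mse_bound:
  fixes f :: "real^'n \<Rightarrow> real^'n" and h :: "real^'n \<Rightarrow> real^'m"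
  assumes p: "0 < p" "p < 1"
    and f: "unif_diff_on X f A" and G: "unif_diff_on X (K \<circ> h) B"
    and fX: "f \<in> X \<rightarrow> X" and x: "x \<in> X"
    and obs: "\<And>xh (\<zeta> :: nat \<Rightarrow> real) t. \<lbrakk>xh \<in> X; \<And>s. \<zeta> s \<in> {0, 1}\<rbrakk> \<Longrightarrow> observer f h K \<zeta> x xh t \<in> X"
    and M: "negligible M" and C: "0 \<le> C"
    and stable: "\<And>y. y \<in> X - M \<Longrightarrow>
      bernoulli_avg p t (\<lambda>\<zeta>. (norm (obs_error f h K \<zeta> x (x - y) t))\<^sup>2) \<le> C * (norm (x - y))\<^sup>2"
    and u: "norm u = 1"
    and acc: "\<And>d. 0 < d \<Longrightarrow> \<exists>s. 0 < \<bar>s\<bar> \<and> \<bar>s\<bar> < d \<and> x + s *\<^sub>R u \<in> lebesgue_support X"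
  shows "bernoulli_avg p t (\<lambda>\<zeta>. (norm (lin_error (\<lambda>s. A ((f ^^ s) x)) (\<lambda>s. B ((f ^^ s) x)) \<zeta> t *v u))\<^sup>2)
    \<le> 16 * C"
proof -
  let ?A = "\<lambda>s. A ((f ^^ s) x)" and ?B = "\<lambda>s. B ((f ^^ s) x)"
  let ?\<Phi> = "\<lambda>\<zeta>. lin_error ?A ?B \<zeta> t"
  define c where "c = (\<Prod>s<t. norm (?A s) + norm (?B s))"
  have c: "0 \<le> c" by (auto simp: c_def intro!: prod_nonneg)
  have key: "bernoulli_avg p t (\<lambda>\<zeta>. (norm (?\<Phi> \<zeta> *v u))\<^sup>2) \<le> 16 * C + (16 + 2 * c\<^sup>2) * \<eta>\<^sup>2"
    if \<eta>: "0 < \<eta>" "\<eta> \<le> 1" for \<eta>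
  proof -
    obtain d where d: "0 < d"
      "\<And>xh (\<zeta> :: nat \<Rightarrow> real). \<lbrakk>xh \<in> X; \<And>s. \<zeta> s \<in> {0, 1}; dist xh x < d\<rbrakk> \<Longrightarrow>
        norm (obs_error f h K \<zeta> x (x - xh) t - ?\<Phi> \<zeta> *v (x - xh)) \<le> \<eta> * norm (x - xh)"
      using error_linearization[OF f G fX x obs \<eta>(1), of t] by metis
    obtain s where s: "0 < \<bar>s\<bar>" "\<bar>s\<bar> < d / 2" "x + s *\<^sub>R u \<in> lebesgue_support X"
      using acc[of "d / 2"] d(1) by auto
    \<comment> \<open>The accuracy is relative to \<open>s\<close>, so that it survives division by \<open>s\<^sup>2\<close>.\<close>
    define \<tau> where "\<tau> = \<eta> * \<bar>s\<bar>"
    have \<tau>: "0 < \<tau>" "\<tau> \<le> \<bar>s\<bar>" using \<eta> s(1) by (auto simp: \<tau>_def mult_left_le_one_le)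
    have "\<not> negligible (X \<inter> ball (x + s *\<^sub>R u) \<tau>)"
      using s(3) \<tau> by (auto simp: lebesgue_support_def)
    then have "\<not> X \<inter> ball (x + s *\<^sub>R u) \<tau> \<subseteq> M" using negligible_subset[OF M] by blast
    then obtain y where "y \<in> X \<inter> ball (x + s *\<^sub>R u) \<tau>" "y \<notin> M" by blast
    then have y: "y \<in> X - M" "dist (x + s *\<^sub>R u) y < \<tau>" by auto
    define v where "v = x - y"
    have su: "norm (s *\<^sub>R u) = \<bar>s\<bar>" using u by simp
    have vs: "norm (v + s *\<^sub>R u) < \<tau>" using y(2) by (simp add: v_def dist_norm algebra_simps)
    have nv: "norm v \<le> 2 * \<bar>s\<bar>"
    proof -
      have "norm v \<le> norm (v + s *\<^sub>R u) + norm (s *\<^sub>R u)"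
        using norm_triangle_ineq4[of "v + s *\<^sub>R u" "s *\<^sub>R u"] by simp
      then show ?thesis using vs su \<tau> by linarith
    qed
    have "dist y x < d" using nv s(2) by (simp add: v_def dist_norm norm_minus_commute)
    then have lin: "norm (obs_error f h K \<zeta> x v t - ?\<Phi> \<zeta> *v v) \<le> \<eta> * norm v"
      if "\<And>s. \<zeta> s \<in> {0, 1}" for \<zeta> :: "nat \<Rightarrow> real"
      using d(2)[of y \<zeta>] y(1) that by (simp add: v_def)
    have nv2: "(norm v)\<^sup>2 \<le> 4 * s\<^sup>2"
      using power_mono[OF nv, of 2] by simp
    have pt: "s\<^sup>2 * (norm (?\<Phi> \<zeta> *v u))\<^sup>2
        \<le> 4 * (norm (obs_error f h K \<zeta> x v t))\<^sup>2 + (16 + 2 * c\<^sup>2) * \<eta>\<^sup>2 * s\<^sup>2"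
      if \<zeta>: "\<And>s. \<zeta> s \<in> {0, 1}" for \<zeta> :: "nat \<Rightarrow> real"
    proof -
      let ?e = "obs_error f h K \<zeta> x v t"
      have 1: "(norm (?\<Phi> \<zeta> *v v))\<^sup>2 \<le> 2 * (norm ?e)\<^sup>2 + 2 * (\<eta> * norm v)\<^sup>2"
      proof -
        have "(norm (?\<Phi> \<zeta> *v v))\<^sup>2 \<le> 2 * (norm ?e)\<^sup>2 + 2 * (norm (?\<Phi> \<zeta> *v v - ?e))\<^sup>2"
          using norm_add_sq_le[of ?e "?\<Phi> \<zeta> *v v - ?e"] by simp
        moreover have "(norm (?\<Phi> \<zeta> *v v - ?e))\<^sup>2 \<le> (\<eta> * norm v)\<^sup>2"
          using lin[OF \<zeta>] by (intro power_mono) (auto simp: norm_minus_commute)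
        ultimately show ?thesis by linarith
      qed
      have 2: "(norm (?\<Phi> \<zeta> *v (s *\<^sub>R u)))\<^sup>2 \<le> 2 * (norm (?\<Phi> \<zeta> *v v))\<^sup>2 + 2 * (c * \<tau>)\<^sup>2"
      proof -
        have "norm (?\<Phi> \<zeta> *v (v + s *\<^sub>R u)) \<le> c * norm (v + s *\<^sub>R u)"
          unfolding c_def by (rule norm_lin_error_le[OF \<zeta>])
        also have "\<dots> \<le> c * \<tau>" using vs c by (intro mult_left_mono) auto
        finally have "(norm (?\<Phi> \<zeta> *v (v + s *\<^sub>R u)))\<^sup>2 \<le> (c * \<tau>)\<^sup>2" by (rule power_mono) simp
        moreover have "?\<Phi> \<zeta> *v (s *\<^sub>R u) = - (?\<Phi> \<zeta> *v v) + ?\<Phi> \<zeta> *v (v + s *\<^sub>R u)"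
          by (simp only: matrix_vector_right_distrib) simp
        ultimately show ?thesis
          using norm_add_sq_le[of "- (?\<Phi> \<zeta> *v v)" "?\<Phi> \<zeta> *v (v + s *\<^sub>R u)"] by (simp only: norm_minus_cancel)
      qed
      have 3: "(norm (?\<Phi> \<zeta> *v (s *\<^sub>R u)))\<^sup>2 = s\<^sup>2 * (norm (?\<Phi> \<zeta> *v u))\<^sup>2"
        by (simp add: matrix_vector_mult_scaleR power_mult_distrib)
      have 4: "(\<eta> * norm v)\<^sup>2 \<le> \<eta>\<^sup>2 * (4 * s\<^sup>2)"
        unfolding power_mult_distrib by (rule mult_left_mono[OF nv2]) simp
      have 5: "(c * \<tau>)\<^sup>2 = c\<^sup>2 * \<eta>\<^sup>2 * s\<^sup>2" by (simp add: \<tau>_def power_mult_distrib)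
      have "s\<^sup>2 * (norm (?\<Phi> \<zeta> *v u))\<^sup>2 \<le> 2 * (2 * (norm ?e)\<^sup>2 + 2 * (\<eta>\<^sup>2 * (4 * s\<^sup>2))) + 2 * (c\<^sup>2 * \<eta>\<^sup>2 * s\<^sup>2)"
      proof -
        have "z \<le> 2 * (2 * e + 2 * q') + 2 * r'"
          if "a \<le> 2 * e + 2 * q" "b \<le> 2 * a + 2 * r" "b = z" "q \<le> q'" "r = r'" for a b z e q r q' r' :: real
          using that by argo
        then show ?thesis using 1 2 3 4 5 by blast
      qed
      then show ?thesis by (simp add: algebra_simps)
    qed
    have "s\<^sup>2 * bernoulli_avg p t (\<lambda>\<zeta>. (norm (?\<Phi> \<zeta> *v u))\<^sup>2)
       \<le> bernoulli_avg p t (\<lambda>\<zeta>. 4 * (norm (obs_error f h K \<zeta> x v t))\<^sup>2 + (16 + 2 * c\<^sup>2) * \<eta>\<^sup>2 * s\<^sup>2)"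
      unfolding bernoulli_avg_cmult[symmetric] by (rule bernoulli_avg_mono[OF p pt])
    also have "\<dots> = 4 * bernoulli_avg p t (\<lambda>\<zeta>. (norm (obs_error f h K \<zeta> x v t))\<^sup>2) + (16 + 2 * c\<^sup>2) * \<eta>\<^sup>2 * s\<^sup>2"
      by (simp only: bernoulli_avg_add bernoulli_avg_cmult bernoulli_avg_const)
    also have "\<dots> \<le> 4 * (C * (4 * s\<^sup>2)) + (16 + 2 * c\<^sup>2) * \<eta>\<^sup>2 * s\<^sup>2"
      using stable[OF y(1)] mult_left_mono[OF nv2 C] by (simp add: v_def)
    also have "\<dots> = s\<^sup>2 * (16 * C + (16 + 2 * c\<^sup>2) * \<eta>\<^sup>2)" by (simp add: algebra_simps)
    finally show ?thesis using s(1) by simp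
  qed
  have lim: "((\<lambda>\<eta>. 16 * C + (16 + 2 * c\<^sup>2) * \<eta>\<^sup>2) \<longlongrightarrow> 16 * C + (16 + 2 * c\<^sup>2) * 0\<^sup>2) (at_right 0)"
    by (intro tendsto_intros)
  have ev: "\<forall>\<^sub>F \<eta> in at_right 0. bernoulli_avg p t (\<lambda>\<zeta>. (norm (?\<Phi> \<zeta> *v u))\<^sup>2) \<le> 16 * C + (16 + 2 * c\<^sup>2) * \<eta>\<^sup>2"
    by (rule eventually_mono[OF eventually_at_right_real[OF zero_less_one]]) (use key in auto)
  show ?thesis using tendsto_lowerbound[OF lim ev] by simp
qed

text \<open>The determinant bound and the stability bound meet at a point \<open>x\<close> of \<open>A\<close> at which stability
  holds for almost every initial observer state and which is not isolated in the support of \<open>X\<close>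
  along any coordinate axis.\<close>

proposition mse_stable_imp_volume_growth_bound:
  fixes f :: "real^'n \<Rightarrow> real^'n" and h :: "real^'n \<Rightarrow> real^'m" and K :: "real^'m \<Rightarrow> real^'n"
  assumes X: "compact X" and p: "0 < p" "p < 1" and iid: "iid_bernoulli P \<xi> p"
    and f: "f \<in> X \<rightarrow> X" "C_on r X f" and h: "h \<in> X \<rightarrow> Y" "C_on r X h" and r: "1 \<le> r"
    and K: "C_on q Y K" "1 \<le> q"
    and det: "\<And>x. x \<in> X \<Longrightarrow> det (jacobian f (at x)) \<noteq> 0"
    and obs: "\<And>x y (\<zeta> :: nat \<Rightarrow> real) t. \<lbrakk>x \<in> X; y \<in> X; \<And>s. \<zeta> s \<in> {0, 1}\<rbrakk> \<Longrightarrow> observer f h K \<zeta> x y t \<in> X"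
    and stable: "mse_stable P \<xi> X f h K"
    and A: "A \<subseteq> X" "\<not> negligible A"
    and birkhoff: "\<And>x. x \<in> A \<Longrightarrow>
      (\<lambda>n. (\<Sum>k=0..n. ln \<bar>det (jacobian f (at ((f ^^ k) x)))\<bar>) / real n) \<longlonglongrightarrow> I"
  shows "real CARD('m) * ln (1 - p) + 2 * I < 0"
proof -
  let ?J = "\<lambda>x. jacobian f (at x)"
  let ?N = "real CARD('n)" and ?M = "real CARD('m)"
  have udf: "unif_diff_on X f ?J" by (rule C_on_imp_unif_diff_on[OF f(2) r X])
  obtain V where V: "X \<subseteq> V" "continuous_on V h" "continuous_on V (\<lambda>x. jacobian h (at x))"
    using C_on_jacobian[OF h(2) r] by metis
  have hX: "compact (h ` X)"
    using V by (intro compact_continuous_image X) (auto intro: continuous_on_subset)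
  have bh: "bounded ((\<lambda>x. jacobian h (at x)) ` X)"
    using V by (intro compact_imp_bounded compact_continuous_image X) (auto intro: continuous_on_subset)
  have KhX: "C_on q (h ` X) K" using h(1) by (intro C_on_subset[OF K(1)]) auto
  obtain W where W: "h ` X \<subseteq> W" "continuous_on W (\<lambda>x. jacobian K (at x))"
    using C_on_jacobian[OF KhX K(2)] by metis
  have bK: "bounded ((\<lambda>y. jacobian K (at y)) ` h ` X)"
    using W by (intro compact_imp_bounded compact_continuous_image hX) (auto intro: continuous_on_subset)
  define B where "B x = jacobian K (at (h x)) ** jacobian h (at x)" for x
  have udG: "unif_diff_on X (K \<circ> h) B"
    unfolding B_def
    by (rule unif_diff_on_compose[OF C_on_imp_unif_diff_on[OF h(2) r X] bh order_refl
          C_on_imp_unif_diff_on[OF KhX K(2) hX] bK])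
  obtain L \<beta> N where L: "0 < L" "0 < \<beta>" "\<beta> < 1" and N: "negligible N"
    and fib: "\<And>x. \<lbrakk>x \<in> X; x \<notin> N\<rbrakk> \<Longrightarrow> \<exists>M. negligible M \<and> (\<forall>y\<in>X - M. \<forall>t.
        mean_square_error P \<xi> f h K x (x - y) (t + 1) \<le> L * \<beta> ^ t * (norm (x - y))\<^sup>2)"
    using mse_stable_fibrewise[OF stable] by metis
  let ?S = "lebesgue_support X"
  define Iso where "Iso i = {x \<in> ?S. \<exists>d>0. \<forall>s. 0 < \<bar>s\<bar> \<and> \<bar>s\<bar> < d \<longrightarrow> x + s *\<^sub>R axis i 1 \<notin> ?S}" for i :: 'n
  have "negligible (Iso i)" for i
    unfolding Iso_def
    by (rule isolated_along_direction_negligible[OF compact_lebesgue_support[OF X]]) (simp add: axis_eq_0_iff)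
  then have bad: "negligible (N \<union> (X - ?S) \<union> (\<Union>i. Iso i))"
    using N negligible_diff_lebesgue_support by (intro negligible_Un negligible_Union) auto
  then have "\<not> A \<subseteq> N \<union> (X - ?S) \<union> (\<Union>i. Iso i)"
    using A(2) negligible_subset[OF bad] by metis
  then obtain x where "x \<in> A" "x \<notin> N \<union> (X - ?S) \<union> (\<Union>i. Iso i)" by (auto simp only: subset_iff)
  then have x: "x \<in> A" "x \<notin> N" "x \<in> ?S" "\<And>i. x \<notin> Iso i"
    using A(1) by auto
  have xX: "x \<in> X" using x A by auto
  obtain M where M: "negligible M" "\<And>y t. y \<in> X - M \<Longrightarrow>
      mean_square_error P \<xi> f h K x (x - y) (t + 1) \<le> L * \<beta> ^ t * (norm (x - y))\<^sup>2"
    using fib[OF xX x(2)] by blast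
  let ?A = "\<lambda>s. ?J ((f ^^ s) x)" and ?B = "\<lambda>s. B ((f ^^ s) x)"
  have col: "bernoulli_avg p (Suc t) (\<lambda>\<zeta>. (norm (lin_error ?A ?B \<zeta> (Suc t) *v axis i 1))\<^sup>2) \<le> 16 * (L * \<beta> ^ t)" for t i
  proof (rule linearized_mse_bound[OF p udf udG f(1) xX _ M(1)])
    show "observer f h K \<zeta> x y t \<in> X" if "y \<in> X" "\<And>s. \<zeta> s \<in> {0, 1}" for y \<zeta> t
      using obs[OF xX that] .
    show "0 \<le> L * \<beta> ^ t" using L by simp
    show "bernoulli_avg p (Suc t) (\<lambda>\<zeta>. (norm (obs_error f h K \<zeta> x (x - y) (Suc t)))\<^sup>2) \<le> L * \<beta> ^ t * (norm (x - y))\<^sup>2"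
      if "y \<in> X - M" for y
      using M(2)[OF that, of t] unfolding mean_square_error_eq_avg[OF iid] by simp
    show "norm (axis i (1::real)) = 1" by simp
    show "\<exists>s. 0 < \<bar>s\<bar> \<and> \<bar>s\<bar> < d \<and> x + s *\<^sub>R axis i 1 \<in> ?S" if "0 < d" for d
      using x(3) x(4)[of i] that unfolding Iso_def by blast
  qed
  define c where "c = (fact CARD('n))\<^sup>2 * (16 * ?N * L) ^ CARD('n)"
  have c: "0 < c" using L by (simp add: c_def)
  define a where "a s = (1 - p) ^ CARD('m) * (det (?A s))\<^sup>2" for s
  have dnz: "det (?A s) \<noteq> 0" for s using det funpow_in[OF f(1) xX] by auto
  have a: "0 < a s" for s using p dnz[of s] by (simp add: a_def)
  have bound: "(\<Prod>s<Suc t. a s) \<le> c * (\<beta> ^ t) ^ CARD('n)" for t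
  proof -
    let ?avg = "bernoulli_avg p (Suc t) (\<lambda>\<zeta>. frob_sq (mat 1 ** lin_error ?A ?B \<zeta> (Suc t)))"
    have "?avg = (\<Sum>i\<in>UNIV. bernoulli_avg p (Suc t) (\<lambda>\<zeta>. (norm (lin_error ?A ?B \<zeta> (Suc t) *v axis i 1))\<^sup>2))"
      unfolding frob_sq_def by (subst bernoulli_avg_sum) (simp_all add: matrix_vector_mult_basis del: bernoulli_avg.simps lin_error.simps)
    also have "\<dots> \<le> (\<Sum>i\<in>(UNIV::'n set). 16 * (L * \<beta> ^ t))" by (rule sum_mono[OF col])
    also have "\<dots> = 16 * ?N * L * \<beta> ^ t" by simp
    finally have le: "?avg \<le> 16 * ?N * L * \<beta> ^ t" .
    have nn: "0 \<le> ?avg"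
      using bernoulli_avg_mono[OF p, of "\<lambda>_. 0" "\<lambda>\<zeta>. frob_sq (mat 1 ** lin_error ?A ?B \<zeta> (Suc t))" "Suc t"]
      by (simp only: frob_sq_nonneg bernoulli_avg_const)
    have "(\<Prod>s<Suc t. a s) \<le> (fact CARD('n))\<^sup>2 * ?avg ^ CARD('n)"
      using mean_square_ge_det_growth[OF p, of ?B "\<lambda>s. jacobian K (at (h ((f ^^ s) x)))" "\<lambda>s. jacobian h (at ((f ^^ s) x))"
          "mat 1" ?A "Suc t"]
      by (simp only: B_def a_def det_I power_one mult_1)
    also have "\<dots> \<le> (fact CARD('n))\<^sup>2 * (16 * ?N * L * \<beta> ^ t) ^ CARD('n)"
      by (intro mult_left_mono power_mono le nn) auto
    also have "\<dots> = c * (\<beta> ^ t) ^ CARD('n)" by (simp add: c_def power_mult_distrib)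
    finally show ?thesis .
  qed
  have logb: "real (Suc t) * (?M * ln (1 - p)) + 2 * (\<Sum>k=0..t. ln \<bar>det (?A k)\<bar>) \<le> ln c + real t * (?N * ln \<beta>)" for t
  proof -
    have la: "ln (a s) = ?M * ln (1 - p) + 2 * ln \<bar>det (?A s)\<bar>" for s
    proof -
      have "ln (a s) = ln ((1 - p) ^ CARD('m)) + ln (\<bar>det (?A s)\<bar> ^ 2)"
        unfolding a_def power2_abs by (rule ln_mult_pos) (use p dnz in auto)
      moreover have "ln ((1 - p) ^ CARD('m)) = ?M * ln (1 - p)" by (rule ln_realpow)
      moreover have "ln (\<bar>det (?A s)\<bar> ^ 2) = real 2 * ln \<bar>det (?A s)\<bar>" by (rule ln_realpow)
      ultimately show ?thesis by (simp only: of_nat_numeral)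
    qed
    have "ln (\<Prod>s<Suc t. a s) = (\<Sum>s<Suc t. ln (a s))" by (rule ln_prod) (use less_imp_neq[OF a] in \<open>auto dest: sym\<close>)
    also have "\<dots> = real (Suc t) * (?M * ln (1 - p)) + 2 * (\<Sum>s<Suc t. ln \<bar>det (?A s)\<bar>)"
      by (simp only: la sum.distrib sum_distrib_left[symmetric] sum_constant card_lessThan mult.left_commute)
    finally have e1: "ln (\<Prod>s<Suc t. a s) = real (Suc t) * (?M * ln (1 - p)) + 2 * (\<Sum>k=0..t. ln \<bar>det (?A k)\<bar>)"
      by (simp only: lessThan_Suc_atMost atLeast0AtMost)
    have "ln (\<Prod>s<Suc t. a s) \<le> ln (c * (\<beta> ^ t) ^ CARD('n))"
      by (rule ln_mono[OF bound]) (intro prod_pos a)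
    also have "\<dots> = ln c + ln ((\<beta> ^ t) ^ CARD('n))" by (rule ln_mult_pos) (use c L in auto)
    also have "\<dots> = ln c + real t * (?N * ln \<beta>)" using L by (simp add: ln_realpow)
    finally show ?thesis unfolding e1 .
  qed
  have "(\<lambda>t. real (Suc t) / real t * (?M * ln (1 - p)) + 2 * ((\<Sum>k=0..t. ln \<bar>det (?A k)\<bar>) / real t))
      \<longlonglongrightarrow> 1 * (?M * ln (1 - p)) + 2 * I"
    by (intro tendsto_intros birkhoff[OF x(1)] LIMSEQ_Suc_n_over_n)
  moreover have "(\<lambda>t. ln c / real t + ?N * ln \<beta>) \<longlonglongrightarrow> 0 + ?N * ln \<beta>"
    by (intro tendsto_intros lim_const_over_n)
  moreover have "real (Suc t) / real t * (?M * ln (1 - p)) + 2 * ((\<Sum>k=0..t. ln \<bar>det (?A k)\<bar>) / real t)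
      \<le> ln c / real t + ?N * ln \<beta>" if "1 \<le> t" for t
  proof -
    have "(real (Suc t) * (?M * ln (1 - p)) + 2 * (\<Sum>k=0..t. ln \<bar>det (?A k)\<bar>)) / real t
        \<le> (ln c + real t * (?N * ln \<beta>)) / real t"
      by (rule divide_right_mono[OF logb]) simp
    also have "\<dots> = ln c / real t + ?N * ln \<beta>" using that by (simp add: add_divide_distrib)
    finally show ?thesis
      by (simp only: add_divide_distrib times_divide_eq_left times_divide_eq_right)
  qed
  ultimately have "1 * (?M * ln (1 - p)) + 2 * I \<le> 0 + ?N * ln \<beta>"
    by (intro LIMSEQ_le) auto
  also have "\<dots> < 0" using L by (simp add: mult_pos_neg)
  finally show ?thesis by simp
qed

section \<open>Entropy of partitions as a code length\<close>

text \<open>Meaningful only if exactly one member of \<open>\<C>\<close> contains \<open>x\<close>.\<close>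

definition cell :: "'a set set \<Rightarrow> 'a \<Rightarrow> 'a set" where
  "cell \<C> x = (THE C. C \<in> \<C> \<and> x \<in> C)"

lemma cell_eq:
  assumes "partition_on A \<C>" "C \<in> \<C>" "x \<in> C"
  shows "cell \<C> x = C"
  unfolding cell_def
proof (rule the_equality)
  show "C \<in> \<C> \<and> x \<in> C" using assms by simp
  show "D = C" if "D \<in> \<C> \<and> x \<in> D" for D
    using assms that by (auto simp: partition_on_def disjoint_def)
qed

lemma cell_in:
  assumes "partition_on A \<C>" "x \<in> A"
  shows "cell \<C> x \<in> \<C>" "x \<in> cell \<C> x"
proof -
  obtain C where "C \<in> \<C>" "x \<in> C" using assms by (auto simp: partition_on_def)
  then show "cell \<C> x \<in> \<C>" "x \<in> cell \<C> x" using cell_eq[OF assms(1)] by auto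
qed

lemma cell_measurable:
  assumes "finite_partition \<mu> \<C>"
  shows "cell \<C> \<in> \<mu> \<rightarrow>\<^sub>M count_space \<C>"
proof -
  have fin: "finite \<C>" and sub: "\<C> \<subseteq> sets \<mu>" and part: "partition_on (space \<mu>) \<C>"
    using assms by (auto simp: finite_partition_def)
  have "cell \<C> -` {C} \<inter> space \<mu> = C" if "C \<in> \<C>" for C
  proof (intro equalityI subsetI)
    fix x assume "x \<in> cell \<C> -` {C} \<inter> space \<mu>"
    then show "x \<in> C" using cell_in(2)[OF part, of x] by simp
  next
    fix x assume x: "x \<in> C"
    then have "x \<in> space \<mu>" using that sub sets.sets_into_space by blast
    then show "x \<in> cell \<C> -` {C} \<inter> space \<mu>" using cell_eq[OF part that x] by simp
  qed
  then have "cell \<C> -` {C} \<inter> space \<mu> \<in> sets \<mu>" if "C \<in> \<C>" for C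
    using that sub by auto
  moreover have "cell \<C> \<in> space \<mu> \<rightarrow> \<C>" using cell_in(1)[OF part] by blast
  ultimately show ?thesis
    using fin by (simp add: measurable_count_space_eq2)
qed

lemma measurable_count_space_Pair:
  assumes v: "v \<in> M \<rightarrow>\<^sub>M count_space A" and w: "w \<in> M \<rightarrow>\<^sub>M count_space B" and fin: "finite A" "finite B"
  shows "(\<lambda>x. (v x, w x)) \<in> M \<rightarrow>\<^sub>M count_space (A \<times> B)"
proof -
  have "(\<lambda>x. (v x, w x)) -` {ab} \<inter> space M \<in> sets M" if "ab \<in> A \<times> B" for ab
  proof -
    have "(\<lambda>x. (v x, w x)) -` {ab} \<inter> space M
      = (v -` {fst ab} \<inter> space M) \<inter> (w -` {snd ab} \<inter> space M)" by (cases ab) auto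
    also have "\<dots> \<in> sets M"
      using measurable_sets[OF v, of "{fst ab}"] measurable_sets[OF w, of "{snd ab}"] that by auto
    finally show ?thesis .
  qed
  then show ?thesis
    using fin measurable_space[OF v] measurable_space[OF w] by (auto simp: measurable_count_space_eq2)
qed

context prob_space
begin

lemma finite_label_integral:
  fixes F :: "'b \<Rightarrow> real"
  assumes V: "V \<in> M \<rightarrow>\<^sub>M count_space S" and S: "finite S"
  shows "integrable M (\<lambda>x. F (V x))"
    and "(\<integral>x. F (V x) \<partial>M) = (\<Sum>v\<in>S. prob (V -` {v} \<inter> space M) * F v)"
proof -
  have "(\<lambda>x. F (V x)) \<in> borel_measurable M"
    by (rule measurable_compose[OF V]) simp
  moreover have "AE x in M. norm (F (V x)) \<le> (\<Sum>v\<in>S. norm (F v))"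
  proof (rule AE_I2)
    fix x assume "x \<in> space M"
    then have "V x \<in> S" using measurable_space[OF V] by simp
    then show "norm (F (V x)) \<le> (\<Sum>v\<in>S. norm (F v))" using S by (intro member_le_sum) auto
  qed
  ultimately show int: "integrable M (\<lambda>x. F (V x))" by (rule integrable_const_bound[rotated])
  have fib: "V -` {v} \<inter> space M \<in> events" for v
  proof (cases "v \<in> S")
    case False
    then have "V -` {v} \<inter> space M = {}" using measurable_space[OF V] by auto
    then show ?thesis by simp
  qed (rule measurable_sets[OF V], simp)
  have "(\<integral>x. F (V x) \<partial>M) = (\<integral>x. (\<Sum>v\<in>S. F v * indicator (V -` {v} \<inter> space M) x) \<partial>M)"
  proof (rule Bochner_Integration.integral_cong[OF refl])
    fix x assume x: "x \<in> space M"
    then have "V x \<in> S" using measurable_space[OF V] by simp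
    have "(\<Sum>v\<in>S. F v * indicator (V -` {v} \<inter> space M) x) = (\<Sum>v\<in>S. if v = V x then F v else 0)"
      by (rule sum.cong) (use x in \<open>auto simp: indicator_def\<close>)
    then show "F (V x) = (\<Sum>v\<in>S. F v * indicator (V -` {v} \<inter> space M) x)"
      using S \<open>V x \<in> S\<close> by simp
  qed
  also have "\<dots> = (\<Sum>v\<in>S. (\<integral>x. F v * indicator (V -` {v} \<inter> space M) x \<partial>M))"
    using fib by (intro Bochner_Integration.integral_sum) (simp add: emeasure_eq_measure)
  also have "\<dots> = (\<Sum>v\<in>S. prob (V -` {v} \<inter> space M) * F v)"
    using fib by (intro sum.cong refl) simp
  finally show "(\<integral>x. F (V x) \<partial>M) = (\<Sum>v\<in>S. prob (V -` {v} \<inter> space M) * F v)" .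
qed

text \<open>Gibbs' inequality. The code words are the values of \<open>V\<close>, weighted by a subprobability \<open>q\<close>,
  and \<open>- ln (q v)\<close> plays the role of the length of \<open>v\<close>. The word may contain more information
  than the cell; the inequality \<open>ln z \<le> z - 1\<close> is applied on each fibre of \<open>V\<close> with
  \<open>z = q v / \<mu>(C)\<close>.\<close>

lemma partition_entropy_le_code_length:
  assumes \<C>: "finite_partition M \<C>"
    and V: "V \<in> M \<rightarrow>\<^sub>M count_space S" and S: "finite S"
    and refines: "\<And>C x y. \<lbrakk>C \<in> \<C>; x \<in> C; y \<in> space M; V x = V y\<rbrakk> \<Longrightarrow> y \<in> C"
    and q0: "\<And>v. v \<in> S \<Longrightarrow> 0 \<le> q v" and q1: "(\<Sum>v\<in>S. q v) \<le> 1"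
    and qpos: "\<And>v. \<lbrakk>v \<in> S; 0 < prob (V -` {v} \<inter> space M)\<rbrakk> \<Longrightarrow> 0 < q v"
  shows "partition_entropy M \<C> \<le> (\<integral>x. - ln (q (V x)) \<partial>M)"
proof -
  have fin: "finite \<C>" and sub: "\<C> \<subseteq> sets M" and part: "partition_on (space M) \<C>"
    using \<C> by (auto simp: finite_partition_def)
  have VS: "V x \<in> S" if "x \<in> space M" for x using measurable_space[OF V that] by simp
  define m where "m v = prob (V -` {v} \<inter> space M)" for v
  \<comment> \<open>The last two terms sum to at most zero over all words and absorb the error of \<open>ln z \<le> z - 1\<close>.\<close>
  define G where "G v = m v * (- ln (q v)) + q v - m v" for v
  have fib: "V -` {v} \<inter> space M \<in> events" if "v \<in> S" for v
    by (rule measurable_sets[OF V]) (use that in simp)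
  have inC: "x \<in> space M" if "C \<in> \<C>" "x \<in> C" for C x
    using that sub sets.sets_into_space by blast
  have finV: "finite (V ` C)" if "C \<in> \<C>" for C
    by (rule finite_subset[OF _ S]) (use VS inC that in auto)
  have cell_bound: "- (prob C * ln (prob C)) \<le> (\<Sum>v\<in>V ` C. G v)" if C: "C \<in> \<C>" for C
  proof -
    have Ceq: "C = (\<Union>v\<in>V ` C. V -` {v} \<inter> space M)"
    proof (intro equalityI subsetI)
      fix y assume "y \<in> (\<Union>v\<in>V ` C. V -` {v} \<inter> space M)"
      then obtain x where "x \<in> C" "V x = V y" "y \<in> space M" by auto
      then show "y \<in> C" using refines[OF C] by metis
    qed (use inC[OF C] in auto)
    have "prob (\<Union>v\<in>V ` C. V -` {v} \<inter> space M) = (\<Sum>v\<in>V ` C. m v)"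
      unfolding m_def
      by (rule finite_measure_finite_Union)
        (use finV[OF C] fib VS inC[OF C] in \<open>auto simp: disjoint_family_on_def\<close>)
    then have "prob C = (\<Sum>v\<in>V ` C. m v)" by (simp only: Ceq[symmetric])
    then have sumC: "prob C * l = (\<Sum>v\<in>V ` C. m v * l)" for l
      by (simp only: sum_distrib_right)
    have "- (prob C * ln (prob C)) = prob C * (- ln (prob C))" by simp
    also have "\<dots> = (\<Sum>v\<in>V ` C. m v * (- ln (prob C)))" by (rule sumC)
    finally have "- (prob C * ln (prob C)) = (\<Sum>v\<in>V ` C. m v * (- ln (prob C)))" .
    also have "\<dots> \<le> (\<Sum>v\<in>V ` C. G v)"
    proof (rule sum_mono)
      fix v assume v: "v \<in> V ` C"
      then have vS: "v \<in> S" using VS inC[OF C] by auto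
      show "m v * (- ln (prob C)) \<le> G v"
      proof (cases "m v = 0")
        case True
        then show ?thesis using q0[OF vS] by (simp add: G_def)
      next
        case False
        then have mv: "0 < m v" by (simp add: m_def zero_less_measure_iff)
        have qv: "0 < q v" using qpos[OF vS] mv by (simp add: m_def)
        have "V -` {v} \<inter> space M \<subseteq> C"
        proof
          fix y assume y: "y \<in> V -` {v} \<inter> space M"
          obtain x where "x \<in> C" "v = V x" using v by auto
          then show "y \<in> C" using refines[OF C, of x y] y by auto
        qed
        then have mC: "m v \<le> prob C"
          unfolding m_def using C sub by (intro finite_measure_mono) auto
        have "ln (q v / prob C) \<le> q v / prob C - 1" using qv mv mC by (intro ln_le_minus_one) auto
        moreover have "ln (q v / prob C) = ln (q v) - ln (prob C)"
        proof (rule ln_divide_pos[OF qv])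
          show "0 < prob C" using mv mC by linarith
        qed
        ultimately have "m v * (ln (q v) - ln (prob C)) \<le> m v * (q v / prob C - 1)"
          using mv by (intro mult_left_mono) auto
        moreover have "m v * (q v / prob C) \<le> q v"
          using mv mC qv by (simp add: field_simps)
        ultimately show ?thesis by (simp add: G_def algebra_simps)
      qed
    qed
    finally show ?thesis .
  qed
  have img: "(\<Union>C\<in>\<C>. V ` C) = V ` space M"
    using partition_onD1[OF part] by auto
  have outside: "m v = 0" if "v \<in> S - V ` space M" for v
  proof -
    have "V -` {v} \<inter> space M = {}" using that by auto
    then show ?thesis by (simp add: m_def)
  qed
  have VsS: "V ` space M \<subseteq> S" using VS by auto
  have "partition_entropy M \<C> = (\<Sum>C\<in>\<C>. - (prob C * ln (prob C)))"
    by (simp add: partition_entropy_def sum_negf)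
  also have "\<dots> \<le> (\<Sum>C\<in>\<C>. \<Sum>v\<in>V ` C. G v)" by (rule sum_mono[OF cell_bound])
  also have "\<dots> = (\<Sum>v\<in>(\<Union>C\<in>\<C>. V ` C). G v)"
  proof (rule sum.UNION_disjoint[symmetric])
    show "\<forall>C\<in>\<C>. \<forall>D\<in>\<C>. C \<noteq> D \<longrightarrow> V ` C \<inter> V ` D = {}"
    proof (intro ballI impI, rule ccontr)
      fix C D assume CD: "C \<in> \<C>" "D \<in> \<C>" "C \<noteq> D" and "V ` C \<inter> V ` D \<noteq> {}"
      then obtain x y where "x \<in> C" "y \<in> D" "V x = V y" by auto
      then have "y \<in> C" using refines[of C x y] CD inC[of D y] by auto
      then show False using CD \<open>y \<in> D\<close> part by (auto simp: partition_on_def disjoint_def)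
    qed
  qed (use fin finV in auto)
  also have "\<dots> = (\<Sum>v\<in>V ` space M. m v * (- ln (q v))) + (\<Sum>v\<in>V ` space M. q v) - (\<Sum>v\<in>V ` space M. m v)"
    by (simp only: img G_def sum.distrib sum_subtractf)
  finally have main: "partition_entropy M \<C> \<le>
    (\<Sum>v\<in>V ` space M. m v * (- ln (q v))) + (\<Sum>v\<in>V ` space M. q v) - (\<Sum>v\<in>V ` space M. m v)" .
  have "(\<Sum>v\<in>V ` space M. m v * (- ln (q v))) = (\<Sum>v\<in>S. m v * (- ln (q v)))"
    by (rule sum.mono_neutral_left[OF S VsS]) (use outside in auto)
  also have "\<dots> = (\<integral>x. - ln (q (V x)) \<partial>M)"
    unfolding m_def by (rule finite_label_integral(2)[OF V S, symmetric])
  finally have 1: "(\<Sum>v\<in>V ` space M. m v * (- ln (q v))) = (\<integral>x. - ln (q (V x)) \<partial>M)" .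
  have 2: "(\<Sum>v\<in>V ` space M. q v) \<le> 1"
    using sum_mono2[OF S VsS, of q] q0 q1 by (auto intro: order_trans)
  have "(\<Sum>v\<in>V ` space M. m v) = (\<Sum>v\<in>S. m v)"
    by (rule sum.mono_neutral_left[OF S VsS]) (use outside in auto)
  also have "\<dots> = 1"
    using finite_label_integral(2)[OF V S, of "\<lambda>_. 1"] by (simp add: m_def prob_space)
  finally have 3: "(\<Sum>v\<in>V ` space M. m v) = 1" .
  show ?thesis using main 1 2 3 by linarith
qed

lemma partition_entropy_nonneg:
  assumes "finite_partition M \<C>"
  shows "0 \<le> partition_entropy M \<C>"
proof -
  have "prob C * ln (prob C) \<le> 0" for C
  proof (cases "prob C = 0")
    case False
    then have "0 < prob C" by (simp add: zero_less_measure_iff)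
    then show ?thesis by (intro mult_nonneg_nonpos) auto
  qed simp
  then show ?thesis unfolding partition_entropy_def by (simp add: sum_nonpos)
qed

end

lemma subadditive_mult_le:
  fixes a :: "nat \<Rightarrow> real"
  assumes "\<And>m n. a (m + n) \<le> a m + a n" "a 0 \<le> 0"
  shows "a (k * m) \<le> real k * a m"
proof (induction k)
  case (Suc k)
  have "a (Suc k * m) \<le> a m + a (k * m)" using assms(1)[of m "k * m"] by simp
  then show ?case using Suc by (simp add: algebra_simps)
qed (use assms in simp)

text \<open>Fekete's lemma: the limit is the infimum of \<open>a n / n\<close>. To get close to the infimum, divide
  \<open>n\<close> by an index \<open>m\<close> for which \<open>a m / m\<close> is nearly minimal.\<close>

lemma subadditive_convergent:
  fixes a :: "nat \<Rightarrow> real"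
  assumes sub: "\<And>m n. a (m + n) \<le> a m + a n" and a0: "a 0 = 0" and nn: "\<And>n. 0 \<le> a n"
  shows "convergent (\<lambda>n. a n / real n)"
proof -
  let ?S = "(\<lambda>n. a n / real n) ` {1..}"
  define L where "L = Inf ?S"
  have bdd: "bdd_below ?S" using nn by (intro bdd_belowI[of _ 0]) auto
  have lower: "L \<le> a n / real n" if "1 \<le> n" for n
    unfolding L_def by (rule cInf_lower[OF _ bdd]) (use that in auto)
  have "(\<lambda>n. a n / real n) \<longlonglongrightarrow> L"
  proof (rule LIMSEQ_I)
    fix e :: real assume e: "0 < e"
    have "\<exists>y\<in>?S. y < L + e / 2"
      using e by (intro cInf_lessD) (auto simp: L_def)
    then obtain m where m: "1 \<le> m" "a m / real m < L + e / 2" by auto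
    define B where "B = (\<Sum>r<m. a r)"
    have B: "a r \<le> B" if "r < m" for r
      unfolding B_def by (rule member_le_sum) (use that nn in auto)
    have "0 \<le> B" unfolding B_def by (rule sum_nonneg) (rule nn)
    obtain n0 :: nat where n0: "2 * B / e < real n0" using reals_Archimedean2 by blast
    show "\<exists>n0. \<forall>n\<ge>n0. norm (a n / real n - L) < e"
    proof (intro exI allI impI)
      fix n assume n: "max 1 n0 \<le> n"
      then have n1: "1 \<le> n" and Bn: "B / real n < e / 2"
        using n0 e by (auto simp: field_simps intro: less_le_trans)
      have "a n \<le> a (n div m * m) + a (n mod m)"
        using sub[of "n div m * m" "n mod m"] by simp
      also have "\<dots> \<le> real (n div m) * a m + B"
        using m by (intro add_mono subadditive_mult_le[OF sub] B) (auto simp: a0)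
      also have "real (n div m) * a m \<le> real n / real m * a m"
        by (intro mult_right_mono nn) (rule of_nat_div_le_of_nat)
      finally have "a n / real n \<le> (real n / real m * a m + B) / real n" by (intro divide_right_mono) auto
      also have "\<dots> = a m / real m + B / real n" using n1 by (simp add: field_simps)
      also have "\<dots> < L + e" using m(2) Bn by linarith
      finally show "norm (a n / real n - L) < e" using lower[OF n1] by (simp add: abs_if)
    qed
  qed
  then show ?thesis by (rule convergentI)
qed

locale measure_preserving_map = prob_space M for M :: "'a measure" +
  fixes T :: "'a \<Rightarrow> 'a"
  assumes T_meas [measurable]: "T \<in> M \<rightarrow>\<^sub>M M" and T_inv: "distr M M T = M"
begin

lemma pow_meas [measurable]: "T ^^ n \<in> M \<rightarrow>\<^sub>M M"
proof (induction n)
  case 0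
  show ?case using measurable_ident[of M] by (simp add: id_def)
next
  case (Suc n)
  show ?case using measurable_comp[OF Suc T_meas] by simp
qed

lemma pow_space: "x \<in> space M \<Longrightarrow> (T ^^ n) x \<in> space M"
  using measurable_space[OF pow_meas] .

lemma pow_inv: "distr M M (T ^^ n) = M"
proof (induction n)
  case 0
  show ?case by (simp add: distr_id2 id_def)
next
  case (Suc n)
  have "distr M M (T \<circ> (T ^^ n)) = distr (distr M M (T ^^ n)) M T"
    by (rule distr_distr[symmetric]) simp_all
  then show ?case by (simp add: Suc T_inv comp_def)
qed

lemma measure_preserving_pow: "measure_preserving_map M (T ^^ n)"
  by unfold_locales (simp_all add: pow_inv)

lemma integral_pow:
  assumes "\<phi> \<in> borel_measurable M"
  shows "(\<integral>x. (\<phi> ((T ^^ n) x) :: real) \<partial>M) = (\<integral>x. \<phi> x \<partial>M)"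
  using integral_distr[OF pow_meas[of n], of \<phi>] assms by (simp add: pow_inv)

lemma integrable_pow:
  assumes "integrable M \<phi>"
  shows "integrable M (\<lambda>x. \<phi> ((T ^^ n) x) :: real)"
  using integrable_distr[OF pow_meas[of n], of \<phi>] assms by (simp add: pow_inv)

lemma prob_pow:
  assumes "A \<in> events"
  shows "prob ((T ^^ n) -` A \<inter> space M) = prob A"
  using measure_distr[OF pow_meas[of n], of A] assms by (simp add: pow_inv)

end

primrec itinerary :: "('a \<Rightarrow> 'b) \<Rightarrow> ('a \<Rightarrow> 'a) \<Rightarrow> nat \<Rightarrow> 'a \<Rightarrow> 'b list" where
  "itinerary v g 0 x = []"
| "itinerary v g (Suc k) x = v x # itinerary v g k (g x)"

lemma itinerary_eq_imp: "itinerary v g k x = itinerary v g k y \<Longrightarrow> j < k \<Longrightarrow> v ((g ^^ j) x) = v ((g ^^ j) y)"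
proof (induction k arbitrary: x y j)
  case (Suc k)
  show ?case
  proof (cases j)
    case (Suc i)
    then show ?thesis using Suc.IH[of "g x" "g y" i] Suc.prems by (simp add: funpow_swap1)
  qed (use Suc.prems in simp)
qed simp

primrec chain_weight :: "('b \<Rightarrow> 'b \<Rightarrow> real) \<Rightarrow> 'b \<Rightarrow> 'b list \<Rightarrow> real" where
  "chain_weight \<kappa> v [] = 1"
| "chain_weight \<kappa> v (w # ws) = \<kappa> v w * chain_weight \<kappa> w ws"

definition words :: "'b set \<Rightarrow> nat \<Rightarrow> 'b list set" where
  "words S k = {ws. set ws \<subseteq> S \<and> length ws = k}"

lemma finite_words: "finite S \<Longrightarrow> finite (words S k)"
  unfolding words_def by (rule finite_lists_length_eq)

lemma words_Suc: "words S (Suc k) = (\<lambda>(w, ws). w # ws) ` (S \<times> words S k)"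
  unfolding words_def by (auto simp: length_Suc_conv image_iff)

lemma sum_words_Suc: "(\<Sum>ws\<in>words S (Suc k). F ws) = (\<Sum>w\<in>S. \<Sum>ws\<in>words S k. F (w # ws))"
proof -
  have "(\<Sum>ws\<in>words S (Suc k). F ws) = (\<Sum>p\<in>S \<times> words S k. F (fst p # snd p))"
    unfolding words_Suc by (subst sum.reindex) (auto simp: inj_on_def case_prod_beta)
  then show ?thesis by (simp add: sum.cartesian_product case_prod_beta)
qed

lemma chain_weight_nonneg:
  assumes "\<And>v w. \<lbrakk>v \<in> S; w \<in> S\<rbrakk> \<Longrightarrow> 0 \<le> \<kappa> v w"
  shows "v \<in> S \<Longrightarrow> set ws \<subseteq> S \<Longrightarrow> 0 \<le> chain_weight \<kappa> v ws"
  by (induction ws arbitrary: v) (auto simp: assms)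

lemma sum_chain_weight_le:
  assumes S: "finite S" and pos: "\<And>v w. \<lbrakk>v \<in> S; w \<in> S\<rbrakk> \<Longrightarrow> 0 \<le> \<kappa> v w"
    and one: "\<And>v. v \<in> S \<Longrightarrow> (\<Sum>w\<in>S. \<kappa> v w) \<le> 1"
  shows "v \<in> S \<Longrightarrow> (\<Sum>ws\<in>words S k. chain_weight \<kappa> v ws) \<le> 1"
proof (induction k arbitrary: v)
  case 0
  have "words S 0 = {[]}" by (auto simp: words_def)
  then show ?case by simp
next
  case (Suc k)
  have "(\<Sum>ws\<in>words S (Suc k). chain_weight \<kappa> v ws)
      = (\<Sum>w\<in>S. \<kappa> v w * (\<Sum>ws\<in>words S k. chain_weight \<kappa> w ws))"
    by (simp add: sum_words_Suc sum_distrib_left)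
  also have "\<dots> \<le> (\<Sum>w\<in>S. \<kappa> v w * 1)"
    by (intro sum_mono mult_left_mono Suc.IH pos Suc.prems)
  also have "\<dots> \<le> 1" using one[OF Suc.prems] by simp
  finally show ?case .
qed

lemma ln_chain_weight_itinerary:
  assumes "\<And>x. x \<in> A \<Longrightarrow> 0 < \<kappa> (v x) (v (g x))" and "\<And>x. x \<in> A \<Longrightarrow> g x \<in> A"
  shows "x \<in> A \<Longrightarrow> 0 < chain_weight \<kappa> (v x) (itinerary v g k (g x)) \<and>
    - ln (chain_weight \<kappa> (v x) (itinerary v g k (g x)))
      = (\<Sum>j<k. - ln (\<kappa> (v ((g ^^ j) x)) (v (g ((g ^^ j) x)))))"
proof (induction k arbitrary: x)
  case (Suc k)
  have IH: "0 < chain_weight \<kappa> (v (g x)) (itinerary v g k (g (g x)))"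
    "- ln (chain_weight \<kappa> (v (g x)) (itinerary v g k (g (g x))))
      = (\<Sum>j<k. - ln (\<kappa> (v ((g ^^ j) (g x))) (v (g ((g ^^ j) (g x))))))"
    using Suc.IH[of "g x"] Suc.prems assms(2) by auto
  have p: "0 < \<kappa> (v x) (v (g x))" using assms(1) Suc.prems by simp
  have "(\<Sum>j<Suc k. - ln (\<kappa> (v ((g ^^ j) x)) (v (g ((g ^^ j) x)))))
     = - ln (\<kappa> (v x) (v (g x))) + (\<Sum>j<k. - ln (\<kappa> (v ((g ^^ j) (g x))) (v (g ((g ^^ j) (g x))))))"
    by (subst sum.lessThan_Suc_shift) (simp add: funpow_swap1)
  then show ?case using IH p by (simp add: ln_mult_pos)
qed simp

context measure_preserving_map
begin

lemma itinerary_measurable: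
  assumes v: "v \<in> M \<rightarrow>\<^sub>M count_space S" and S: "finite S"
  shows "itinerary v T k \<in> M \<rightarrow>\<^sub>M count_space (words S k)"
proof (induction k)
  case 0
  show ?case by (simp add: words_def)
next
  case (Suc k)
  have "(\<lambda>x. itinerary v T k (T x)) \<in> M \<rightarrow>\<^sub>M count_space (words S k)"
    by (rule measurable_compose[OF T_meas Suc])
  have "itinerary v T (Suc k) -` {ws} \<inter> space M \<in> events" if W: "ws \<in> words S (Suc k)" for ws
  proof -
    obtain w us where ws: "ws = w # us" "w \<in> S" "us \<in> words S k"
      using W unfolding words_Suc by auto
    have "itinerary v T (Suc k) -` {ws} \<inter> space M
        = (v -` {w} \<inter> space M) \<inter> ((\<lambda>x. itinerary v T k (T x)) -` {us} \<inter> space M)"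
      by (auto simp: ws)
    also have "\<dots> \<in> events"
      using measurable_sets[OF v, of "{w}"] ws
        measurable_sets[OF \<open>(\<lambda>x. itinerary v T k (T x)) \<in> _\<close>, of "{us}"] by auto
    finally show ?thesis .
  qed
  moreover have "itinerary v T (Suc k) \<in> space M \<rightarrow> words S (Suc k)"
    using measurable_space[OF v] measurable_space[OF \<open>(\<lambda>x. itinerary v T k (T x)) \<in> _\<close>]
    by (fastforce simp: words_Suc)
  ultimately show ?case
    by (simp add: measurable_count_space_eq2 finite_words S del: itinerary.simps)
qed

text \<open>The code word of a point is its \<open>v\<close>-itinerary, weighted by a uniform first letter and
  transition weights \<open>\<kappa>\<close>. Its code length is a sum along the orbit, and invariance makes each
  summand contribute the same integral.\<close>

lemma partition_entropy_markov_bound: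
  assumes \<C>: "finite_partition M \<C>"
    and v: "v \<in> M \<rightarrow>\<^sub>M count_space S" and S: "finite S"
    and nn: "\<And>a b. \<lbrakk>a \<in> S; b \<in> S\<rbrakk> \<Longrightarrow> 0 \<le> \<kappa> a b"
    and one: "\<And>a. a \<in> S \<Longrightarrow> (\<Sum>b\<in>S. \<kappa> a b) \<le> 1"
    and pos: "\<And>x. x \<in> space M \<Longrightarrow> 0 < \<kappa> (v x) (v (T x))"
    and refines: "\<And>C x y. \<lbrakk>C \<in> \<C>; x \<in> C; y \<in> space M; itinerary v T (Suc k) x = itinerary v T (Suc k) y\<rbrakk> \<Longrightarrow> y \<in> C"
  shows "partition_entropy M \<C> \<le> ln (card S) + real k * (\<integral>x. - ln (\<kappa> (v x) (v (T x))) \<partial>M)"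
proof -
  define q where "q ws = chain_weight \<kappa> (hd ws) (tl ws) / card S" for ws
  have vS: "v x \<in> S" if "x \<in> space M" for x using measurable_space[OF v that] by simp
  have Tsp: "T x \<in> space M" if "x \<in> space M" for x using measurable_space[OF T_meas that] .
  obtain x0 where "x0 \<in> space M" using not_empty by blast
  then have cS: "0 < card S" using vS S by (auto simp: card_gt_0_iff)
  have lnq: "0 < q (itinerary v T (Suc k) x) \<and> - ln (q (itinerary v T (Suc k) x))
       = ln (card S) + (\<Sum>j<k. - ln (\<kappa> (v ((T ^^ j) x)) (v (T ((T ^^ j) x)))))" if "x \<in> space M" for x
  proof -
    have *: "0 < chain_weight \<kappa> (v x) (itinerary v T k (T x))"
      "- ln (chain_weight \<kappa> (v x) (itinerary v T k (T x)))
        = (\<Sum>j<k. - ln (\<kappa> (v ((T ^^ j) x)) (v (T ((T ^^ j) x)))))"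
      using ln_chain_weight_itinerary[of "space M" \<kappa> v T x k, OF pos Tsp that] by auto
    have "ln (q (itinerary v T (Suc k) x)) = ln (chain_weight \<kappa> (v x) (itinerary v T k (T x))) - ln (card S)"
      unfolding q_def using *(1) cS by (simp add: ln_divide_pos)
    then show ?thesis using * cS by (simp add: q_def)
  qed
  define \<phi> where "\<phi> x = - ln (\<kappa> (v x) (v (T x)))" for x
  have int: "integrable M \<phi>"
  proof -
    have vv: "(\<lambda>x. (v x, v (T x))) \<in> M \<rightarrow>\<^sub>M count_space (S \<times> S)"
      by (rule measurable_count_space_Pair[OF v measurable_compose[OF T_meas v] S S])
    show ?thesis
      using finite_label_integral(1)[OF vv, of "\<lambda>(a, b). - ln (\<kappa> a b)"] S by (simp add: \<phi>_def[abs_def])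
  qed
  have "partition_entropy M \<C> \<le> (\<integral>x. - ln (q (itinerary v T (Suc k) x)) \<partial>M)"
  proof (rule partition_entropy_le_code_length[OF \<C> itinerary_measurable[OF v S] finite_words[OF S] refines])
    show "0 \<le> q ws" if "ws \<in> words S (Suc k)" for ws
      using that chain_weight_nonneg[of S \<kappa>, OF nn]
      by (auto simp: q_def words_Suc) (auto simp: words_def intro!: divide_nonneg_nonneg)
    have "(\<Sum>ws\<in>words S (Suc k). q ws) = (\<Sum>w\<in>S. (\<Sum>ws\<in>words S k. chain_weight \<kappa> w ws) / card S)"
      by (simp add: sum_words_Suc q_def sum_divide_distrib)
    also have "\<dots> \<le> (\<Sum>w\<in>S. 1 / card S)"
      by (intro sum_mono divide_right_mono sum_chain_weight_le S nn one) auto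
    also have "\<dots> = 1" using cS by simp
    finally show "(\<Sum>ws\<in>words S (Suc k). q ws) \<le> 1" .
    show "0 < q ws" if "0 < prob (itinerary v T (Suc k) -` {ws} \<inter> space M)" for ws
    proof -
      have "itinerary v T (Suc k) -` {ws} \<inter> space M \<noteq> {}" using that by (metis measure_empty less_irrefl)
      then obtain x where "x \<in> itinerary v T (Suc k) -` {ws} \<inter> space M" by blast
      then have "x \<in> space M" "itinerary v T (Suc k) x = ws" by simp_all
      then show ?thesis using lnq by metis
    qed
  qed
  also have "\<dots> = (\<integral>x. ln (card S) + (\<Sum>j<k. \<phi> ((T ^^ j) x)) \<partial>M)"
    by (rule Bochner_Integration.integral_cong[OF refl]) (use lnq in \<open>simp add: \<phi>_def del: itinerary.simps\<close>)
  also have "\<dots> = ln (card S) + (\<Sum>j<k. (\<integral>x. \<phi> ((T ^^ j) x) \<partial>M))"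
    using integrable_pow[OF int] by (simp add: prob_space)
  also have "\<dots> = ln (card S) + real k * (\<integral>x. \<phi> x \<partial>M)"
    using integral_pow[OF borel_measurable_integrable[OF int]] by simp
  finally show ?thesis by (simp add: \<phi>_def)
qed

lemma iterated_join_partition:
  assumes "finite_partition M P"
  shows "finite_partition M (iterated_join T M P n)"
proof -
  have fin: "finite P" and sub: "P \<subseteq> events" and part: "partition_on (space M) P"
    using assms by (auto simp: finite_partition_def)
  define c where "c A = {x \<in> space M. \<forall>i<n. (T ^^ i) x \<in> A i}" for A
  have c_restrict: "c (restrict A {..<n}) = c A" for A by (auto simp: c_def)
  have J: "iterated_join T M P n = {c A | A. \<forall>i<n. A i \<in> P} - {{}}"
    by (simp add: iterated_join_def c_def)
  have "{c A | A. \<forall>i<n. A i \<in> P} \<subseteq> c ` (PiE {..<n} (\<lambda>_. P))"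
  proof
    fix C assume "C \<in> {c A | A. \<forall>i<n. A i \<in> P}"
    then obtain A where A: "C = c A" "\<forall>i<n. A i \<in> P" by auto
    then show "C \<in> c ` (PiE {..<n} (\<lambda>_. P))"
      by (intro image_eqI[of _ _ "restrict A {..<n}"]) (auto simp: c_restrict)
  qed
  then have f: "finite (iterated_join T M P n)"
    unfolding J by (intro finite_Diff) (rule finite_subset, auto intro!: finite_PiE fin)
  have meas: "c A \<in> events" if A: "\<forall>i<n. A i \<in> P" for A
  proof -
    have "c A = space M \<inter> (\<Inter>i\<in>{..<n}. (T ^^ i) -` A i \<inter> space M)" by (auto simp: c_def)
    also have "\<dots> \<in> events"
    proof (cases "n = 0")
      case False
      have "(\<Inter>i\<in>{..<n}. (T ^^ i) -` A i \<inter> space M) \<in> events"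
      proof (rule sets.finite_INT)
        show "(T ^^ i) -` A i \<inter> space M \<in> events" if "i \<in> {..<n}" for i
          using A sub that by (intro measurable_sets[OF pow_meas]) auto
      qed (use False in auto)
      then show ?thesis by (rule sets.Int[OF sets.top])
    qed simp
    finally show ?thesis .
  qed
  have "partition_on (space M) (iterated_join T M P n)"
  proof (rule partition_onI)
    show "\<Union>(iterated_join T M P n) = space M"
    proof (intro equalityI subsetI)
      fix x assume x: "x \<in> space M"
      let ?A = "\<lambda>i. cell P ((T ^^ i) x)"
      have "x \<in> c ?A" using x cell_in(2)[OF part pow_space] by (simp add: c_def)
      moreover have "\<forall>i<n. ?A i \<in> P" using cell_in(1)[OF part pow_space[OF x]] by simp
      ultimately show "x \<in> \<Union>(iterated_join T M P n)" unfolding J by blast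
    qed (auto simp: J c_def)
    show "{} \<notin> iterated_join T M P n" by (simp add: J)
    show "disjnt p p'" if pp: "p \<in> iterated_join T M P n" "p' \<in> iterated_join T M P n" "p \<noteq> p'" for p p'
    proof (rule ccontr)
      assume "\<not> disjnt p p'"
      then obtain x where x: "x \<in> p" "x \<in> p'" by (auto simp: disjnt_def)
      obtain A A' where A: "p = c A" "\<forall>i<n. A i \<in> P" "p' = c A'" "\<forall>i<n. A' i \<in> P"
        using pp unfolding J by auto
      have "A i = A' i" if "i < n" for i
      proof -
        have "(T ^^ i) x \<in> A i" "(T ^^ i) x \<in> A' i" "A i \<in> P" "A' i \<in> P"
          using x A that by (auto simp: c_def)
        then show ?thesis using part unfolding partition_on_def disjoint_def by blast
      qed
      then have "c A = c A'" by (auto simp: c_def)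
      then show False using A \<open>p \<noteq> p'\<close> by simp
    qed
  qed
  then show ?thesis
    using f meas by (auto simp: finite_partition_def J)
qed

lemma same_join_cell:
  assumes P: "finite_partition M P" and x: "x \<in> space M" and y: "y \<in> space M"
    and eq: "cell (iterated_join T M P n) x = cell (iterated_join T M P n) y"
    and i: "i < n" and A: "A \<in> P" "(T ^^ i) x \<in> A"
  shows "(T ^^ i) y \<in> A"
proof -
  let ?J = "iterated_join T M P n"
  have part: "partition_on (space M) ?J" "partition_on (space M) P"
    using iterated_join_partition[OF P] P by (auto simp: finite_partition_def)
  have "x \<in> cell ?J x" "y \<in> cell ?J x" "cell ?J x \<in> ?J"
    using cell_in[OF part(1) x] cell_in[OF part(1) y] eq by auto
  then obtain B where B: "\<forall>i<n. B i \<in> P" "(T ^^ i) x \<in> B i" "(T ^^ i) y \<in> B i"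
    using i by (auto simp: iterated_join_def)
  have "B i = A" using B i A part(2) unfolding partition_on_def disjoint_def by blast
  then show ?thesis using B by simp
qed

text \<open>The cell of the longer join is coded by the pair of cells of the first \<open>m\<close> and the last \<open>n\<close>
  observations, as if they were independent.\<close>

lemma partition_entropy_join_subadditive:
  assumes P: "finite_partition M P"
  shows "partition_entropy M (iterated_join T M P (m + n))
    \<le> partition_entropy M (iterated_join T M P m) + partition_entropy M (iterated_join T M P n)"
proof -
  let ?J = "\<lambda>n. iterated_join T M P n"
  have J: "finite_partition M (?J n)" for n by (rule iterated_join_partition[OF P])
  have finJ: "finite (?J n)" and partJ: "partition_on (space M) (?J n)" and subJ: "?J n \<subseteq> events" for n
    using J[of n] by (auto simp: finite_partition_def)
  let ?V = "\<lambda>x. (cell (?J m) x, cell (?J n) ((T ^^ m) x))"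
  let ?q = "\<lambda>(C, D). prob C * prob D"
  have c1: "cell (?J m) \<in> M \<rightarrow>\<^sub>M count_space (?J m)" by (rule cell_measurable[OF J])
  have c2: "(\<lambda>x. cell (?J n) ((T ^^ m) x)) \<in> M \<rightarrow>\<^sub>M count_space (?J n)"
    by (rule measurable_compose[OF pow_meas cell_measurable[OF J]])
  have Vm: "?V \<in> M \<rightarrow>\<^sub>M count_space (?J m \<times> ?J n)"
    by (rule measurable_count_space_Pair[OF c1 c2 finJ finJ])
  have fib: "cell (?J n) -` {C} \<inter> space M = C" if "C \<in> ?J n" for C n
    using cell_in[OF partJ] cell_eq[OF partJ that] sets.sets_into_space[OF subsetD[OF subJ that]] by auto
  have part1: "(\<Sum>C\<in>?J n. prob C) = 1" for n
    using finite_label_integral(2)[OF cell_measurable[OF J[of n]] finJ, of "\<lambda>_. 1"]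
    by (simp add: fib prob_space)
  have ent: "(\<integral>x. - ln (prob (cell (?J n) x)) \<partial>M) = partition_entropy M (?J n)" for n
    using finite_label_integral(2)[OF cell_measurable[OF J[of n]] finJ, of "\<lambda>C. - ln (prob C)"]
    by (simp add: fib partition_entropy_def sum_negf)
  have int: "integrable M (\<lambda>x. - ln (prob (cell (?J n) x)))" for n
    by (rule finite_label_integral(1)[OF cell_measurable[OF J[of n]] finJ])
  have "partition_entropy M (?J (m + n)) \<le> (\<integral>x. - ln (?q (?V x)) \<partial>M)"
  proof (rule partition_entropy_le_code_length[OF J Vm])
    show "finite (?J m \<times> ?J n)" using finJ by simp
    show "y \<in> C" if C: "C \<in> ?J (m + n)" "x \<in> C" and y: "y \<in> space M" and eq: "?V x = ?V y" for C x y
    proof -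
      obtain A where A: "C = {x \<in> space M. \<forall>i<m + n. (T ^^ i) x \<in> A i}" "\<forall>i<m + n. A i \<in> P"
        using C(1) by (auto simp: iterated_join_def)
      have x: "x \<in> space M" "\<And>i. i < m + n \<Longrightarrow> (T ^^ i) x \<in> A i" using C(2) A(1) by auto
      have "(T ^^ i) y \<in> A i" if i: "i < m + n" for i
      proof (cases "i < m")
        case True
        then show ?thesis using same_join_cell[OF P x(1) y, of m i "A i"] eq x(2)[OF i] A(2) i by auto
      next
        case False
        then have i': "i - m < n" "i = (i - m) + m" using i by auto
        have "(T ^^ (i - m)) ((T ^^ m) x) \<in> A i" using x(2)[OF i] i'(2) by (metis comp_apply funpow_add)
        then have "(T ^^ (i - m)) ((T ^^ m) y) \<in> A i"
          using same_join_cell[OF P pow_space[OF x(1)] pow_space[OF y], of n m m "i - m" "A i"] eq A(2) i i'(1) by auto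
        then show ?thesis using i'(2) by (metis comp_apply funpow_add)
      qed
      then show ?thesis using A(1) y by simp
    qed
    show "0 \<le> ?q v" for v by (cases v) simp
    have "(\<Sum>v\<in>?J m \<times> ?J n. ?q v) = (\<Sum>C\<in>?J m. prob C) * (\<Sum>D\<in>?J n. prob D)"
      by (simp add: sum_product sum.cartesian_product)
    then show "(\<Sum>v\<in>?J m \<times> ?J n. ?q v) \<le> 1" by (simp add: part1)
    show "0 < ?q v" if v: "v \<in> ?J m \<times> ?J n" and p: "0 < prob (?V -` {v} \<inter> space M)" for v
    proof -
      obtain C D where CD: "v = (C, D)" "C \<in> ?J m" "D \<in> ?J n" using v by auto
      have "prob (?V -` {v} \<inter> space M) \<le> prob (cell (?J m) -` {C} \<inter> space M)"
        using measurable_sets[OF c1, of "{C}"] CD by (intro finite_measure_mono) auto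
      moreover have "prob (?V -` {v} \<inter> space M) \<le> prob ((T ^^ m) -` D \<inter> space M)"
      proof (rule finite_measure_mono)
        show "?V -` {v} \<inter> space M \<subseteq> (T ^^ m) -` D \<inter> space M"
          using cell_in(2)[OF partJ pow_space] CD(1) by force
        show "(T ^^ m) -` D \<inter> space M \<in> events"
          using CD subJ by (intro measurable_sets[OF pow_meas]) auto
      qed
      moreover have "prob ((T ^^ m) -` D \<inter> space M) = prob D"
        using CD(3) subJ by (intro prob_pow) blast
      ultimately have "0 < prob C" "0 < prob D"
        using p fib[OF CD(2)] by auto
      then show ?thesis by (simp add: CD)
    qed
  qed
  also have "\<dots> = (\<integral>x. - ln (prob (cell (?J m) x)) + - ln (prob (cell (?J n) ((T ^^ m) x))) \<partial>M)"
  proof (rule Bochner_Integration.integral_cong_AE)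
    show "(\<lambda>x. - ln (?q (?V x))) \<in> borel_measurable M"
      by (rule borel_measurable_integrable, rule finite_label_integral(1)[OF Vm]) (use finJ in simp)
    show "(\<lambda>x. - ln (prob (cell (?J m) x)) + - ln (prob (cell (?J n) ((T ^^ m) x)))) \<in> borel_measurable M"
      using int[of m] integrable_pow[OF int[of n], of m]
      by (intro borel_measurable_integrable Bochner_Integration.integrable_add)
    \<comment> \<open>The logarithm of the product splits only where both factors are positive.\<close>
    have nz: "AE x in M. prob (cell (?J n) x) \<noteq> 0" for n
    proof -
      have "(\<Union>C\<in>{C \<in> ?J n. prob C = 0}. C) \<in> null_sets M"
        using finJ[of n] subJ[of n]
        by (intro null_sets_UN') (auto simp: countable_finite emeasure_eq_measure)
      then have "AE x in M. x \<notin> (\<Union>C\<in>{C \<in> ?J n. prob C = 0}. C)" by (rule AE_not_in)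
      then show ?thesis
        by (rule AE_mp) (rule AE_I2, use cell_in[OF partJ] in blast)
    qed
    have "AE x in distr M M (T ^^ m). prob (cell (?J n) x) \<noteq> 0" unfolding pow_inv by (rule nz)
    then have nz2: "AE x in M. prob (cell (?J n) ((T ^^ m) x)) \<noteq> 0"
      by (rule AE_distrD[OF pow_meas])
    show "AE x in M. - ln (?q (?V x)) = - ln (prob (cell (?J m) x)) + - ln (prob (cell (?J n) ((T ^^ m) x)))"
      using nz[of m] nz2
    proof eventually_elim
      case (elim x)
      then have "0 < prob (cell (?J m) x)" "0 < prob (cell (?J n) ((T ^^ m) x))"
        by (auto simp: zero_less_measure_iff)
      then show ?case by (simp add: ln_mult_pos)
    qed
  qed
  also have "\<dots> = (\<integral>x. - ln (prob (cell (?J m) x)) \<partial>M) + (\<integral>x. - ln (prob (cell (?J n) ((T ^^ m) x))) \<partial>M)"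
    by (rule Bochner_Integration.integral_add[OF int integrable_pow[OF int]])
  also have "(\<integral>x. - ln (prob (cell (?J n) ((T ^^ m) x))) \<partial>M) = (\<integral>x. - ln (prob (cell (?J n) x)) \<partial>M)"
    by (rule integral_pow[OF borel_measurable_integrable[OF int]])
  finally show ?thesis by (simp only: ent)
qed

lemma partition_entropy_join_0: "partition_entropy M (iterated_join T M P 0) = 0"
  by (simp add: partition_entropy_def iterated_join_def not_empty prob_space)

lemma partition_entropy_join_convergent:
  assumes P: "finite_partition M P"
  shows "convergent (\<lambda>n. partition_entropy M (iterated_join T M P n) / real n)"
  by (intro subadditive_convergent partition_entropy_join_subadditive[OF P] partition_entropy_join_0
      partition_entropy_nonneg[OF iterated_join_partition[OF P]])

text \<open>Convergence of the entropy rate allows evaluation along multiples of \<open>m\<close>, which gives a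
  bound for \<open>T ^^ m\<close> in place of \<open>T\<close>.\<close>

lemma entropy_rate_le:
  assumes P: "finite_partition M P" and m: "0 < m"
    and bound: "\<And>k. partition_entropy M (iterated_join T M P (Suc k * m)) \<le> c + real k * C"
  shows "lim (\<lambda>n. partition_entropy M (iterated_join T M P n) / real n) \<le> C / real m"
proof -
  let ?a = "\<lambda>n. partition_entropy M (iterated_join T M P n) / real n"
  have "?a \<longlonglongrightarrow> lim ?a"
    using partition_entropy_join_convergent[OF P] by (simp add: convergent_LIMSEQ_iff)
  moreover have "strict_mono (\<lambda>k. Suc k * m)" using m by (simp add: strict_mono_def)
  ultimately have "(?a \<circ> (\<lambda>k. Suc k * m)) \<longlonglongrightarrow> lim ?a" by (rule LIMSEQ_subseq_LIMSEQ)
  moreover have "(\<lambda>k. c / real m * (1 / real (Suc k)) + real k / real (Suc k) * (C / real m)) \<longlonglongrightarrow> c / real m * 0 + 1 * (C / real m)"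
  proof (intro tendsto_intros)
    show "(\<lambda>k. 1 / real (Suc k)) \<longlonglongrightarrow> 0" using LIMSEQ_inverse_real_of_nat by (simp add: inverse_eq_divide)
    show "(\<lambda>k. real k / real (Suc k)) \<longlonglongrightarrow> 1" by (rule LIMSEQ_n_over_Suc_n)
  qed
  moreover have "(?a \<circ> (\<lambda>k. Suc k * m)) k \<le> c / real m * (1 / real (Suc k)) + real k / real (Suc k) * (C / real m)" for k
  proof -
    have "?a (Suc k * m) \<le> (c + real k * C) / real (Suc k * m)"
      by (intro divide_right_mono bound) simp
    also have "\<dots> = c / real m * (1 / real (Suc k)) + real k / real (Suc k) * (C / real m)"
      by (simp add: add_divide_distrib algebra_simps)
    finally show ?thesis by simp
  qed
  ultimately show ?thesis using LIMSEQ_le by fastforce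
qed

end

section \<open>Volume of linear images\<close>

lemma measure_image_eq_of_cbox:
  fixes f :: "real^'n \<Rightarrow> real^'n"
  assumes "linear f" "\<bar>det (matrix f)\<bar> = 1" "S \<in> lmeasurable"
    and "\<And>a b. measure lebesgue (f ` cbox a b) = measure lebesgue (cbox a b)"
  shows "f ` S \<in> lmeasurable \<and> measure lebesgue (f ` S) = \<bar>det (matrix f)\<bar> * measure lebesgue S"
  using measure_linear_sufficient[OF assms(1,3), of 1] assms(2,4) by simp

text \<open>Translating along the sheared axis reduces to a box with \<open>a $ n = 0\<close>, where
  \<open>measure_shear_interval\<close> applies.\<close>

lemma shear_volume_preserving:
  fixes S :: "(real^'n) set"
  assumes mn: "m \<noteq> n" and S: "S \<in> lmeasurable"
  defines "h \<equiv> \<lambda>x :: real^'n. \<chi> i. if i = m then x $ m + x $ n else x $ i"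
  shows "h ` S \<in> lmeasurable \<and> measure lebesgue (h ` S) = \<bar>det (matrix h)\<bar> * measure lebesgue S"
proof (rule measure_image_eq_of_cbox[OF _ _ S])
  show lin: "linear h"
    unfolding h_def by (rule linearI) (auto simp: vec_eq_iff algebra_simps)
  have "matrix h = (\<chi> k. if k = m then row m (mat 1) + 1 *s row n (mat 1) else row k (mat 1))"
    by (auto simp: vec_eq_iff matrix_def h_def row_def mat_def axis_def)
  then show "\<bar>det (matrix h)\<bar> = 1"
    using det_row_operation[OF mn, of "mat 1 :: real^'n^'n" 1] by simp
  fix a b :: "real^'n"
  show "measure lebesgue (h ` cbox a b) = measure lebesgue (cbox a b)"
  proof (cases "cbox a b = {}")
    case False
    define v :: "real^'n" where "v = axis n (a $ n)"
    have cb: "cbox a b = (+) v ` cbox (a - v) (b - v)"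
      using cbox_translation[of v "a - v" "b - v"] by simp
    have "h ` (+) v ` B = (+) (h v) ` h ` B" for B
      unfolding image_image linear_add[OF lin] ..
    then have "measure lebesgue (h ` cbox a b) = measure lebesgue (h ` cbox (a - v) (b - v))"
      unfolding cb by (simp add: measure_translation)
    also have "\<dots> = measure lebesgue (cbox (a - v) (b - v))"
      unfolding h_def
    proof (rule measure_shear_interval[OF mn])
      show "cbox (a - v) (b - v) \<noteq> {}" using False cb by auto
      show "0 \<le> (a - v) $ n" by (simp add: v_def)
    qed
    also have "\<dots> = measure lebesgue (cbox a b)" unfolding cb by (rule measure_translation[symmetric])
    finally show ?thesis .
  qed simp
qed

lemma coordinate_swap_volume_preserving:
  fixes S :: "(real^'n) set" and m n :: 'n
  assumes S: "S \<in> lmeasurable"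
  defines "\<tau> \<equiv> Transposition.transpose m n"
  defines "h \<equiv> \<lambda>x :: real^'n. \<chi> i. x $ \<tau> i"
  shows "h ` S \<in> lmeasurable \<and> measure lebesgue (h ` S) = \<bar>det (matrix h)\<bar> * measure lebesgue S"
proof (rule measure_image_eq_of_cbox[OF _ _ S])
  have tt: "\<tau> (\<tau> i) = i" for i by (simp add: \<tau>_def)
  have perm: "\<tau> permutes UNIV" by (simp add: \<tau>_def permutes_swap_id)
  have hh: "h (h x) = x" for x by (simp add: h_def vec_eq_iff tt)
  show "linear h"
    unfolding h_def by (rule linearI) (auto simp: vec_eq_iff)
  have "matrix h = (\<chi> i. mat 1 $ \<tau> i)"
    by (auto simp: vec_eq_iff matrix_def h_def mat_def axis_def)
  then show "\<bar>det (matrix h)\<bar> = 1"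
    using det_permute_rows[OF perm, of "mat 1 :: real^'n^'n"] by (simp add: abs_mult sign_def)
  fix a b :: "real^'n"
  have mem: "h x \<in> cbox (h a) (h b) \<longleftrightarrow> x \<in> cbox a b" for x a b
  proof -
    have "(\<forall>i. a $ \<tau> i \<le> x $ \<tau> i \<and> x $ \<tau> i \<le> b $ \<tau> i) \<longleftrightarrow> (\<forall>i. a $ i \<le> x $ i \<and> x $ i \<le> b $ i)"
      by (metis tt)
    then show ?thesis by (simp add: mem_box_cart h_def)
  qed
  have img: "h ` cbox a b = cbox (h a) (h b)"
  proof (intro equalityI subsetI)
    fix y assume "y \<in> cbox (h a) (h b)"
    then have "h y \<in> cbox a b" using mem[of "h y" a b] by (simp add: hh)
    then show "y \<in> h ` cbox a b" using hh[of y] by (metis imageI)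
  qed (use mem in auto)
  show "measure lebesgue (h ` cbox a b) = measure lebesgue (cbox a b)"
  proof (cases "cbox a b = {}")
    case False
    then have ne: "cbox (h a) (h b) \<noteq> {}" using img by auto
    have "(\<Prod>i\<in>UNIV. h b $ i - h a $ i) = (\<Prod>i\<in>UNIV. b $ i - a $ i)"
      using prod.permute[OF perm, of "\<lambda>i. b $ i - a $ i"] by (simp add: h_def comp_def)
    then show ?thesis using False ne by (simp add: img content_cbox_cart)
  qed simp
qed

text \<open>A linear map is a composition of shears, coordinate swaps, stretches and maps that annihilate a
  coordinate; the formula is multiplicative and holds for each of these. This is
  \<open>measure_linear_image\<close> for an index type without an order.\<close>

lemma measure_matrix_image:
  fixes D :: "real^'n^'n" and S :: "(real^'n) set"
  assumes "S \<in> lmeasurable"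
  shows "(*v) D ` S \<in> lmeasurable \<and> measure lebesgue ((*v) D ` S) = \<bar>det D\<bar> * measure lebesgue S"
proof -
  let ?P = "\<lambda>f :: real^'n \<Rightarrow> real^'n. \<forall>S\<in>lmeasurable.
    f ` S \<in> lmeasurable \<and> measure lebesgue (f ` S) = \<bar>det (matrix f)\<bar> * measure lebesgue S"
  have "?P ((*v) D)"
  proof (rule induct_linear_elementary[of "(*v) D" ?P])
    show "linear ((*v) D)" by simp
    show "?P (f \<circ> g)" if fg: "linear f" "linear g" "?P f" "?P g" for f g
    proof
      fix S :: "(real^'n) set" assume S: "S \<in> lmeasurable"
      have "(f \<circ> g) ` S = f ` g ` S" by (simp only: image_comp)
      moreover have "\<bar>det (matrix (f \<circ> g))\<bar> = \<bar>det (matrix f)\<bar> * \<bar>det (matrix g)\<bar>"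
        by (simp only: matrix_compose[OF fg(2,1)] det_mul abs_mult)
      ultimately show "(f \<circ> g) ` S \<in> lmeasurable
          \<and> measure lebesgue ((f \<circ> g) ` S) = \<bar>det (matrix (f \<circ> g))\<bar> * measure lebesgue S"
        using fg(3,4) S by simp
    qed
    show "?P f" if f: "linear f" "\<And>x. f x $ i = 0" for f i
    proof -
      have "f x \<noteq> axis i 1" for x
      proof
        assume "f x = axis i 1"
        then show False using f(2)[of x] by simp
      qed
      then have "\<not> surj f" by (metis surjD)
      then have ninj: "\<not> inj f" using linear_injective_imp_surjective[OF f(1)] by blast
      have "negligible (f ` S)" for S by (rule negligible_linear_singular_image[OF f(1) ninj])
      moreover have "det (matrix f) = 0" using ninj det_nz_iff_inj[OF f(1)] by blast
      ultimately show ?thesis by (simp add: negligible_iff_measure)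
    qed
    show "?P (\<lambda>x. \<chi> i. c i * x $ i)" for c
    proof -
      have "matrix (\<lambda>x. \<chi> i. c i * x $ i) = (\<chi> i j. if i = j then c i else 0)"
        by (auto simp: matrix_def vec_eq_iff axis_def)
      then have "det (matrix (\<lambda>x. \<chi> i. c i * x $ i)) = prod c UNIV" by (simp add: det_diagonal)
      then show ?thesis by (simp add: measurable_stretch measure_stretch)
    qed
    show "?P (\<lambda>x. \<chi> i. x $ Transposition.transpose m n i)" for m n
      using coordinate_swap_volume_preserving by blast
    show "?P (\<lambda>x. \<chi> i. if i = m then x $ m + x $ n else x $ i)" if "m \<noteq> n" for m n
      using shear_volume_preserving[OF that] by blast
  qed
  then show ?thesis using assms by simp
qed

section \<open>Counting grid cells\<close>

text \<open>The index of the half-open cube of side \<open>s\<close> that contains \<open>x\<close>.\<close>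

definition grid_index :: "real \<Rightarrow> real^'n \<Rightarrow> 'n \<Rightarrow> int" where
  "grid_index s x = (\<lambda>i. \<lfloor>x $ i / s\<rfloor>)"

lemma grid_index_eq_iff:
  assumes "0 < s"
  shows "grid_index s x = c \<longleftrightarrow> (\<forall>i. s * of_int (c i) \<le> x $ i \<and> x $ i < s * (of_int (c i) + 1))"
  using assms by (auto simp: grid_index_def fun_eq_iff floor_eq_iff field_simps)

lemma grid_index_eq_imp_dist_le:
  fixes x y :: "real^'n"
  assumes s: "0 < s" and eq: "grid_index s x = grid_index s y"
  shows "norm (x - y) \<le> real CARD('n) * s"
proof -
  have "\<bar>(x - y) $ i\<bar> \<le> s" for i
  proof -
    have "s * of_int (grid_index s y i) \<le> x $ i" "x $ i < s * (of_int (grid_index s y i) + 1)"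
      "s * of_int (grid_index s y i) \<le> y $ i" "y $ i < s * (of_int (grid_index s y i) + 1)"
      using grid_index_eq_iff[OF s, of x "grid_index s y"] grid_index_eq_iff[OF s, of y "grid_index s y"] eq by auto
    then show ?thesis by (simp add: algebra_simps abs_if)
  qed
  then have "(\<Sum>i\<in>UNIV. \<bar>(x - y) $ i\<bar>) \<le> (\<Sum>i\<in>(UNIV::'n set). s)" by (intro sum_mono)
  then show ?thesis using norm_le_l1_cart[of "x - y"] by simp
qed

lemma finite_grid_index_image:
  fixes X :: "(real^'n) set"
  assumes X: "bounded X" and s: "0 < s"
  shows "finite (grid_index s ` X)"
proof -
  obtain r where r: "\<And>x. x \<in> X \<Longrightarrow> norm x \<le> r" using X by (auto simp: bounded_iff)
  have "grid_index s ` X \<subseteq> PiE UNIV (\<lambda>_. {\<lfloor>- r / s\<rfloor>..\<lfloor>r / s\<rfloor>})"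
  proof
    fix c assume "c \<in> grid_index s ` X"
    then obtain x where x: "x \<in> X" "c = grid_index s x" by auto
    have "- r \<le> x $ i \<and> x $ i \<le> r" for i
      using component_le_norm_cart[of x i] r[OF x(1)] by (simp add: abs_le_iff)
    then have "\<lfloor>- r / s\<rfloor> \<le> c i \<and> c i \<le> \<lfloor>r / s\<rfloor>" for i
      unfolding x(2) grid_index_def using s by (intro conjI floor_mono divide_right_mono) auto
    then show "c \<in> PiE UNIV (\<lambda>_. {\<lfloor>- r / s\<rfloor>..\<lfloor>r / s\<rfloor>})" by auto
  qed
  then show ?thesis by (rule finite_subset) (intro finite_PiE, auto)
qed

lemma measure_cube:
  fixes l :: "real^'n"
  assumes "0 \<le> s"
  shows "measure lebesgue (box l (l + (\<chi> i. s))) = s ^ CARD('n)"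
    and "measure lebesgue (cbox l (l + (\<chi> i. s))) = s ^ CARD('n)"
proof -
  have b: "(\<chi> i. s) \<bullet> b = s" if "b \<in> Basis" for b :: "real^'n"
    using that by (auto simp: Basis_vec_def inner_axis)
  have le: "l \<bullet> b \<le> (l + (\<chi> i. s)) \<bullet> b" if "b \<in> Basis" for b
    using b[OF that] assms by (simp add: inner_add_left)
  have "(\<Prod>b\<in>Basis. (l + (\<chi> i. s) - l) \<bullet> b) = (\<Prod>b\<in>(Basis :: (real^'n) set). s)"
    by (rule prod.cong) (use b in \<open>simp_all add: inner_diff_left inner_add_left\<close>)
  also have "\<dots> = s ^ CARD('n)" by simp
  finally have p: "(\<Prod>b\<in>Basis. (l + (\<chi> i. s) - l) \<bullet> b) = s ^ CARD('n)" .
  show "measure lebesgue (box l (l + (\<chi> i. s))) = s ^ CARD('n)"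
    using measure_lborel_box_eq[of l "l + (\<chi> i. s)"] le p by simp
  show "measure lebesgue (cbox l (l + (\<chi> i. s))) = s ^ CARD('n)"
    using measure_lborel_cbox_eq[of l "l + (\<chi> i. s)"] le p by simp
qed

lemma expansion_imp_inj:
  fixes A :: "real^'n^'n"
  assumes "\<And>v. norm v \<le> c * norm (A *v v)"
  shows "inj ((*v) A)"
proof (rule injI)
  fix u v assume "A *v u = A *v v"
  then have "A *v (u - v) = 0" by (simp add: matrix_vector_mult_diff_distrib)
  then show "u = v" using assms[of "u - v"] by simp
qed

lemma expansion_imp_det_nonzero:
  fixes A :: "real^'n^'n"
  assumes "\<And>v. norm v \<le> c * norm (A *v v)"
  shows "det A \<noteq> 0"
  using expansion_imp_inj[OF assms] det_nz_iff_inj[of "(*v) A"] by simp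

text \<open>All cubes reached from the cube of \<open>x\<close> lie in the image under \<open>v \<mapsto> g x + D v\<close> of a cube of
  side proportional to \<open>(1 + 2 c) s\<close>: the linearization error and the size of the target cubes
  are of order \<open>s\<close>, and the image under \<open>D\<close> of a ball of radius \<open>c \<delta>\<close> covers the ball of radius
  \<open>\<delta>\<close>. The target cubes are disjoint, so comparing volumes gives the bound.\<close>

lemma card_grid_image_le:
  fixes g :: "real^'n \<Rightarrow> real^'n" and D :: "real^'n^'n"
  assumes s: "0 < s" and fin: "finite (grid_index s ` g ` X)"
    and c: "0 \<le> c" and exp: "\<And>v. norm v \<le> c * norm (D *v v)"
    and lin: "\<And>y. \<lbrakk>y \<in> X; grid_index s y = grid_index s x\<rbrakk> \<Longrightarrow> norm (g y - g x - D *v (y - x)) \<le> norm (y - x)"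
  shows "real (card {grid_index s (g y) | y. y \<in> X \<and> grid_index s y = grid_index s x})
    \<le> \<bar>det D\<bar> * (2 * real CARD('n) * (1 + 2 * c)) ^ CARD('n)"
proof -
  let ?T = "{grid_index s (g y) | y. y \<in> X \<and> grid_index s y = grid_index s x}"
  define d where "d = real CARD('n) * s"
  have d: "0 \<le> d" using s by (simp add: d_def)
  \<comment> \<open>One \<open>d\<close> for the source cube, and \<open>c\<close> times \<open>2 d\<close> for the linearization error
    and the target cube.\<close>
  define R where "R = d * (1 + 2 * c)"
  have R: "0 \<le> R" using d c by (simp add: R_def)
  have finT: "finite ?T" by (rule finite_subset[OF _ fin]) auto
  define lo :: "('n \<Rightarrow> int) \<Rightarrow> real^'n" where "lo c = (\<chi> i. s * of_int (c i))" for c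
  define B where "B c = box (lo c) (lo c + (\<chi> i. s))" for c
  have inB: "grid_index s z = c" if "z \<in> B c" for z c
    using that s by (auto simp: grid_index_eq_iff B_def lo_def mem_box_cart algebra_simps less_imp_le)
  have disj: "disjoint_family_on B ?T"
    unfolding disjoint_family_on_def
  proof (intro ballI impI, rule ccontr)
    fix m n assume "m \<noteq> n" "B m \<inter> B n \<noteq> {}"
    then obtain z where "z \<in> B m" "z \<in> B n" by auto
    then have "m = n" using inB[of z m] inB[of z n] by simp
    then show False using \<open>m \<noteq> n\<close> by simp
  qed
  have "inj ((*v) D)" by (rule expansion_imp_inj[OF exp])
  then have surj: "surj ((*v) D)" by (intro linear_injective_imp_surjective) auto
  let ?E = "(+) (g x) ` (*v) D ` cbox (\<chi> i. - R) ((\<chi> i. - R) + (\<chi> i. 2 * R))"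
  have sub: "(\<Union>c\<in>?T. B c) \<subseteq> ?E"
  proof
    fix z assume "z \<in> (\<Union>c\<in>?T. B c)"
    then obtain y where y: "y \<in> X" "grid_index s y = grid_index s x" "z \<in> B (grid_index s (g y))" by auto
    have yx: "norm (y - x) \<le> d" unfolding d_def by (rule grid_index_eq_imp_dist_le[OF s y(2)])
    have zg: "norm (z - g y) \<le> d"
      unfolding d_def by (rule grid_index_eq_imp_dist_le[OF s]) (rule inB[OF y(3)])
    have r: "norm (g y - g x - D *v (y - x)) \<le> d" using lin[OF y(1,2)] yx by linarith
    obtain u where u: "D *v u = (z - g y) + (g y - g x - D *v (y - x))" using surj by (metis surjD)
    have "norm (D *v u) \<le> 2 * d" unfolding u using zg r by (intro norm_triangle_le) simp
    then have "norm u \<le> c * (2 * d)" using exp[of u] mult_left_mono[OF _ c] order_trans by blast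
    then have "norm ((y - x) + u) \<le> R"
      using yx by (intro norm_triangle_le) (simp add: R_def algebra_simps)
    then have "\<bar>((y - x) + u) $ i\<bar> \<le> R" for i
      using component_le_norm_cart[of "(y - x) + u" i] by linarith
    then have "- R \<le> ((y - x) + u) $ i \<and> ((y - x) + u) $ i \<le> R" for i
      unfolding abs_le_iff by (meson minus_le_iff)
    then have "(y - x) + u \<in> cbox (\<chi> i. - R) ((\<chi> i. - R) + (\<chi> i. 2 * R))"
      by (simp add: mem_box_cart)
    moreover have "z = g x + D *v ((y - x) + u)"
      unfolding matrix_vector_right_distrib u by simp
    ultimately show "z \<in> ?E" by blast
  qed
  have lmE: "(*v) D ` cbox (\<chi> i. - R) ((\<chi> i. - R) + (\<chi> i. 2 * R)) \<in> lmeasurable"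
    by (rule conjunct1[OF measure_matrix_image]) auto
  have "real (card ?T) * s ^ CARD('n) = (\<Sum>c\<in>?T. measure lebesgue (B c))"
    unfolding B_def measure_cube(1)[OF less_imp_le[OF s]] by simp
  also have "\<dots> = measure lebesgue (\<Union>c\<in>?T. B c)"
    by (rule measure_finite_Union[symmetric, OF finT _ disj]) (auto simp: B_def emeasure_lborel_box_eq)
  also have "\<dots> \<le> measure lebesgue ?E"
    by (rule measure_mono_fmeasurable[OF sub]) (use finT lmE in \<open>auto simp: B_def intro: measurable_translation\<close>)
  also have "\<dots> = \<bar>det D\<bar> * (2 * R) ^ CARD('n)"
  proof -
    have "measure lebesgue ?E = \<bar>det D\<bar> * measure lebesgue (cbox (\<chi> i. - R) ((\<chi> i. - R) + (\<chi> i. 2 * R)) :: (real^'n) set)"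
      unfolding measure_translation by (rule conjunct2[OF measure_matrix_image]) auto
    then show ?thesis using measure_cube(2)[of "2 * R" "(\<chi> i. - R) :: real^'n"] R by simp
  qed
  also have "\<dots> = \<bar>det D\<bar> * (2 * real CARD('n) * (1 + 2 * c)) ^ CARD('n) * s ^ CARD('n)"
  proof -
    have "2 * R = 2 * real CARD('n) * (1 + 2 * c) * s" by (simp add: R_def d_def)
    then show ?thesis by (simp only: power_mult_distrib mult.assoc)
  qed
  finally show ?thesis using s by simp
qed

text \<open>By inner regularity each cell is exhausted, up to small measure, by a compact set, and
  finitely many disjoint compact sets have positive mutual distance. So outside a set of small
  measure, a sufficiently accurate position determines the cell.\<close>

lemma cell_approximation:
  fixes \<mu> :: "(real^'n) measure"
  assumes "prob_space \<mu>" and sets: "sets \<mu> = sets (restrict_space borel X)" and X: "X \<in> sets borel"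
    and \<C>: "finite_partition \<mu> \<C>" and e: "0 < e"
  shows "\<exists>d>0. \<exists>G\<in>sets \<mu>. measure \<mu> (space \<mu> - G) \<le> e \<and>
    (\<forall>x\<in>G. \<forall>y\<in>G. dist x y < d \<longrightarrow> cell \<C> x = cell \<C> y)"
proof -
  interpret prob_space \<mu> by fact
  have fin: "finite \<C>" and sub: "\<C> \<subseteq> sets \<mu>" and part: "partition_on (space \<mu>) \<C>"
    using \<C> by (auto simp: finite_partition_def)
  have sp: "space \<mu> = X" using sets_eq_imp_space_eq[OF sets] by (simp add: space_restrict_space)
  have borel: "A \<in> sets \<mu> \<longleftrightarrow> A \<in> sets borel \<and> A \<subseteq> X" for A
    unfolding sets using X by (simp add: sets_restrict_space_iff conj_commute)
  have ne: "\<C> \<noteq> {}" using part not_empty partition_onD1[OF part] by auto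
  define \<nu> where "\<nu> = distr \<mu> borel (\<lambda>x. x)"
  have id: "(\<lambda>x. x) \<in> \<mu> \<rightarrow>\<^sub>M borel"
  proof (rule measurableI)
    fix A :: "(real^'n) set" assume "A \<in> sets borel"
    then show "(\<lambda>x. x) -` A \<inter> space \<mu> \<in> sets \<mu>" using X sp by (simp add: borel)
  qed simp
  have \<nu>: "emeasure \<nu> A = emeasure \<mu> A" if "A \<in> sets \<mu>" for A
    using that borel sets.sets_into_space[OF that] by (simp add: \<nu>_def emeasure_distr[OF id] Int_absorb2)
  have "prob_space \<nu>" unfolding \<nu>_def by (rule prob_space_distr[OF id])
  then interpret N: prob_space \<nu> .
  define \<epsilon> where "\<epsilon> = e / card \<C>"
  have cC: "0 < card \<C>" using fin ne by (simp add: card_gt_0_iff)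
  have \<epsilon>: "0 < \<epsilon>" using e cC by (simp add: \<epsilon>_def)
  have "\<exists>K. compact K \<and> K \<subseteq> C \<and> K \<in> sets \<mu> \<and> measure \<mu> (C - K) \<le> \<epsilon>" if C: "C \<in> \<C>" for C
  proof -
    have Cb: "C \<in> sets borel" "C \<subseteq> X" "C \<in> sets \<mu>" using C sub borel by auto
    have "emeasure \<nu> C = (SUP K \<in> {K. K \<subseteq> C \<and> compact K}. emeasure \<nu> K)"
      by (rule inner_regular) (simp_all add: \<nu>_def Cb(1) N.emeasure_finite[unfolded \<nu>_def])
    show ?thesis
    proof (cases "prob C \<le> \<epsilon>")
      case True
      then show ?thesis by (intro exI[of _ "{}"]) auto
    next
      case False
      have "ennreal (prob C - \<epsilon>) < emeasure \<nu> C"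
        using False \<epsilon> \<nu>[OF Cb(3)] by (simp add: emeasure_eq_measure ennreal_less_iff)
      then obtain K where K: "K \<subseteq> C" "compact K" "ennreal (prob C - \<epsilon>) < emeasure \<nu> K"
        using \<open>emeasure \<nu> C = _\<close> by (auto simp: less_SUP_iff)
      have Ks: "K \<in> sets \<mu>" using K Cb by (auto simp: borel compact_imp_closed borel_closed)
      have "prob C - \<epsilon> < prob K"
        using K(3) False \<nu>[OF Ks] by (simp add: emeasure_eq_measure ennreal_less_iff)
      then have "prob (C - K) \<le> \<epsilon>" using finite_measure_Diff[OF Cb(3) Ks K(1)] by simp
      then show ?thesis using K Ks by blast
    qed
  qed
  then obtain \<K> where \<K>: "\<And>C. C \<in> \<C> \<Longrightarrow> compact (\<K> C) \<and> \<K> C \<subseteq> C \<and> \<K> C \<in> sets \<mu> \<and> measure \<mu> (C - \<K> C) \<le> \<epsilon>"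
    by metis
  define pairs where "pairs = {(C, C'). C \<in> \<C> \<and> C' \<in> \<C> \<and> C \<noteq> C'}"
  have finp: "finite pairs" by (rule finite_subset[of _ "\<C> \<times> \<C>"]) (use fin in \<open>auto simp: pairs_def\<close>)
  have "\<exists>d>0. \<forall>x\<in>\<K> C. \<forall>y\<in>\<K> C'. d \<le> dist x y" if "(C, C') \<in> pairs" for C C'
  proof (rule separate_compact_closed)
    show "compact (\<K> C)" "closed (\<K> C')" using that \<K> by (auto simp: pairs_def compact_imp_closed)
    have "C \<inter> C' = {}" using that part by (auto simp: pairs_def partition_on_def disjoint_def)
    then show "\<K> C \<inter> \<K> C' = {}" using that \<K>[of C] \<K>[of C'] by (auto simp: pairs_def)
  qed
  then obtain \<delta> where \<delta>: "\<And>C C'. (C, C') \<in> pairs \<Longrightarrow> 0 < \<delta> C C' \<and> (\<forall>x\<in>\<K> C. \<forall>y\<in>\<K> C'. \<delta> C C' \<le> dist x y)"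
    by metis
  define d where "d = Min (insert 1 ((\<lambda>(C, C'). \<delta> C C') ` pairs))"
  have d: "0 < d" unfolding d_def using finp \<delta> by (subst Min_gr_iff) auto
  have dle: "d \<le> \<delta> C C'" if "(C, C') \<in> pairs" for C C'
    unfolding d_def using that finp by (intro Min_le) (auto intro!: image_eqI[of _ _ "(C, C')"])
  define G where "G = (\<Union>C\<in>\<C>. \<K> C)"
  have Gs: "G \<in> sets \<mu>" unfolding G_def using fin \<K> by (intro sets.finite_UN) auto
  have "space \<mu> - G \<subseteq> (\<Union>C\<in>\<C>. C - \<K> C)"
    using partition_onD1[OF part] by (auto simp: G_def)
  then have "prob (space \<mu> - G) \<le> prob (\<Union>C\<in>\<C>. C - \<K> C)"
    using fin \<K> sub by (intro finite_measure_mono sets.finite_UN sets.Diff) auto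
  also have "\<dots> \<le> (\<Sum>C\<in>\<C>. prob (C - \<K> C))"
    using fin \<K> sub by (intro finite_measure_subadditive_finite) auto
  also have "\<dots> \<le> (\<Sum>C\<in>\<C>. \<epsilon>)" using \<K> by (intro sum_mono) auto
  also have "\<dots> = e" using cC by (simp add: \<epsilon>_def)
  finally have small: "prob (space \<mu> - G) \<le> e" .
  have sep: "cell \<C> x = cell \<C> y" if "x \<in> G" "y \<in> G" "dist x y < d" for x y
  proof -
    obtain C C' where CC: "C \<in> \<C>" "C' \<in> \<C>" "x \<in> \<K> C" "y \<in> \<K> C'" using \<open>x \<in> G\<close> \<open>y \<in> G\<close> by (auto simp: G_def)
    have "C = C'"
    proof (rule ccontr)
      assume "C \<noteq> C'"
      then have "(C, C') \<in> pairs" using CC by (simp add: pairs_def)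
      then show False using \<delta>[of C C'] dle[of C C'] CC \<open>dist x y < d\<close> by force
    qed
    moreover have "x \<in> C" "y \<in> C'" using CC \<K> by blast+
    ultimately show ?thesis using cell_eq[OF part] CC by metis
  qed
  show ?thesis using d Gs small sep by blast
qed

section \<open>Entropy and the Jacobian determinant\<close>

lemma grid_index_measurable:
  fixes X :: "(real^'n) set"
  assumes sets: "sets M = sets (restrict_space borel X)" and X: "compact X" and s: "0 < s"
  shows "grid_index s \<in> M \<rightarrow>\<^sub>M count_space (grid_index s ` X)"
proof -
  have sp: "space M = X" using sets_eq_imp_space_eq[OF sets] by (simp add: space_restrict_space)
  have "grid_index s -` {c} \<inter> space M \<in> sets M" for c
  proof -
    have "grid_index s -` {c} = (\<Inter>i. {x. s * of_int (c i) \<le> x $ i} \<inter> {x. x $ i < s * (of_int (c i) + 1)})"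
      using grid_index_eq_iff[OF s, of _ c] by (auto simp: vimage_def)
    also have "\<dots> \<in> sets borel"
    proof (rule sets.finite_INT)
      show "{x. s * of_int (c i) \<le> x $ i} \<inter> {x. x $ i < s * (of_int (c i) + 1)} \<in> sets borel" for i
        by (intro sets.Int borel_closed borel_open closed_halfspace_component_ge_cart
            open_halfspace_component_lt_cart)
    qed auto
    finally have "grid_index s -` {c} \<in> sets borel" .
    then show ?thesis
      unfolding sets sp using X
      by (auto simp: sets_restrict_space_iff compact_imp_closed borel_closed)
  qed
  then show ?thesis
    using finite_grid_index_image[OF compact_imp_bounded[OF X] s] sp
    by (auto simp: measurable_count_space_eq2)
qed

text \<open>Points are coded by the visited grid cube together with the cell of the \<open>m\<close>-fold join. Given
  the previous cube, the next one is chosen uniformly among the reachable cubes; given the cube,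
  the cell predicted by \<open>cell_approximation\<close> has weight \<open>1/2\<close>, and the rest of the weight is spread
  uniformly. The grid is so fine that naming the cell costs at most \<open>ln 2 + 1\<close> on average. This
  is paid once every \<open>m\<close> steps.\<close>

proposition entropy_rate_le_integral_log_det:
  fixes M :: "(real^'n) measure" and D :: "real^'n \<Rightarrow> real^'n^'n"
  assumes mp: "measure_preserving_map M T" and sets: "sets M = sets (restrict_space borel X)"
    and X: "compact X" and m: "0 < m"
    and D: "unif_diff_on X (T ^^ m) D"
    and c: "\<And>x. x \<in> X \<Longrightarrow> 0 \<le> c x" "\<And>x v. x \<in> X \<Longrightarrow> norm v \<le> c x * norm (D x *v v)"
    and int: "integrable M (\<lambda>x. ln (\<bar>det (D x)\<bar> * (2 * real CARD('n) * (1 + 2 * c x)) ^ CARD('n)))"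
    and P: "finite_partition M P"
  shows "lim (\<lambda>n. partition_entropy M (iterated_join T M P n) / real n)
    \<le> ((\<integral>x. ln (\<bar>det (D x)\<bar> * (2 * real CARD('n) * (1 + 2 * c x)) ^ CARD('n)) \<partial>M) + ln 2 + 1) / real m"
proof -
  interpret T: measure_preserving_map M T by fact
  define g where "g = T ^^ m"
  have gpow: "g ^^ j = T ^^ (m * j)" for j by (simp add: g_def funpow_mult mult.commute)
  interpret G: measure_preserving_map M g unfolding g_def by (rule T.measure_preserving_pow)
  have sp: "space M = X" using sets_eq_imp_space_eq[OF sets] by (simp add: space_restrict_space)
  have gX: "g x \<in> X" if "x \<in> X" for x using T.pow_space[of x m] that by (simp add: g_def sp)
  define F where "F x = ln (\<bar>det (D x)\<bar> * (2 * real CARD('n) * (1 + 2 * c x)) ^ CARD('n))" for x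
  define J where "J = iterated_join T M P m"
  have J: "finite_partition M J" unfolding J_def by (rule T.iterated_join_partition[OF P])
  then have finJ: "finite J" and partJ: "partition_on X J" by (auto simp: finite_partition_def sp)
  obtain x0 where x0: "x0 \<in> X" using T.not_empty by (auto simp: sp)
  have cJ: "0 < card J" using cell_in(1)[OF partJ x0] finJ by (auto simp: card_gt_0_iff)
  then have lnJ: "0 \<le> ln (card J)" by simp
  define w where "w = cell J"
  have Xb: "X \<in> sets borel" using X by (simp add: compact_imp_closed borel_closed)
  obtain d1 A where d1: "0 < d1" and A: "A \<in> sets M" "T.prob (X - A) \<le> 1 / (1 + ln (card J))"
    and sep: "\<And>x y. \<lbrakk>x \<in> A; y \<in> A; dist x y < d1\<rbrakk> \<Longrightarrow> w x = w y"
  proof -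
    have "0 < 1 / (1 + ln (card J))" using lnJ by simp
    from cell_approximation[OF T.prob_space_axioms sets Xb J this] that show ?thesis
      unfolding w_def sp by metis
  qed
  have AX: "A \<subseteq> X" using sets.sets_into_space[OF A(1)] sp by simp
  obtain d2 where d2: "0 < d2"
    "\<And>x y. \<lbrakk>x \<in> X; y \<in> X; dist x y < d2\<rbrakk> \<Longrightarrow> norm (g y - g x - D x *v (y - x)) \<le> 1 * norm (y - x)"
    using unif_diff_onD[OF D, of 1] unfolding g_def by (metis zero_less_one)
  define s where "s = min d1 d2 / (2 * real CARD('n))"
  have s: "0 < s" using d1 d2 by (simp add: s_def)
  have sN: "real CARD('n) * s < d1" "real CARD('n) * s < d2" using d1 d2 by (auto simp: s_def)
  define z where "z = (grid_index s :: real^'n \<Rightarrow> _)"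
  have zd: "dist x y < d1" "dist x y < d2" if "z x = z y" for x y
    using grid_index_eq_imp_dist_le[OF s, of x y] that sN by (auto simp: z_def dist_norm)
  have finZ: "finite (z ` X)" unfolding z_def by (rule finite_grid_index_image[OF compact_imp_bounded[OF X] s])
  define R where "R k = {z (g y) | y. y \<in> X \<and> z y = k}" for k
  have RZ: "R k \<subseteq> z ` X" for k using gX by (auto simp: R_def)
  have finR: "finite (R k)" for k by (rule finite_subset[OF RZ finZ])
  have Rmem: "z (g x) \<in> R (z x)" if "x \<in> X" for x using that by (auto simp: R_def)
  have cR: "0 < card (R (z x))" if "x \<in> X" for x using Rmem[OF that] finR by (auto simp: card_gt_0_iff)
  have count: "ln (card (R (z x))) \<le> F x" if x: "x \<in> X" for x
  proof -
    have "real (card (R (z x))) \<le> \<bar>det (D x)\<bar> * (2 * real CARD('n) * (1 + 2 * c x)) ^ CARD('n)"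
      unfolding R_def z_def
    proof (rule card_grid_image_le[OF s _ c(1)[OF x] c(2)[OF x]])
      show "finite (grid_index s ` g ` X)"
        by (rule finite_subset[OF _ finZ]) (use gX in \<open>auto simp: z_def\<close>)
      show "norm (g y - g x - D x *v (y - x)) \<le> norm (y - x)"
        if "y \<in> X" "grid_index s y = grid_index s x" for y
        using d2(2)[OF x that(1)] zd(2)[of x y] that(2) by (simp add: z_def)
    qed
    then show ?thesis unfolding F_def using cR[OF x] by (intro ln_mono) auto
  qed
  have F0: "0 \<le> F x" if "x \<in> X" for x
  proof -
    have "0 \<le> ln (real (card (R (z x))))" using cR[OF that] by simp
    then show ?thesis using count[OF that] by linarith
  qed
  \<comment> \<open>The cell predicted from a cube: that of any point of the good set in it, with
    an arbitrary default.\<close>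
  define ws where "ws k = (if \<exists>y\<in>A. z y = k then w (SOME y. y \<in> A \<and> z y = k) else w x0)" for k
  have ws: "ws (z x) = w x" if "x \<in> A" for x
  proof -
    let ?y = "SOME y. y \<in> A \<and> z y = z x"
    have y: "?y \<in> A \<and> z ?y = z x" by (rule someI[of _ x]) (use that in simp)
    have "ws (z x) = w ?y" using that by (auto simp: ws_def)
    also have "\<dots> = w x" using y that zd(1)[of ?y x] by (intro sep) auto
    finally show ?thesis .
  qed
  define \<rho> where "\<rho> a k = (if a = ws k then 1 / 2 else 1 / (2 * real (card J)))" for a k
  have \<rho>pos: "0 < \<rho> a k" for a k using cJ by (simp add: \<rho>_def)
  have \<rho>sum: "(\<Sum>a\<in>J. \<rho> a k) \<le> 1" for k
  proof -
    have "(\<Sum>a\<in>J. \<rho> a k) \<le> (\<Sum>a\<in>J. (if a = ws k then 1 / 2 else 0) + 1 / (2 * real (card J)))"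
      by (intro sum_mono) (auto simp: \<rho>_def)
    also have "\<dots> \<le> 1" using finJ cJ by (simp add: sum.distrib)
    finally show ?thesis .
  qed
  \<comment> \<open>The next cube is uniform among the reachable ones, then the cell is drawn given the cube.\<close>
  define \<kappa> where "\<kappa> p q = (if snd q \<in> R (snd p) then 1 / real (card (R (snd p))) else 0) * \<rho> (fst q) (snd q)"
    for p q :: "(real^'n) set \<times> ('n \<Rightarrow> int)"
  define v where "v x = (w x, z x)" for x
  have vm: "v \<in> M \<rightarrow>\<^sub>M count_space (J \<times> z ` X)"
    unfolding v_def w_def z_def
    by (intro measurable_count_space_Pair cell_measurable[OF J] grid_index_measurable[OF sets X s] finJ
        finZ[unfolded z_def])
  have \<kappa>sum: "(\<Sum>q\<in>J \<times> z ` X. \<kappa> p q) \<le> 1" for p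
  proof -
    have "(\<Sum>q\<in>J \<times> z ` X. \<kappa> p q)
       = (\<Sum>k\<in>z ` X. (if k \<in> R (snd p) then 1 / real (card (R (snd p))) else 0) * (\<Sum>a\<in>J. \<rho> a k))"
    proof -
      have "(\<Sum>q\<in>J \<times> z ` X. \<kappa> p q) = (\<Sum>a\<in>J. \<Sum>k\<in>z ` X. \<kappa> p (a, k))"
        by (simp add: sum.cartesian_product)
      also have "\<dots> = (\<Sum>k\<in>z ` X. \<Sum>a\<in>J. \<kappa> p (a, k))" by (rule sum.swap)
      finally show ?thesis by (simp add: \<kappa>_def sum_distrib_left)
    qed
    also have "\<dots> \<le> (\<Sum>k\<in>z ` X. (if k \<in> R (snd p) then 1 / real (card (R (snd p))) else 0) * 1)"
      by (intro sum_mono mult_left_mono \<rho>sum) auto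
    also have "\<dots> = (\<Sum>k\<in>R (snd p). 1 / real (card (R (snd p))))"
      using sum.inter_restrict[OF finZ, of "\<lambda>_. 1 / real (card (R (snd p)))" "R (snd p)"] RZ[of "snd p"]
      by (simp add: Int_absorb1)
    also have "\<dots> \<le> 1" by simp
    finally show ?thesis .
  qed
  define L where "L x = F x + ln 2 + indicator (X - A) (g x) * ln (card J)" for x
  have XA: "X - A \<in> sets M" using A(1) sets.top[of M] sp by auto
  have intI: "integrable M (\<lambda>x. indicator (X - A) (g x) * ln (card J))"
    using XA G.integrable_pow[of "\<lambda>x. indicator (X - A) x * ln (card J)" 1]
    by (simp add: T.emeasure_eq_measure)
  have intL: "integrable M L"
    unfolding L_def using int intI by (intro Bochner_Integration.integrable_add) (auto simp: F_def)
  have "partition_entropy M (iterated_join T M P (Suc k * m))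
     \<le> ln (card (J \<times> z ` X)) + real k * (\<integral>x. - ln (\<kappa> (v x) (v (g x))) \<partial>M)" for k
  proof (rule G.partition_entropy_markov_bound[OF T.iterated_join_partition[OF P] vm])
    show "finite (J \<times> z ` X)" using finJ finZ by simp
    show "0 \<le> \<kappa> p q" for p q using \<rho>pos[of "fst q" "snd q"] by (simp add: \<kappa>_def)
    show "(\<Sum>q\<in>J \<times> z ` X. \<kappa> p q) \<le> 1" for p by (rule \<kappa>sum)
    show "0 < \<kappa> (v x) (v (g x))" if "x \<in> space M" for x
      using Rmem[of x] cR[of x] \<rho>pos that by (simp add: \<kappa>_def v_def sp)
    fix C x y
    assume C: "C \<in> iterated_join T M P (Suc k * m)" and x: "x \<in> C" and y: "y \<in> space M"
      and eq: "itinerary v g (Suc k) x = itinerary v g (Suc k) y"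
    obtain B where B: "C = {x \<in> space M. \<forall>i<Suc k * m. (T ^^ i) x \<in> B i}" "\<forall>i<Suc k * m. B i \<in> P"
      using C by (auto simp: iterated_join_def)
    have xs: "x \<in> space M" using x B by simp
    have "(T ^^ i) y \<in> B i" if i: "i < Suc k * m" for i
    proof -
      have j: "i div m < Suc k" using i m by (simp add: less_mult_imp_div_less)
      have "i mod m < m" using m by simp
      have split: "(T ^^ i) u = (T ^^ (i mod m)) ((g ^^ (i div m)) u)" for u
        unfolding gpow by (metis comp_apply funpow_add mod_mult_div_eq)
      have "w ((g ^^ (i div m)) x) = w ((g ^^ (i div m)) y)"
        using itinerary_eq_imp[OF eq j] by (simp add: v_def)
      then have "(T ^^ (i mod m)) ((g ^^ (i div m)) y) \<in> B i"
        using T.same_join_cell[OF P G.pow_space[OF xs] G.pow_space[OF y], of m "i div m" "i div m" "i mod m" "B i"]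
          x B i \<open>i mod m < m\<close> split[of x] by (auto simp: w_def J_def)
      then show ?thesis by (simp add: split)
    qed
    then show "y \<in> C" using B y by simp
  qed
  moreover have "(\<integral>x. - ln (\<kappa> (v x) (v (g x))) \<partial>M) \<le> (\<integral>x. L x \<partial>M)"
  proof (rule integral_mono'[OF intL])
    fix x assume "x \<in> space M"
    then have x: "x \<in> X" by (simp add: sp)
    show "0 \<le> L x" using F0[OF x] lnJ by (simp add: L_def)
    have "\<kappa> (v x) (v (g x)) = 1 / real (card (R (z x))) * \<rho> (w (g x)) (z (g x))"
      using Rmem[OF x] by (simp add: \<kappa>_def v_def)
    then have "- ln (\<kappa> (v x) (v (g x))) = ln (card (R (z x))) - ln (\<rho> (w (g x)) (z (g x)))"
      using cR[OF x] \<rho>pos[of "w (g x)" "z (g x)"] by (simp add: ln_mult_pos ln_divide_pos)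
    also have "- ln (\<rho> (w (g x)) (z (g x))) \<le> ln 2 + indicator (X - A) (g x) * ln (card J)"
    proof (cases "g x \<in> A")
      case True
      then have "\<rho> (w (g x)) (z (g x)) = 1 / 2" by (simp add: \<rho>_def ws)
      then have "- ln (\<rho> (w (g x)) (z (g x))) = ln 2" by (simp only:) (simp add: ln_div)
      then show ?thesis using lnJ by (simp add: indicator_def)
    next
      case False
      then have ind: "indicator (X - A) (g x) = (1::real)" using gX[OF x] by simp
      have "1 / (2 * real (card J)) \<le> \<rho> (w (g x)) (z (g x))"
        using cJ by (auto simp: \<rho>_def field_simps)
      then have "ln (1 / (2 * real (card J))) \<le> ln (\<rho> (w (g x)) (z (g x)))"
        using cJ by (intro ln_mono) auto
      then show ?thesis using cJ by (simp add: ind ln_divide_pos ln_mult_pos)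
    qed
    then have "ln (card (R (z x))) - ln (\<rho> (w (g x)) (z (g x))) \<le> L x"
      using count[OF x] by (simp add: L_def)
    finally show "- ln (\<kappa> (v x) (v (g x))) \<le> L x" .
  qed
  moreover have "(\<integral>x. L x \<partial>M) \<le> (\<integral>x. F x \<partial>M) + ln 2 + 1"
  proof -
    have "(\<integral>x. indicator (X - A) (g x) * ln (card J) \<partial>M) = T.prob (X - A) * ln (card J)"
      using G.integral_pow[of "\<lambda>x. indicator (X - A) x * ln (card J)" 1] XA by simp
    also have "\<dots> \<le> 1 / (1 + ln (card J)) * ln (card J)" by (rule mult_right_mono[OF A(2) lnJ])
    also have "\<dots> \<le> 1" using lnJ by (simp add: field_simps)
    finally have "(\<integral>x. indicator (X - A) (g x) * ln (card J) \<partial>M) \<le> 1" .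
    moreover have "(\<integral>x. L x \<partial>M) = (\<integral>x. F x \<partial>M) + ln 2 + (\<integral>x. indicator (X - A) (g x) * ln (card J) \<partial>M)"
      unfolding L_def using int intI by (simp add: F_def[symmetric] T.prob_space)
    ultimately show ?thesis by linarith
  qed
  ultimately have "partition_entropy M (iterated_join T M P (Suc k * m))
     \<le> ln (card (J \<times> z ` X)) + real k * ((\<integral>x. F x \<partial>M) + ln 2 + 1)" for k
    by (meson add_left_mono mult_left_mono of_nat_0_le_iff order_trans)
  then show ?thesis unfolding F_def by (rule T.entropy_rate_le[OF P m])
qed

lemma continuous_on_matrix_vector_mult:
  fixes A :: "'a::topological_space \<Rightarrow> real^'n^'m"
  assumes "continuous_on S A"
  shows "continuous_on S (\<lambda>x. A x *v v)"
  unfolding matrix_vector_mult_def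
  by (intro continuous_on_vec_lambda continuous_on_sum continuous_on_mult continuous_on_const
      continuous_on_component assms)

lemma continuous_on_det:
  fixes A :: "'a::topological_space \<Rightarrow> real^'n^'n"
  assumes "continuous_on S A"
  shows "continuous_on S (\<lambda>x. det (A x))"
  unfolding det_def
  by (intro continuous_on_sum continuous_on_mult continuous_on_const continuous_on_prod
      continuous_on_component assms)

lemma integrable_continuous_on_compact:
  fixes \<phi> :: "real^'n \<Rightarrow> real"
  assumes "prob_space M" and sets: "sets M = sets (restrict_space borel X)" and X: "compact X"
    and \<phi>: "continuous_on X \<phi>"
  shows "integrable M \<phi>"
proof -
  interpret prob_space M by fact
  have sp: "space M = X" using sets_eq_imp_space_eq[OF sets] by (simp add: space_restrict_space)
  have "\<phi> \<in> borel_measurable M"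
    using borel_measurable_continuous_on_restrict[OF \<phi>] measurable_cong_sets[OF sets refl] by blast
  moreover obtain B where "\<And>x. x \<in> X \<Longrightarrow> norm (\<phi> x) \<le> B"
    using compact_imp_bounded[OF compact_continuous_image[OF \<phi> X]] by (auto simp: bounded_iff)
  ultimately show ?thesis by (intro integrable_const_bound[of _ B] AE_I2) (auto simp: sp)
qed

lemma det_deriv_cocycle:
  "det (deriv_cocycle f x t) = (\<Prod>k\<le>t. det (jacobian f (at ((f ^^ k) x))))"
  by (induction t) (simp_all add: det_mul mult.commute)

lemma norm_le_deriv_cocycle:
  assumes f: "f \<in> X \<rightarrow> X" and c: "0 \<le> c"
    and exp: "\<And>x v. x \<in> X \<Longrightarrow> norm v \<le> c * norm (jacobian f (at x) *v v)"
  shows "x \<in> X \<Longrightarrow> norm v \<le> c ^ Suc t * norm (deriv_cocycle f x t *v v)"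
proof (induction t)
  case (Suc t)
  have "norm v \<le> c ^ Suc t * norm (deriv_cocycle f x t *v v)" by (rule Suc.IH[OF Suc.prems])
  also have "\<dots> \<le> c ^ Suc t * (c * norm (jacobian f (at ((f ^^ Suc t) x)) *v (deriv_cocycle f x t *v v)))"
    by (intro mult_left_mono exp funpow_in[OF f Suc.prems] zero_le_power c)
  finally show ?case by (simp add: matrix_vector_mul_assoc ac_simps)
qed (use exp in simp)

text \<open>The previous estimate is applied to \<open>f\<^sup>t\<^sup>+\<^sup>1\<close> for each \<open>t\<close>. On the set \<open>E\<close> where this iterate
  does not contract, the reachable cubes number at most a constant times the determinant. Off \<open>E\<close>
  the extra cost is at most linear in \<open>t\<close>, and the measure of the complement tends to zero. After
  division by \<open>t + 1\<close> only the integral remains.\<close>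

proposition entropy_rate_le_integral_log_jacobian:
  fixes M :: "(real^'n) measure" and f :: "real^'n \<Rightarrow> real^'n"
  assumes mp: "measure_preserving_map M f" and sets: "sets M = sets (restrict_space borel X)"
    and X: "compact X" and fX: "f \<in> X \<rightarrow> X" and smooth: "C_on r X f" "1 \<le> r"
    and exp: "\<And>x v. x \<in> X \<Longrightarrow> norm v \<le> c * norm (jacobian f (at x) *v v)" and c: "1 \<le> c"
    and ev: "AE x in M. \<forall>\<^sub>F t in sequentially. \<forall>v. norm v \<le> norm (deriv_cocycle f x t *v v)"
    and P: "finite_partition M P"
  shows "lim (\<lambda>n. partition_entropy M (iterated_join f M P n) / real n)
    \<le> (\<integral>x. ln \<bar>det (jacobian f (at x))\<bar> \<partial>M)"
proof -
  interpret measure_preserving_map M f by fact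
  have sp: "space M = X" using sets_eq_imp_space_eq[OF sets] by (simp add: space_restrict_space)
  obtain U where U: "X \<subseteq> U" "continuous_on U (\<lambda>x. jacobian f (at x))" "continuous_on U f"
    using C_on_jacobian[OF smooth] by metis
  have cf: "continuous_on X f" and cJ: "continuous_on X (\<lambda>x. jacobian f (at x))"
    using U continuous_on_subset by blast+
  have cD: "continuous_on X (\<lambda>x. deriv_cocycle f x t)" for t
    by (rule deriv_cocycle_continuous_on[OF cf fX cJ])
  define \<phi> where "\<phi> x = ln \<bar>det (jacobian f (at x))\<bar>" for x
  have dnz: "det (jacobian f (at x)) \<noteq> 0" if "x \<in> X" for x
    by (rule expansion_imp_det_nonzero[OF exp[OF that]])
  have int\<phi>: "integrable M \<phi>"
    unfolding \<phi>_def
    by (rule integrable_continuous_on_compact[OF prob_space_axioms sets X])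
      (intro continuous_on_ln continuous_on_rabs continuous_on_det cJ, use dnz in auto)
  define N where "N = real CARD('n)"
  have N: "1 \<le> N" by (simp add: N_def Suc_leI)
  define E where "E t = {x \<in> X. \<forall>v. norm v \<le> norm (deriv_cocycle f x t *v v)}" for t
  have Em: "E t \<in> events" for t
  proof -
    have Eeq: "E t = (\<Inter>v. X \<inter> (\<lambda>x. norm (deriv_cocycle f x t *v v)) -` {norm v..})"
      by (auto simp: E_def)
    have "closed (X \<inter> (\<lambda>x. norm (deriv_cocycle f x t *v v)) -` {norm v..})" for v
      by (intro continuous_closed_preimage continuous_on_norm continuous_on_matrix_vector_mult cD
          compact_imp_closed[OF X] closed_atLeast)
    then have "closed (E t)" unfolding Eeq by (intro closed_INT ballI)
    moreover have "E t \<subseteq> X" by (auto simp: E_def)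
    ultimately show ?thesis
      unfolding sets using X by (simp add: sets_restrict_space_iff compact_imp_closed borel_closed)
  qed
  have XEm: "X - E t \<in> events" for t using Em[of t] sets.top[of M] sp by auto
  let ?H = "\<lambda>n. partition_entropy M (iterated_join f M P n) / real n"
  define C where "C = N * ln (2 * N) + 2 * (N * ln 3) + ln 2 + 1"
  have bound: "lim ?H \<le> (\<integral>x. \<phi> x \<partial>M) + C * (1 / real (Suc t)) + N * ln c * prob (X - E t)" for t
  proof -
    let ?D = "\<lambda>x. deriv_cocycle f x t"
    \<comment> \<open>A bound for the inverse of the derivative: the trivial one off \<open>E t\<close>.\<close>
    define k where "k x = (if x \<in> E t then 1 else c ^ Suc t)" for x
    have k0: "0 \<le> k x" and kD: "norm v \<le> k x * norm (?D x *v v)" if "x \<in> X" for x v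
      using that norm_le_deriv_cocycle[OF fX _ exp that, of v t] c
      by (auto simp: k_def E_def simp del: power_Suc)
    define u where "u = ln (1 + 2 * c ^ Suc t)"
    define F where "F x = ln (\<bar>det (?D x)\<bar> * (2 * real CARD('n) * (1 + 2 * k x)) ^ CARD('n))" for x
    let ?R = "\<lambda>x. (\<Sum>j\<le>t. \<phi> ((f ^^ j) x)) + N * ln (2 * N)
        + N * (indicator (E t) x * ln 3 + indicator (X - E t) x * u)"
    have Feq: "F x = ?R x" if x: "x \<in> X" for x
    proof -
      have d: "det (jacobian f (at ((f ^^ j) x))) \<noteq> 0" for j by (rule dnz[OF funpow_in[OF fX x]])
      have kp: "0 < 1 + 2 * k x" using k0[OF x] by linarith
      have "ln \<bar>det (?D x)\<bar> = (\<Sum>j\<le>t. \<phi> ((f ^^ j) x))"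
        unfolding det_deriv_cocycle abs_prod \<phi>_def by (rule ln_prod) (use d in auto)
      moreover have "ln ((2 * real CARD('n) * (1 + 2 * k x)) ^ CARD('n)) = N * (ln (2 * N) + ln (1 + 2 * k x))"
        using kp N by (simp add: ln_realpow ln_mult_pos N_def)
      moreover have "F x = ln \<bar>det (?D x)\<bar> + ln ((2 * real CARD('n) * (1 + 2 * k x)) ^ CARD('n))"
        unfolding F_def by (rule ln_mult_pos) (use d kp in \<open>auto simp: det_deriv_cocycle\<close>)
      moreover have "ln (1 + 2 * k x) = indicator (E t) x * ln 3 + indicator (X - E t) x * u"
        using x by (simp add: k_def u_def)
      ultimately show ?thesis by (simp add: algebra_simps)
    qed
    have i\<phi>: "integrable M (\<lambda>x. \<Sum>j\<le>t. \<phi> ((f ^^ j) x))"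
      by (rule Bochner_Integration.integrable_sum) (rule integrable_pow[OF int\<phi>])
    have iE: "integrable M (indicator (E t) :: _ \<Rightarrow> real)" "integrable M (indicator (X - E t) :: _ \<Rightarrow> real)"
      using Em XEm by (auto intro!: integrable_real_indicator simp: emeasure_eq_measure)
    have iu: "integrable M (\<lambda>x. indicator (E t) x * ln 3 + indicator (X - E t) x * u)"
      by (intro Bochner_Integration.integrable_add integrable_mult_left iE)
    have intR: "integrable M ?R"
      by (intro Bochner_Integration.integrable_add i\<phi> integrable_const integrable_mult_right iu)
    have "integrable M F \<longleftrightarrow> integrable M ?R"
      by (rule Bochner_Integration.integrable_cong[OF refl]) (rule Feq, simp add: sp)
    then have intF: "integrable M F" using intR by (rule iffD2)
    have "(\<integral>x. F x \<partial>M) = (\<integral>x. ?R x \<partial>M)"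
      by (rule Bochner_Integration.integral_cong[OF refl]) (rule Feq, simp add: sp)
    also have "\<dots> = (\<integral>x. (\<Sum>j\<le>t. \<phi> ((f ^^ j) x)) \<partial>M) + N * ln (2 * N)
        + N * (\<integral>x. indicator (E t) x * ln 3 + indicator (X - E t) x * u \<partial>M)"
      using i\<phi> iu by (simp add: prob_space)
    also have "(\<integral>x. indicator (E t) x * ln 3 + indicator (X - E t) x * u \<partial>M)
        = prob (E t) * ln 3 + prob (X - E t) * u"
      using iE Em XEm by simp
    also have "(\<integral>x. (\<Sum>j\<le>t. \<phi> ((f ^^ j) x)) \<partial>M) = (\<Sum>j\<le>t. (\<integral>x. \<phi> ((f ^^ j) x) \<partial>M))"
      by (rule Bochner_Integration.integral_sum) (rule integrable_pow[OF int\<phi>])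
    also have "\<dots> = real (Suc t) * (\<integral>x. \<phi> x \<partial>M)"
      using integral_pow[OF borel_measurable_integrable[OF int\<phi>]] by simp
    finally have IF: "(\<integral>x. F x \<partial>M) = real (Suc t) * (\<integral>x. \<phi> x \<partial>M) + N * ln (2 * N)
        + N * (prob (E t) * ln 3 + prob (X - E t) * u)" .
    have "u \<le> ln (3 * c ^ Suc t)"
      unfolding u_def using one_le_power[OF c, of "Suc t"] by (intro ln_mono) (auto simp del: power_Suc)
    also have "\<dots> = ln 3 + real (Suc t) * ln c"
      using c by (subst ln_mult_pos) (auto simp: ln_realpow simp del: power_Suc)
    finally have ub: "u \<le> ln 3 + real (Suc t) * ln c" .
    have ln3: "0 \<le> ln (3::real)" by simp
    have "prob (X - E t) * u \<le> prob (X - E t) * (ln 3 + real (Suc t) * ln c)"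
      by (rule mult_left_mono[OF ub]) simp
    also have "\<dots> \<le> ln 3 + real (Suc t) * ln c * prob (X - E t)"
      using mult_right_mono[OF prob_le_1[of "X - E t"] ln3] by (simp add: algebra_simps)
    finally have "prob (E t) * ln 3 + prob (X - E t) * u \<le> 2 * ln 3 + real (Suc t) * ln c * prob (X - E t)"
      using mult_right_mono[OF prob_le_1[of "E t"] ln3] by linarith
    then have "N * (prob (E t) * ln 3 + prob (X - E t) * u) \<le> N * (2 * ln 3 + real (Suc t) * ln c * prob (X - E t))"
      using N by (intro mult_left_mono) auto
    then have "(\<integral>x. F x \<partial>M) + ln 2 + 1 \<le> real (Suc t) * (\<integral>x. \<phi> x \<partial>M) + C + real (Suc t) * (N * ln c * prob (X - E t))"
      unfolding IF C_def by (simp add: algebra_simps)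
    then have le: "((\<integral>x. F x \<partial>M) + ln 2 + 1) / real (Suc t)
       \<le> (real (Suc t) * (\<integral>x. \<phi> x \<partial>M) + C + real (Suc t) * (N * ln c * prob (X - E t))) / real (Suc t)"
      by (rule divide_right_mono) simp
    have "lim ?H \<le> ((\<integral>x. F x \<partial>M) + ln 2 + 1) / real (Suc t)"
      unfolding F_def
      by (rule entropy_rate_le_integral_log_det[OF mp sets X _ deriv_cocycle_unif_diff_on[OF X fX smooth] k0 kD _ P])
        (use intF in \<open>simp_all add: F_def[abs_def]\<close>)
    also note le
    also have "(real (Suc t) * (\<integral>x. \<phi> x \<partial>M) + C + real (Suc t) * (N * ln c * prob (X - E t))) / real (Suc t)
      = (\<integral>x. \<phi> x \<partial>M) + C * (1 / real (Suc t)) + N * ln c * prob (X - E t)"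
      by (simp add: add_divide_distrib del: of_nat_Suc)
    finally show ?thesis .
  qed
  have "(\<lambda>t. prob (X - E t)) \<longlonglongrightarrow> 0"
  proof -
    have "(\<lambda>t. \<integral>x. indicator (X - E t) x \<partial>M) \<longlonglongrightarrow> (\<integral>x. (0::real) \<partial>M)"
    proof (rule integral_dominated_convergence[where w = "\<lambda>_. 1"])
      show "AE x in M. (\<lambda>t. indicator (X - E t) x :: real) \<longlonglongrightarrow> 0"
        using ev
      proof (rule AE_mp, intro AE_I2 impI)
        fix x assume x: "x \<in> space M"
          and evx: "\<forall>\<^sub>F t in sequentially. \<forall>v. norm v \<le> norm (deriv_cocycle f x t *v v)"
        have "\<forall>\<^sub>F t in sequentially. indicator (X - E t) x = (0::real)"
          by (rule eventually_mono[OF evx]) (use x sp in \<open>simp add: E_def\<close>)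
        then show "(\<lambda>t. indicator (X - E t) x :: real) \<longlonglongrightarrow> 0" by (rule tendsto_eventually)
      qed
      show "AE x in M. norm (indicator (X - E t) x :: real) \<le> 1" for t
        by (simp add: indicator_def)
    qed (use XEm in \<open>auto simp: emeasure_eq_measure\<close>)
    then show ?thesis using XEm by simp
  qed
  moreover have "(\<lambda>t. 1 / real (Suc t)) \<longlonglongrightarrow> 0"
    using LIMSEQ_inverse_real_of_nat by (simp add: inverse_eq_divide)
  ultimately have "(\<lambda>t. (\<integral>x. \<phi> x \<partial>M) + C * (1 / real (Suc t)) + N * ln c * prob (X - E t))
      \<longlonglongrightarrow> (\<integral>x. \<phi> x \<partial>M) + C * 0 + N * ln c * 0"
    by (intro tendsto_intros)
  then have "lim ?H \<le> (\<integral>x. \<phi> x \<partial>M) + C * 0 + N * ln c * 0"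
    by (rule LIMSEQ_le_const) (use bound in blast)
  then show ?thesis by (simp add: \<phi>_def)
qed

section \<open>Positive Lyapunov exponents\<close>

text \<open>A minimizer of the quadratic form on the unit sphere is an eigenvector, by the first-order
  condition.\<close>

lemma min_quadratic_form_eigenvalue:
  fixes \<Lambda> :: "real^'n^'n"
  assumes sym: "transpose \<Lambda> = \<Lambda>"
  obtains l where "det (mat l - \<Lambda>) = 0" "\<And>v. l * (norm v)\<^sup>2 \<le> v \<bullet> (\<Lambda> *v v)"
proof -
  have ne: "sphere (0 :: real^'n) 1 \<noteq> {}" by simp
  have "continuous_on (sphere 0 1) (\<lambda>v :: real^'n. v \<bullet> (\<Lambda> *v v))"
    by (intro continuous_on_inner continuous_on_id linear_continuous_on) simp
  from continuous_attains_inf[OF compact_sphere ne this]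
  obtain u where u: "norm u = 1" "\<And>v. norm v = 1 \<Longrightarrow> u \<bullet> (\<Lambda> *v u) \<le> v \<bullet> (\<Lambda> *v v)"
    by auto
  define l where "l = u \<bullet> (\<Lambda> *v u)"
  have low: "l * (norm v)\<^sup>2 \<le> v \<bullet> (\<Lambda> *v v)" for v
  proof (cases "v = 0")
    case False
    let ?w = "(1 / norm v) *\<^sub>R v"
    have "l \<le> ?w \<bullet> (\<Lambda> *v ?w)" unfolding l_def using False by (intro u(2)) simp
    also have "\<dots> = (v \<bullet> (\<Lambda> *v v)) / (norm v)\<^sup>2"
      by (simp add: matrix_vector_mult_scaleR power2_eq_square)
    finally show ?thesis using False by (simp add: field_simps)
  qed simp
  define r where "r = \<Lambda> *v u - l *\<^sub>R u"
  have symm: "x \<bullet> (\<Lambda> *v y) = (\<Lambda> *v x) \<bullet> y" for x y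
    using dot_lmul_matrix[of x \<Lambda> y] sym by (metis transpose_matrix_vector)
  have uu: "u \<bullet> u = 1" using u(1) by (simp add: dot_square_norm)
  have ur: "u \<bullet> r = 0" by (simp add: r_def inner_diff_right l_def[symmetric] uu)
  have "r \<bullet> r = 0"
  proof (rule ccontr)
    assume "r \<bullet> r \<noteq> 0"
    then have rr: "0 < r \<bullet> r" by simp
    define c where "c = r \<bullet> (\<Lambda> *v r) - l * (r \<bullet> r)"
    have quad: "2 * (r \<bullet> r) \<le> e * c" if e: "0 < e" for e
    proof -
      \<comment> \<open>Moving from the minimizer against the residual \<open>r\<close> would decrease the form to first order.\<close>
      let ?x = "u - e *\<^sub>R r"
      have "l * (?x \<bullet> ?x) \<le> ?x \<bullet> (\<Lambda> *v ?x)" using low[of ?x] by (simp add: dot_square_norm)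
      moreover have "?x \<bullet> ?x = 1 + e\<^sup>2 * (r \<bullet> r)"
        using ur uu by (simp add: inner_diff_left inner_diff_right inner_commute[of r u] power2_eq_square)
      moreover have "r \<bullet> (\<Lambda> *v u) = r \<bullet> r"
        using ur by (simp add: r_def inner_diff_right inner_diff_left inner_commute)
      then have "?x \<bullet> (\<Lambda> *v ?x) = l - 2 * e * (r \<bullet> r) + e\<^sup>2 * (r \<bullet> (\<Lambda> *v r))"
        using symm[of u r] l_def
        by (simp add: matrix_vector_mult_diff_distrib matrix_vector_mult_scaleR inner_diff_left inner_diff_right
            inner_commute power2_eq_square algebra_simps)
      ultimately have "e * (2 * (r \<bullet> r)) \<le> e * (e * c)"
        by (simp add: c_def power2_eq_square algebra_simps)
      then show ?thesis using e by simp
    qed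
    have "0 < c" using quad[of 1] rr by linarith
    then show False using quad[of "(r \<bullet> r) / c"] rr by simp
  qed
  then have "\<Lambda> *v u = l *\<^sub>R u" by (simp add: r_def)
  moreover have "mat l *v u = l *\<^sub>R u"
    by (simp add: matrix_vector_mult_def mat_def vec_eq_iff if_distrib[of "\<lambda>a. a * _"] cong: if_cong)
  ultimately have "(mat l - \<Lambda>) *v u = 0"
    by (simp add: matrix_vector_mult_diff_rdistrib)
  then have "det (mat l - \<Lambda>) = 0"
    using u(1) by (metis invertible_det_nz matrix_left_invertible_ker invertible_left_inverse norm_zero zero_neq_one)
  then show ?thesis using that low by blast
qed

lemma mat_pow_commute: "Q ** mat_pow Q k = mat_pow Q k ** Q"
proof (induction k)
  case (Suc k)
  have "Q ** mat_pow Q (Suc k) = Q ** (mat_pow Q k ** Q)" by (simp add: Suc)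
  also have "\<dots> = mat_pow Q (Suc k) ** Q" by (simp add: matrix_mul_assoc)
  finally show ?case .
qed simp

text \<open>Since \<open>Q\<close> is symmetric, \<open>v \<bullet> Q\<^sup>2\<^sup>k\<^sup>+\<^sup>2 v = Q v \<bullet> Q\<^sup>2\<^sup>k (Q v)\<close>.\<close>

lemma expanding_power:
  assumes sym: "transpose Q = Q" and exp: "\<And>v. norm v \<le> norm (Q *v v)"
  shows "(norm v)\<^sup>2 \<le> v \<bullet> (mat_pow Q (2 * k) *v v)"
proof (induction k arbitrary: v)
  case (Suc k)
  have symm: "x \<bullet> (Q *v y) = (Q *v x) \<bullet> y" for x y
    using dot_lmul_matrix[of x Q y] sym by (metis transpose_matrix_vector)
  have "(norm v)\<^sup>2 \<le> (norm (Q *v v))\<^sup>2" using exp by (intro power_mono) auto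
  also have "\<dots> \<le> (Q *v v) \<bullet> (mat_pow Q (2 * k) *v (Q *v v))" by (rule Suc.IH)
  also have "\<dots> = v \<bullet> ((Q ** (mat_pow Q (2 * k) ** Q)) *v v)"
    by (simp add: symm[symmetric] matrix_vector_mul_assoc[symmetric])
  also have "Q ** (mat_pow Q (2 * k) ** Q) = mat_pow Q (2 * Suc k)"
    by (simp add: mat_pow_commute[symmetric])
  finally show ?case .
qed (simp add: dot_square_norm)

text \<open>The least eigenvalue of \<open>\<Lambda>\<close> exceeds \<open>1\<close>, so for large \<open>t\<close> the quadratic form of \<open>Q t\<close> dominates
  that of the identity, and so does that of \<open>(Q t)\<^sup>2\<^sup>t\<close>, which is \<open>\<bar>D\<^sup>tf(x) v\<bar>\<^sup>2\<close>.\<close>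

lemma positive_exponents_imp_eventually_expanding:
  fixes f :: "real^'n \<Rightarrow> real^'n"
  assumes \<Lambda>: "lyapunov_matrix f x \<Lambda>"
    and char: "\<And>z. det (mat z - \<Lambda>) = (\<Prod>i=1..CARD('n). z - exp (lexp i))"
    and pos: "\<And>i. i \<in> {1..CARD('n)} \<Longrightarrow> 0 < lexp i"
  shows "\<forall>\<^sub>F t in sequentially. \<forall>v. norm v \<le> norm (deriv_cocycle f x t *v v)"
proof -
  obtain Q where Q: "\<And>t. 1 \<le> t \<Longrightarrow> pos_semidef (Q t)"
    "\<And>t. 1 \<le> t \<Longrightarrow> mat_pow (Q t) (2 * t) = transpose (deriv_cocycle f x t) ** deriv_cocycle f x t"
    "Q \<longlonglongrightarrow> \<Lambda>"
    using \<Lambda> unfolding lyapunov_matrix_def by blast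
  have symQ: "transpose (Q t) = Q t" if "1 \<le> t" for t using Q(1)[OF that] by (simp add: pos_semidef_def)
  have "transpose \<Lambda> = \<Lambda>"
  proof -
    have lim: "(\<lambda>t. Q t $ i $ j) \<longlonglongrightarrow> \<Lambda> $ i $ j" for i j by (intro tendsto_vec_nth Q(3))
    have "\<Lambda> $ j $ i = \<Lambda> $ i $ j" for i j
    proof (rule LIMSEQ_unique[OF lim])
      show "(\<lambda>t. Q t $ j $ i) \<longlonglongrightarrow> \<Lambda> $ i $ j"
      proof (rule Lim_transform_eventually[OF lim])
        show "\<forall>\<^sub>F t in sequentially. Q t $ i $ j = Q t $ j $ i"
          using eventually_ge_at_top[of 1]
        proof (rule eventually_mono)
          fix t :: nat assume "1 \<le> t"
          then have "transpose (Q t) $ j $ i = Q t $ j $ i" by (simp only: symQ)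
          then show "Q t $ i $ j = Q t $ j $ i" by (simp add: transpose_def)
        qed
      qed
    qed
    then show ?thesis by (simp add: transpose_def vec_eq_iff)
  qed
  then obtain l where l: "det (mat l - \<Lambda>) = 0" "\<And>v. l * (norm v)\<^sup>2 \<le> v \<bullet> (\<Lambda> *v v)"
    using min_quadratic_form_eigenvalue by blast
  then have "(\<Prod>i=1..CARD('n). l - exp (lexp i)) = 0" using char[of l] by simp
  then obtain i where i: "i \<in> {1..CARD('n)}" "l = exp (lexp i)" by auto
  then have l1: "1 < l" using pos[OF i(1)] by simp
  have "\<forall>\<^sub>F t in sequentially. dist (Q t) \<Lambda> < l - 1"
    using Q(3) l1 by (intro tendstoD) auto
  then show ?thesis
    using eventually_ge_at_top[of 1]
  proof eventually_elim
    case (elim t)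
    have Qexp: "norm v \<le> norm (Q t *v v)" for v
    proof (cases "v = 0")
      case False
      have "\<bar>v \<bullet> ((Q t - \<Lambda>) *v v)\<bar> \<le> norm v * (norm (Q t - \<Lambda>) * norm v)"
        by (rule order_trans[OF Cauchy_Schwarz_ineq2]) (intro mult_left_mono norm_matrix_vector_mult_le norm_ge_zero)
      also have "\<dots> \<le> norm v * ((l - 1) * norm v)"
        using elim(1) by (intro mult_left_mono mult_right_mono) (auto simp: dist_norm)
      finally have "\<bar>v \<bullet> ((Q t - \<Lambda>) *v v)\<bar> \<le> (l - 1) * (norm v)\<^sup>2" by (simp add: power2_eq_square ac_simps)
      then have "(norm v)\<^sup>2 \<le> v \<bullet> (Q t *v v)"
        using l(2)[of v] by (simp add: matrix_vector_mult_diff_rdistrib inner_diff_right algebra_simps)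
      also have "\<dots> \<le> norm v * norm (Q t *v v)" by (rule norm_cauchy_schwarz)
      finally show ?thesis using False by (simp add: power2_eq_square)
    qed simp
    show ?case
    proof
      fix v :: "real^'n"
      let ?D = "deriv_cocycle f x t"
      have "(norm v)\<^sup>2 \<le> v \<bullet> (mat_pow (Q t) (2 * t) *v v)"
        by (rule expanding_power[OF symQ[OF elim(2)] Qexp])
      also have "\<dots> = v \<bullet> (transpose ?D *v (?D *v v))"
        by (simp add: Q(2)[OF elim(2)] matrix_vector_mul_assoc)
      also have "\<dots> = (norm (?D *v v))\<^sup>2"
        using dot_lmul_matrix[of v "transpose ?D" "?D *v v"] by (simp add: dot_square_norm)
      finally show "norm v \<le> norm (?D *v v)" by (rule power2_le_imp_le) simp
    qed
  qed
qed

section \<open>Entropy limitation for observation over an erasure channel\<close>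

lemma invariant_prob_imp_measure_preserving:
  assumes inv: "invariant_prob X f \<mu>" and f: "continuous_on X f" "f \<in> X \<rightarrow> X"
  shows "measure_preserving_map \<mu> f"
proof -
  interpret prob_space \<mu> using inv by (simp add: invariant_prob_def)
  have sets: "sets \<mu> = sets (restrict_space borel X)" using inv by (simp add: invariant_prob_def)
  have sp: "space \<mu> = X" using sets_eq_imp_space_eq[OF sets] by (simp add: space_restrict_space)
  have "f \<in> restrict_space borel X \<rightarrow>\<^sub>M restrict_space borel X"
    using borel_measurable_continuous_on_restrict[OF f(1)] f(2)
    by (intro measurable_restrict_space2) (auto simp: space_restrict_space)
  then have meas: "f \<in> \<mu> \<rightarrow>\<^sub>M \<mu>" using measurable_cong_sets[OF sets sets] by blast
  have "distr \<mu> \<mu> f = \<mu>"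
  proof (rule measure_eqI)
    fix B assume "B \<in> sets (distr \<mu> \<mu> f)"
    then have B: "B \<in> sets \<mu>" by simp
    then have "measure \<mu> (f -` B \<inter> X) = measure \<mu> B" using inv by (simp add: invariant_prob_def)
    then show "emeasure (distr \<mu> \<mu> f) B = emeasure \<mu> B"
      using meas B by (simp add: emeasure_distr emeasure_eq_measure sp)
  qed simp
  then show ?thesis by unfold_locales (rule meas)
qed

lemma mat_le_imp_norm_le:
  fixes A :: "real^'n^'n"
  assumes a: "0 < a" and le: "mat a \<preceq> transpose A ** A"
  shows "norm v \<le> max 1 (1 / sqrt a) * norm (A *v v)"
proof -
  have "mat a *v v = a *\<^sub>R v"
    by (simp add: matrix_vector_mult_def mat_def vec_eq_iff if_distrib[of "\<lambda>a. a * _"] cong: if_cong)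
  moreover have "v \<bullet> ((transpose A ** A) *v v) = (norm (A *v v))\<^sup>2"
    using dot_lmul_matrix[of v "transpose A" "A *v v"]
    by (simp add: matrix_vector_mul_assoc[symmetric] dot_square_norm)
  moreover have "0 \<le> v \<bullet> ((transpose A ** A - mat a) *v v)"
    using le by (simp add: mat_le_def pos_semidef_def)
  ultimately have "a * (norm v)\<^sup>2 \<le> (norm (A *v v))\<^sup>2"
    by (simp add: matrix_vector_mult_diff_rdistrib inner_diff_right dot_square_norm)
  then have "sqrt (a * (norm v)\<^sup>2) \<le> sqrt ((norm (A *v v))\<^sup>2)" by (rule real_sqrt_le_mono)
  then have "sqrt a * norm v \<le> norm (A *v v)" by (simp add: real_sqrt_mult)
  then have "norm v \<le> 1 / sqrt a * norm (A *v v)" using a by (simp add: field_simps)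
  also have "\<dots> \<le> max 1 (1 / sqrt a) * norm (A *v v)" by (intro mult_right_mono) auto
  finally show ?thesis .
qed

theorem theorem23:
  fixes X :: "(real^'n) set" and Y :: "(real^'m) set"
    and f :: "real^'n \<Rightarrow> real^'n" and h :: "real^'n \<Rightarrow> real^'m" and K :: "real^'m \<Rightarrow> real^'n"
    and P :: "'w measure" and \<xi> :: "nat \<Rightarrow> 'w \<Rightarrow> real" and p :: real
    and r s :: nat and a b \<alpha> \<beta> :: real
    and \<mu> :: "(real^'n) measure" and lexp :: "nat \<Rightarrow> real"
  assumes dims: "CARD('m) < CARD('n)"
    and state_space: "compact X" "0 \<in> X"
    and channel: "0 < p" "p < 1" "iid_bernoulli P \<xi> p"
    and maps: "f \<in> X \<rightarrow> X" "h \<in> X \<rightarrow> Y" "f 0 = 0" "h 0 = 0"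
    and smooth: "1 \<le> r" "C_on r X f" "C_on r X h"
    and jacobian_bounds: "0 < a" "0 < b"
      "\<forall>x\<in>X. mat a \<preceq> transpose (jacobian f (at x)) ** jacobian f (at x)
            \<and> transpose (jacobian f (at x)) ** jacobian f (at x) \<preceq> mat b"
    and observability_rank: "\<forall>x\<in>X. rank (jacobian (obs_map f h) (at x)) = CARD('n)"
    and observability_bounds: "0 < \<alpha>" "0 < \<beta>"
      "\<forall>x\<in>X. mat \<alpha> \<prec> transpose (jacobian (obs_map f h) (at x)) ** jacobian (obs_map f h) (at x)
            \<and> transpose (jacobian (obs_map f h) (at x)) ** jacobian (obs_map f h) (at x) \<prec> mat \<beta>"
    and gain: "K \<in> Y \<rightarrow> X" "1 \<le> s" "C_on s Y K" "K 0 = 0"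
    and observer_in_X: "\<forall>x0\<in>X. \<forall>xh0\<in>X. \<forall>\<zeta>. (\<forall>t. \<zeta> t \<in> {0, 1}) \<longrightarrow>
      (\<forall>t. observer f h K \<zeta> x0 xh0 t \<in> X)"
    and physical: "physical_measure X f \<mu>" "\<forall>\<nu>. physical_measure X f \<nu> \<longrightarrow> \<nu> = \<mu>"
    and lyapunov: "lyapunov_exponents f \<mu> lexp" "\<forall>i\<in>{1..CARD('n)}. 0 < lexp i"
    and stable: "mse_stable P \<xi> X f h K"
  shows "ereal (real CARD('m) * ln (1 - p)) + 2 * ks_entropy f \<mu> < 0"
proof -
  let ?J = "\<lambda>x. jacobian f (at x)"
  define I where "I = (\<integral>x. ln \<bar>det (?J x)\<bar> \<partial>\<mu>)"
  obtain U where U: "X \<subseteq> U" "continuous_on U ?J" "continuous_on U f"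
    using C_on_jacobian[OF smooth(2,1)] by metis
  have cf: "continuous_on X f" and cJ: "continuous_on X ?J"
    using U continuous_on_subset by blast+
  define c where "c = max 1 (1 / sqrt a)"
  have expand: "norm v \<le> c * norm (?J x *v v)" if "x \<in> X" for x v
    unfolding c_def using jacobian_bounds(3) that by (intro mat_le_imp_norm_le jacobian_bounds(1)) blast
  have dnz: "det (?J x) \<noteq> 0" if "x \<in> X" for x
    by (rule expansion_imp_det_nonzero[OF expand[OF that]])
  have log_cont: "continuous_on X (\<lambda>x. ln \<bar>det (?J x)\<bar>)"
    by (intro continuous_on_ln continuous_on_rabs continuous_on_det cJ) (use dnz in auto)
  have inv: "invariant_prob X f \<mu>" using physical(1) by (simp add: physical_measure_def ergodic_prob_def)
  have mp: "measure_preserving_map \<mu> f" by (rule invariant_prob_imp_measure_preserving[OF inv cf maps(1)])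
  have sets: "sets \<mu> = sets (restrict_space borel X)" using inv by (simp add: invariant_prob_def)
  have "AE x in \<mu>. \<exists>\<Lambda>. lyapunov_matrix f x \<Lambda> \<and>
      (\<forall>z. det (mat z - \<Lambda>) = (\<Prod>i=1..CARD('n). z - exp (lexp i)))"
    using lyapunov(1) by (simp add: lyapunov_exponents_def)
  then have "AE x in \<mu>. \<forall>\<^sub>F t in sequentially. \<forall>v. norm v \<le> norm (deriv_cocycle f x t *v v)"
  proof (rule AE_mp, intro AE_I2 impI)
    fix x assume "\<exists>\<Lambda>. lyapunov_matrix f x \<Lambda> \<and>
      (\<forall>z. det (mat z - \<Lambda>) = (\<Prod>i=1..CARD('n). z - exp (lexp i)))"
    then obtain \<Lambda> where L: "lyapunov_matrix f x \<Lambda>"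
      "\<And>z. det (mat z - \<Lambda>) = (\<Prod>i=1..CARD('n). z - exp (lexp i))" by blast
    show "\<forall>\<^sub>F t in sequentially. \<forall>v. norm v \<le> norm (deriv_cocycle f x t *v v)"
      by (rule positive_exponents_imp_eventually_expanding[OF L]) (use lyapunov(2) in blast)
  qed
  then have rate: "lim (\<lambda>n. partition_entropy \<mu> (iterated_join f \<mu> \<P> n) / real n) \<le> I"
    if "finite_partition \<mu> \<P>" for \<P>
    unfolding I_def
    by (intro entropy_rate_le_integral_log_jacobian[OF mp sets state_space(1) maps(1) smooth(2,1) expand _ _ that])
      (auto simp: c_def)
  have ks: "ks_entropy f \<mu> \<le> ereal I"
    unfolding ks_entropy_def by (rule SUP_least) (simp add: rate)
  obtain A where A: "A \<subseteq> X" "A \<in> sets lebesgue" "0 < emeasure lebesgue A"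
    and birkhoff: "\<And>x \<phi>. \<lbrakk>x \<in> A; continuous_on X \<phi>\<rbrakk> \<Longrightarrow>
      (\<lambda>n. (\<Sum>k=0..n. \<phi> ((f ^^ k) x)) / real n) \<longlonglongrightarrow> (\<integral>x. (\<phi> x :: real) \<partial>\<mu>)"
    using physical(1) unfolding physical_measure_def by blast
  have nA: "\<not> negligible A"
    using A(3) by (auto simp: negligible_iff_null_sets null_sets_def)
  have "real CARD('m) * ln (1 - p) + 2 * I < 0"
  proof (rule mse_stable_imp_volume_growth_bound[OF state_space(1) channel maps(1) smooth(2) maps(2) smooth(3,1)
        gain(3,2) dnz _ stable A(1) nA])
    show "observer f h K \<zeta> x y t \<in> X" if "x \<in> X" "y \<in> X" "\<And>s. \<zeta> s \<in> {0, 1}" for x y \<zeta> t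
      using observer_in_X that by blast
    show "(\<lambda>n. (\<Sum>k=0..n. ln \<bar>det (?J ((f ^^ k) x))\<bar>) / real n) \<longlonglongrightarrow> I" if "x \<in> A" for x
      unfolding I_def by (rule birkhoff[OF that log_cont])
  qed
  moreover have "ereal (real CARD('m) * ln (1 - p)) + 2 * ks_entropy f \<mu>
      \<le> ereal (real CARD('m) * ln (1 - p)) + 2 * ereal I"
    by (intro add_left_mono ereal_mult_left_mono ks) simp
  moreover have "ereal (real CARD('m) * ln (1 - p)) + 2 * ereal I = ereal (real CARD('m) * ln (1 - p) + 2 * I)"
    unfolding numeral_eq_ereal times_ereal.simps(1) plus_ereal.simps(1) ..
  ultimately show ?thesis
    by (simp add: order_le_less_trans)
qed

end
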